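(* Let $0<\theta\le1$ and assume that Hypothesis $R(\theta)$ (defined in the context) holds. Put $N=\lfloor 2/\theta\rfloor$. Then for all real $x>3$, \[ s_\Gamma^{(N)}(x)\gg\frac{x}{\log x}, \] i.e. there is a constant $c>0$, independent of $x$, such that $s_\Gamma^{(N)}(x)\ge c\,x/\log x$ for all $x>3$. In particular, Hypothesis $R(1/2)$ implies $s_\Gamma^{(4)}(x)\gg x/\log x$.
   Context: For an integer $k\ge1$, $s_\Gamma^{(k)}(x)$ denotes the number of quadruples $(x_1,x_2,x_3,x_4)\in\mathbb{Z}^4$ with $x_1x_4-x_2x_3=1$ such that the integer $n=x_1^2+x_2^2+x_3^2+x_4^2$ satisfies $n\le x$, $n$ is square-free, and $\omega(n)\le k$, where $\omega(n)$ is the number of distinct prime factors of $n$. Let $r(m)$ denote the number of representations of $m$ as a sum of two squares of integers, i.e. the number of $(a,b)\in\mathbb{Z}^2$ with $a^2+b^2=m$. Let $\chi_4$ be the non-principal Dirichlet character modulo $4$, and for odd positive integers $d$ put \[ g(d)=\frac1d\prod_{p\mid d}\frac{p-\chi_4(p)}{p+\chi_4(p)}, \] the product being over primes $p$ dividing $d$. Hypothesis $R(\theta)$: for every $\varepsilon>0$ and every $A>0$, \[ \sum_{\substack{d\le x^{\theta-\varepsilon}\\ d\ \text{odd, square-free}}}\left|\sum_{\substack{n\le x\\ n\equiv3\ (\mathrm{mod}\ 4)\\ n\equiv0\ (\mathrm{mod}\ d)}}r(n-2)\,r(n+2)-8g(d)x\right|\ll\frac{x}{(\log x)^A} \] for all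 $x\ge2$, with an implied constant depending only on $\varepsilon$ and $A$; here $n$ and $d$ run over positive integers. *)

theory Defs
  imports Complex_Main "HOL-Computational_Algebra.Computational_Algebra"
begin

definition omega :: "nat \<Rightarrow> nat" where
  "omega n = card (prime_factors n)"

definition s_Gamma :: "nat \<Rightarrow> real \<Rightarrow> nat" where
  "s_Gamma k x = card {(x1 :: int, x2 :: int, x3 :: int, x4 :: int).
     x1 * x4 - x2 * x3 = 1 \<and>
     (\<exists>n :: nat. int n = x1\<^sup>2 + x2\<^sup>2 + x3\<^sup>2 + x4\<^sup>2 \<and>
        real n \<le> x \<and> squarefree n \<and> omega n \<le> k)}"

definition r :: "nat \<Rightarrow> nat" where
  "r m = card {(a :: int, b :: int). a\<^sup>2 + b\<^sup>2 = int m}"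

definition chi4 :: "nat \<Rightarrow> real" where
  "chi4 n = (if n mod 4 = 1 then 1 else if n mod 4 = 3 then -1 else 0)"

definition g :: "nat \<Rightarrow> real" where
  "g d = 1 / real d * (\<Prod>p\<in>prime_factors d. (real p - chi4 p) / (real p + chi4 p))"

(* Natural-number subtraction in n - 2 never truncates, as n mod 4 = 3 forces n \<ge> 3.
   Both summation ranges are bounded, hence finite. *)
definition hypothesis_R :: "real \<Rightarrow> bool" where
  "hypothesis_R \<theta> \<longleftrightarrow>
     (\<forall>\<epsilon>>0. \<forall>A>0. \<exists>C>0. \<forall>x::real. x \<ge> 2 \<longrightarrow>
        (\<Sum>d | d > 0 \<and> real d \<le> x powr (\<theta> - \<epsilon>) \<and> odd d \<and> squarefree d.
           \<bar>real (\<Sum>n | n > 0 \<and> real n \<le> x \<and> n mod 4 = 3 \<and> d dvd n. r (n - 2) * r (n + 2))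
              - 8 * g d * x\<bar>)
        \<le> C * (x / ln x powr A))"

end

theory Submission
  imports Defs "HOL-Analysis.Analysis" "HOL-Real_Asymp.Real_Asymp"
begin

text \<open>Writing \<open>n + 2 = (x1 + x4)\<^sup>2 + (x2 - x3)\<^sup>2\<close> and \<open>n - 2 = (x1 - x4)\<^sup>2 + (x2 + x3)\<^sup>2\<close> shows that an
  \<open>n \<equiv> 3 (mod 4)\<close> is hit by at least \<open>r (n - 2) * r (n + 2) / 2\<close> matrices.  Sieving this weight with level
  \<open>D = x powr (\<theta> - \<epsilon>)\<close> by all odd primes below \<open>z = D powr (1 / (2 + \<delta>))\<close> leaves \<open>n\<close> whose prime factors exceed
  \<open>z\<close>, hence with at most \<open>2 / \<theta>\<close> of them, and the few \<open>n\<close> divisible by the square of a prime \<open>p \<ge> z\<close>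
  are negligible because \<open>r (m)\<close> is \<open>O (m powr \<kappa>)\<close> for every \<open>\<kappa> > 0\<close>.

  What makes \<open>\<lfloor>2 / \<theta>\<rfloor>\<close> attainable is that the linear sieve has sifting limit exactly 2.  The Jurkat-Richert
  functions \<open>F, f\<close> are obtained from the solutions \<open>s (F \<plusminus> f)\<close> of two scalar delay equations; \<open>f (2) = 0\<close>
  holds because the equation for \<open>F - f\<close> has the adjoint solution \<open>s - 1\<close>, which also forces \<open>F - f\<close> to be positive
  and to decay faster than exponentially.  Shifting the argument of \<open>F - 1\<close> and \<open>1 - f\<close> by a small \<open>\<eta>\<close> and adding a small
  multiple of \<open>exp (- s)\<close> turns the integral equations into strict inequalities, and this slack
  absorbs the errors of Mertens' theorem at every step of the Buchstab recursion at once.\<close>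

section \<open>Delay differential equations of the linear sieve\<close>

text \<open>The depth of the Buchstab recursion grows with \<open>x\<close>, so a loss of a factor
  \<open>1 + \<epsilon>\<close> per level could compound without bound. A bound survives only if one
  level together with its loss reproduces the same bound; hence strict inequalities instead of the
  exact functions. The shift alone cannot provide them for large \<open>s\<close>: it gains
  \<open>\<eta> / s\<close> times the value at \<open>s\<close>, while the loss involves the value
  at \<open>s - 1\<close>, and for functions decaying faster than exponentially the quotient of the
  two is unbounded. The added exponential has the constant quotient \<open>exp 1\<close>, so one
  small \<open>\<epsilon>\<close> serves all \<open>s\<close>. The remainders must not pick up
  weights either, since hypothesis R bounds a plain sum over \<open>d\<close>. Cutting each divisor
  at its largest prime follows the Buchstab identity exactly, so every \<open>remainder d\<close>
  enters once, in absolute value. The classical constant in front of F and f, twice the exponential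
  of Euler's constant, is never computed: division by the supremum of the unnormalised lower
  function gives both functions the limit 1.\<close>

primrec delay_iter :: "real \<Rightarrow> nat \<Rightarrow> real \<Rightarrow> real" where
  "delay_iter \<sigma> 0 s = 1"
| "delay_iter \<sigma> (Suc n) s = 1 + \<sigma> * integral {1..max 1 (s - 1)} (\<lambda>t. delay_iter \<sigma> n t / t)"

lemma integral_upto_has_derivative:
  fixes h :: "real \<Rightarrow> real"
  assumes "continuous_on {a..} h" "a < x"
  shows "((\<lambda>x. integral {a..x} h) has_real_derivative h x) (at x)"
proof -
  have "continuous_on {a..x+1} h"
    using assms(1) by (rule continuous_on_subset) auto
  then have "((\<lambda>x. integral {a..x} h) has_real_derivative h x) (at x within {a..x+1})"
    using assms(2) by (intro integral_has_real_derivative) auto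
  moreover have "at x within {a..x+1} = at x"
    by (rule at_within_interior) (use assms in auto)
  ultimately show ?thesis by simp
qed

lemma continuous_on_integral_upto:
  fixes h :: "real \<Rightarrow> real"
  assumes "continuous_on {a..} h"
  shows "continuous_on {a..} (\<lambda>x. integral {a..x} h)"
proof -
  have c: "continuous_on {a..b} (\<lambda>x. integral {a..x} h)" for b
    by (intro indefinite_integral_continuous_1 integrable_continuous_real
        continuous_on_subset[OF assms]) auto
  have "isCont (\<lambda>x. integral {a..x} h) x" if "x > a" for x
    using DERIV_isCont[OF integral_upto_has_derivative[OF assms that]] .
  moreover have "continuous (at a within {a..}) (\<lambda>x. integral {a..x} h)"
  proof -
    have "continuous (at a within {a..a+1}) (\<lambda>x. integral {a..x} h)"
      using c[of "a + 1"]
      by (simp add: continuous_on_eq_continuous_within)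
    moreover have "at a within {a..a+1} = at a within {a..}"
      by (rule at_within_nhd[where S="{a-1<..<a+1}"]) auto
    ultimately show ?thesis by simp
  qed
  ultimately show ?thesis
    unfolding continuous_on_eq_continuous_within
    by (metis atLeast_iff continuous_at_imp_continuous_at_within le_less)
qed

lemma continuous_delay_iter: "continuous_on UNIV (delay_iter \<sigma> n)"
proof (induction n)
  case 0
  have "delay_iter \<sigma> 0 = (\<lambda>s. 1)" by auto
  then show ?case by simp
next
  case (Suc n)
  have "continuous_on {1..} (\<lambda>t. delay_iter \<sigma> n t / t)"
    by (intro continuous_intros continuous_on_subset[OF Suc]) auto
  from continuous_on_integral_upto[OF this]
  have "continuous_on UNIV (\<lambda>s. integral {1..max 1 (s-1)} (\<lambda>t. delay_iter \<sigma> n t / t))"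
    by (rule continuous_on_compose2) (auto intro!: continuous_intros)
  then have "continuous_on UNIV (\<lambda>s. delay_iter \<sigma> (Suc n) s)"
    by (auto intro!: continuous_intros)
  then show ?case by simp
qed

text \<open>The integral that defines an iterate at \<open>s\<close> sees the previous iterate only
  up to \<open>s - 1\<close>, so each iteration extends the agreement by one unit. It starts at 2
  because \<open>max 1 (s - 1)\<close> collapses the interval there.\<close>

lemma delay_iter_Suc: "s \<le> real n + 2 \<Longrightarrow> delay_iter \<sigma> (Suc n) s = delay_iter \<sigma> n s"
proof (induction n arbitrary: s)
  case 0
  then have "max 1 (s - 1) = 1" by auto
  then show ?case by simp
next
  case (Suc n)
  have "integral {1..max 1 (s-1)} (\<lambda>t. delay_iter \<sigma> (Suc n) t / t)
      = integral {1..max 1 (s-1)} (\<lambda>t. delay_iter \<sigma> n t / t)"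
  proof (rule Henstock_Kurzweil_Integration.integral_cong)
    fix t assume "t \<in> {1..max 1 (s-1)}"
    then show "delay_iter \<sigma> (Suc n) t / t = delay_iter \<sigma> n t / t"
      using Suc.prems Suc.IH[of t] by (auto simp: max_def split: if_splits)
  qed
  then show ?case by (simp only: delay_iter.simps)
qed

lemma delay_iter_eq:
  assumes "n \<le> m" "s \<le> real n + 2"
  shows "delay_iter \<sigma> m s = delay_iter \<sigma> n s"
  using assms
proof (induction m rule: dec_induct)
  case (step k)
  then show ?case using delay_iter_Suc[of s k \<sigma>] by auto
qed simp

text \<open>Each iterate is already exact for \<open>s \<le> n + 2\<close>, so no limit is needed.\<close>

definition delay :: "real \<Rightarrow> real \<Rightarrow> real" where
  "delay \<sigma> s = delay_iter \<sigma> (nat \<lceil>s\<rceil>) s"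

lemma delay_eq_iter:
  assumes "s \<le> real n + 2"
  shows "delay \<sigma> s = delay_iter \<sigma> n s"
proof (cases "nat \<lceil>s\<rceil> \<le> n")
  case True
  have "s \<le> real (nat \<lceil>s\<rceil>) + 2" by linarith
  with True show ?thesis unfolding delay_def by (metis delay_iter_eq)
next
  case False
  then have "n \<le> nat \<lceil>s\<rceil>" by linarith
  then show ?thesis unfolding delay_def using assms by (rule delay_iter_eq)
qed

lemma isCont_delay: "isCont (delay \<sigma>) s"
proof -
  define n where "n = nat \<lceil>s\<rceil>"
  have "isCont (delay_iter \<sigma> n) s"
    using continuous_delay_iter by (simp add: continuous_on_eq_continuous_at)
  moreover have "s < real n + 2" unfolding n_def by linarith
  then have ev: "\<forall>\<^sub>F t in nhds s. delay \<sigma> t = delay_iter \<sigma> n t"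
    by (intro eventually_mono[OF eventually_nhds_in_open[of "{..<real n + 2}"]])
      (auto intro!: delay_eq_iter)
  ultimately show ?thesis by (simp add: isCont_cong[OF ev])
qed

lemma continuous_on_delay: "continuous_on S (delay \<sigma>)"
  by (simp add: continuous_at_imp_continuous_on isCont_delay)

lemma delay_initial: "s \<le> 2 \<Longrightarrow> delay \<sigma> s = 1"
  using delay_eq_iter[of s 0 \<sigma>] by simp

lemma delay_deriv:
  assumes "s > 2"
  shows "(delay \<sigma> has_real_derivative \<sigma> * delay \<sigma> (s - 1) / (s - 1)) (at s)"
proof -
  define n where "n = nat \<lceil>s\<rceil>"
  have c: "continuous_on {1..} (\<lambda>t. delay_iter \<sigma> n t / t)"
    by (intro continuous_intros continuous_on_subset[OF continuous_delay_iter]) auto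
  have "((\<lambda>x. integral {1..x} (\<lambda>t. delay_iter \<sigma> n t / t)) has_real_derivative
      delay_iter \<sigma> n (s - 1) / (s - 1)) (at (s - 1))"
    by (rule integral_upto_has_derivative[OF c]) (use assms in simp)
  then have "((\<lambda>x. integral {1..x} (\<lambda>t. delay_iter \<sigma> n t / t)) has_real_derivative
      delay_iter \<sigma> n (s - 1) / (s - 1)) (at (s + (-1)))"
    by simp
  then have "((\<lambda>x. integral {1..x + (-1)} (\<lambda>t. delay_iter \<sigma> n t / t)) has_real_derivative
      delay_iter \<sigma> n (s - 1) / (s - 1)) (at s)"
    by (subst DERIV_shift[symmetric])
  then have d: "((\<lambda>x. 1 + \<sigma> * integral {1..x - 1} (\<lambda>t. delay_iter \<sigma> n t / t)) has_real_derivative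
      \<sigma> * delay_iter \<sigma> n (s - 1) / (s - 1)) (at s)"
    by (auto intro!: derivative_eq_intros)
  have e: "delay \<sigma> (s - 1) = delay_iter \<sigma> n (s - 1)"
    by (rule delay_eq_iter) (simp add: n_def; linarith)
  have "(delay \<sigma> has_real_derivative \<sigma> * delay_iter \<sigma> n (s - 1) / (s - 1)) (at s)"
  proof (rule has_field_derivative_transform_within_open[OF d])
    show "open {2<..<real n + 2}" "s \<in> {2<..<real n + 2}"
      using assms unfolding n_def by (simp_all, linarith)
    fix x assume x: "x \<in> {2<..<real n + 2}"
    then have "delay \<sigma> x = delay_iter \<sigma> (Suc n) x"
      by (intro delay_eq_iter) auto
    then show "1 + \<sigma> * integral {1..x - 1} (\<lambda>t. delay_iter \<sigma> n t / t) = delay \<sigma> x"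
      using x by (simp add: max_def)
  qed
  then show ?thesis by (simp only: e)
qed

text \<open>Continuity makes the failing set closed, so it would have a least element, where
  \<open>step\<close> gives a contradiction. At \<open>s = a\<close> the premise of
  \<open>step\<close> is vacuous, so \<open>step\<close> also supplies the start.\<close>

lemma first_failure:
  fixes m :: "real \<Rightarrow> real"
  assumes c: "continuous_on {a..} m"
    and step: "\<And>s. s \<ge> a \<Longrightarrow> (\<And>t. a \<le> t \<Longrightarrow> t < s \<Longrightarrow> m t > 0) \<Longrightarrow> m s > 0"
    and s: "s \<ge> a"
  shows "m s > 0"
proof (rule ccontr)
  assume "\<not> m s > 0"
  define A where "A = {a..} \<inter> m -` {..0}"
  have cl: "closed A"
    unfolding A_def using c by (intro continuous_closed_preimage) auto
  have ne: "A \<noteq> {}" and bb: "bdd_below A"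
    using s \<open>\<not> m s > 0\<close> by (auto simp: A_def intro!: bdd_belowI[of _ a])
  have i: "Inf A \<in> A" by (rule closed_contains_Inf[OF ne bb cl])
  have pos: "m t > 0" if t: "a \<le> t" "t < Inf A" for t
  proof (rule ccontr)
    assume "\<not> m t > 0"
    then have "t \<in> A" using t by (simp add: A_def)
    then show False using cInf_lower[OF _ bb, of t] t by simp
  qed
  have "m (Inf A) > 0"
  proof (rule step)
    show "a \<le> Inf A" using i by (simp add: A_def)
  qed (rule pos)
  with i show False by (auto simp: A_def)
qed

section \<open>Positivity and decay of the difference F - f\<close>

abbreviation dickman_like :: "real \<Rightarrow> real" where "dickman_like \<equiv> delay (-1)"
abbreviation buchstab_like :: "real \<Rightarrow> real" where "buchstab_like \<equiv> delay 1"

text \<open>\<open>dickman_like s\<close> is Dickman's function rho at \<open>s - 1\<close>, and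
  this is the classical identity that u rho(u) is the integral of rho from u - 1 to u: the
  difference of both sides has derivative 0 by the delay equation. Writing the value through an
  integral of earlier values is what makes positivity visible, which the differential equation alone
  does not show.\<close>

lemma dickman_like_identity:
  assumes "s \<ge> 2"
  shows "(s - 1) * dickman_like s = integral {1..s} dickman_like - integral {1..s-1} dickman_like"
proof -
  define D where "D = (\<lambda>s. (s - 1) * dickman_like s
      - (integral {1..s} dickman_like - integral {1..s-1} dickman_like))"
  have cI: "continuous_on {1..} (\<lambda>x. integral {1..x} dickman_like)"
    by (intro continuous_on_integral_upto continuous_on_delay)
  have cI': "continuous_on {2..} (\<lambda>x. integral {1..x-1} dickman_like)"
    by (rule continuous_on_compose2[OF cI]) (auto intro!: continuous_intros)
  have dI: "((\<lambda>x. integral {1..x} dickman_like) has_real_derivative dickman_like x) (at x)" if "x > 1" for x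
    by (intro integral_upto_has_derivative continuous_on_delay that)
  have "D s = D 2"
  proof (cases "s = 2")
    case False
    show ?thesis
    proof (rule DERIV_isconst_end[where a = 2 and b = s])
      show "2 < s" using assms False by simp
      show "continuous_on {2..s} D" unfolding D_def
        by (intro continuous_intros continuous_on_delay continuous_on_subset[OF cI]
            continuous_on_subset[OF cI']) auto
      fix x :: real assume x: "2 < x" "x < s"
      have "((\<lambda>x. integral {1..x - 1} dickman_like) has_real_derivative dickman_like (x - 1)) (at x)"
        using dI[of "x - 1"] x
          DERIV_shift[of "\<lambda>x. integral {1..x} dickman_like" "dickman_like (x - 1)" x "-1"]
        by simp
      then show "(D has_real_derivative 0) (at x)"
        unfolding D_def using x
        by (auto intro!: derivative_eq_intros delay_deriv dI simp: field_simps)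
    qed
  qed simp
  moreover have "integral {1..2} dickman_like = integral {1..2::real} (\<lambda>x. 1)"
    by (intro Henstock_Kurzweil_Integration.integral_cong) (auto simp: delay_initial)
  then have "D 2 = 0" by (simp add: D_def delay_initial)
  ultimately show ?thesis by (simp add: D_def)
qed

lemma integral_upto_diff:
  assumes "1 \<le> a" "a \<le> b"
  shows "integral {1..b} (delay \<sigma>) - integral {1..a} (delay \<sigma>) = integral {a..b} (delay \<sigma>)"
  using Henstock_Kurzweil_Integration.integral_combine[of 1 a b "delay \<sigma>"] assms
  by (simp add: integrable_continuous_real continuous_on_delay)

lemma dickman_like_pos: "dickman_like s > 0"
proof (cases "s \<ge> 2")
  case True
  show ?thesis
  proof (rule first_failure[where a = 2 and m = dickman_like, OF continuous_on_delay _ True])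
    fix s :: real assume s: "2 \<le> s" and IH: "\<And>t. 2 \<le> t \<Longrightarrow> t < s \<Longrightarrow> dickman_like t > 0"
    have p: "dickman_like t > 0" if "t < s" for t
      using IH[of t] that delay_initial[of t "-1"] by (cases "t \<ge> 2") auto
    have "integral {s-1..s} dickman_like > integral {s-1..s} (\<lambda>x. 0)"
      by (rule integral_less_real) (use p in \<open>auto simp: continuous_on_delay\<close>)
    then have "(s - 1) * dickman_like s > 0"
      using dickman_like_identity[OF s] integral_upto_diff[of "s - 1" s "-1"] s by simp
    then show "dickman_like s > 0" using s by (simp add: zero_less_mult_iff)
  qed
qed (simp add: delay_initial)

lemma dickman_like_antimono:
  assumes "a \<le> b" shows "dickman_like b \<le> dickman_like a"
proof -
  have *: "dickman_like b \<le> dickman_like a" if "2 \<le> a" "a \<le> b" for a b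
  proof (rule DERIV_nonpos_imp_decreasing_open[OF that(2) _ continuous_on_delay])
    fix x assume "a < x" "x < b"
    then show "\<exists>y. (dickman_like has_real_derivative y) (at x) \<and> y \<le> 0"
      using that delay_deriv[of x "-1"] dickman_like_pos[of "x - 1"]
      by (intro exI[of _ "-1 * dickman_like (x - 1) / (x - 1)"]) (auto simp: divide_simps)
  qed
  show ?thesis
    using assms *[of a b] *[of 2 b] delay_initial[of a "-1"] delay_initial[of b "-1"] delay_initial[of 2 "-1"]
    by (cases "a \<ge> 2"; cases "b \<ge> 2") auto
qed

lemma dickman_like_step:
  assumes "s \<ge> 2" shows "(s - 1) * dickman_like s \<le> dickman_like (s - 1)"
proof -
  have "integral {s-1..s} dickman_like \<le> integral {s-1..s} (\<lambda>x. dickman_like (s - 1))"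
    by (rule integral_le)
      (auto intro: integrable_continuous_real continuous_on_delay dickman_like_antimono)
  then show ?thesis
    using dickman_like_identity[OF assms] integral_upto_diff[of "s - 1" s "-1"] assms by simp
qed

text \<open>Beyond 4 the factor \<open>s - 1\<close> of \<open>dickman_like_step\<close> exceeds
  \<open>3 \<ge> exp 1\<close>, so every unit step gains a factor \<open>exp (- 1)\<close>; up to 4
  the bound by 1 suffices and fixes the constant \<open>exp 4\<close>.\<close>

lemma dickman_like_decay: "dickman_like s \<le> exp 4 * exp (- s)"
proof -
  have le1: "dickman_like s \<le> 1" for s
    using dickman_like_antimono[of "min s 2" s] delay_initial[of "min s 2" "-1"] by simp
  have "\<forall>s \<le> real n + 4. dickman_like s \<le> exp (4 - s)" for n
  proof (induction n)
    case 0
    show ?case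
    proof (intro allI impI)
      fix s :: real assume "s \<le> real 0 + 4"
      then have "1 \<le> exp (4 - s)" by simp
      then show "dickman_like s \<le> exp (4 - s)" using le1[of s] by linarith
    qed
  next
    case (Suc n)
    show ?case
    proof (intro allI impI)
      fix s :: real assume s: "s \<le> real (Suc n) + 4"
      show "dickman_like s \<le> exp (4 - s)"
      proof (cases "s \<le> 4")
        case True then show ?thesis using Suc by auto
      next
        case False
        then have "exp 1 * dickman_like s \<le> (s - 1) * dickman_like s"
          using exp_le dickman_like_pos[of s] by (intro mult_right_mono) auto
        also have "\<dots> \<le> dickman_like (s - 1)" by (rule dickman_like_step) (use False in simp)
        also have "\<dots> \<le> exp (4 - (s - 1))" using Suc[rule_format, of "s - 1"] s by simp
        also have "\<dots> = exp 1 * exp (4 - s)" by (simp add: exp_add[symmetric])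
        finally show ?thesis by simp
      qed
    qed
  qed
  moreover have "s \<le> real (nat \<lceil>s\<rceil>) + 4" by linarith
  ultimately have "dickman_like s \<le> exp (4 - s)" by blast
  then show ?thesis by (simp add: exp_add[symmetric])
qed

section \<open>The Jurkat-Richert functions F and f up to a common constant factor\<close>

definition upper_fun :: "real \<Rightarrow> real" where
  "upper_fun s = (buchstab_like s + dickman_like s) / (2 * s)"

definition lower_fun :: "real \<Rightarrow> real" where
  "lower_fun s = (buchstab_like s - dickman_like s) / (2 * s)"

lemma upper_fun_initial: "s \<le> 2 \<Longrightarrow> upper_fun s = 1 / s"
  by (simp add: upper_fun_def delay_initial)

lemma lower_fun_initial: "s \<le> 2 \<Longrightarrow> lower_fun s = 0"
  by (simp add: lower_fun_def delay_initial)

lemma lower_less_upper: "s > 0 \<Longrightarrow> lower_fun s < upper_fun s"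
  using dickman_like_pos[of s] by (simp add: upper_fun_def lower_fun_def divide_simps)

lemma upper_minus_lower: "upper_fun s - lower_fun s = dickman_like s / s"
  by (simp add: upper_fun_def lower_fun_def diff_divide_distrib[symmetric])

lemma times_upper_deriv:
  assumes "s > 2"
  shows "((\<lambda>s. s * upper_fun s) has_real_derivative lower_fun (s - 1)) (at s)"
proof -
  have "((\<lambda>s. (buchstab_like s + dickman_like s) / 2) has_real_derivative
      (1 * buchstab_like (s - 1) / (s - 1) + -1 * dickman_like (s - 1) / (s - 1)) / 2) (at s)"
    by (intro DERIV_cdivide DERIV_add DERIV_diff delay_deriv assms)
  also have "(1 * buchstab_like (s - 1) / (s - 1) + -1 * dickman_like (s - 1) / (s - 1)) / 2 = lower_fun (s - 1)"
    using assms by (simp add: lower_fun_def divide_simps)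
  finally have "((\<lambda>s. (buchstab_like s + dickman_like s) / 2) has_real_derivative lower_fun (s - 1)) (at s)" .
  then show ?thesis
    by (rule has_field_derivative_transform_within_open[where S = "{2<..}"])
      (use assms in \<open>auto simp: upper_fun_def\<close>)
qed

lemma times_lower_deriv:
  assumes "s > 2"
  shows "((\<lambda>s. s * lower_fun s) has_real_derivative upper_fun (s - 1)) (at s)"
proof -
  have "((\<lambda>s. (buchstab_like s - dickman_like s) / 2) has_real_derivative
      (1 * buchstab_like (s - 1) / (s - 1) - -1 * dickman_like (s - 1) / (s - 1)) / 2) (at s)"
    by (intro DERIV_cdivide DERIV_add DERIV_diff delay_deriv assms)
  also have "(1 * buchstab_like (s - 1) / (s - 1) - -1 * dickman_like (s - 1) / (s - 1)) / 2 = upper_fun (s - 1)"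
    using assms by (simp add: upper_fun_def divide_simps)
  finally have "((\<lambda>s. (buchstab_like s - dickman_like s) / 2) has_real_derivative upper_fun (s - 1)) (at s)" .
  then show ?thesis
    by (rule has_field_derivative_transform_within_open[where S = "{2<..}"])
      (use assms in \<open>auto simp: lower_fun_def\<close>)
qed

lemma upper_deriv:
  assumes "s > 2"
  shows "(upper_fun has_real_derivative (lower_fun (s - 1) - upper_fun s) / s) (at s)"
proof -
  have "((\<lambda>s. (s * upper_fun s) / s) has_real_derivative
      (lower_fun (s - 1) * s - s * upper_fun s * 1) / (s * s)) (at s)"
    by (rule DERIV_divide[OF times_upper_deriv[OF assms] DERIV_ident]) (use assms in simp)
  also have "(lower_fun (s - 1) * s - s * upper_fun s * 1) / (s * s) = (lower_fun (s - 1) - upper_fun s) / s"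
    using assms by (simp add: field_simps)
  finally have "((\<lambda>s. (s * upper_fun s) / s) has_real_derivative (lower_fun (s - 1) - upper_fun s) / s) (at s)" .
  then show ?thesis
    by (rule has_field_derivative_transform_within_open[where S = "{2<..}"]) (use assms in auto)
qed

lemma lower_deriv:
  assumes "s > 2"
  shows "(lower_fun has_real_derivative (upper_fun (s - 1) - lower_fun s) / s) (at s)"
proof -
  have "((\<lambda>s. (s * lower_fun s) / s) has_real_derivative
      (upper_fun (s - 1) * s - s * lower_fun s * 1) / (s * s)) (at s)"
    by (rule DERIV_divide[OF times_lower_deriv[OF assms] DERIV_ident]) (use assms in simp)
  also have "(upper_fun (s - 1) * s - s * lower_fun s * 1) / (s * s) = (upper_fun (s - 1) - lower_fun s) / s"
    using assms by (simp add: field_simps)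
  finally have "((\<lambda>s. (s * lower_fun s) / s) has_real_derivative (upper_fun (s - 1) - lower_fun s) / s) (at s)" .
  then show ?thesis
    by (rule has_field_derivative_transform_within_open[where S = "{2<..}"]) (use assms in auto)
qed

lemma continuous_on_upper: "S \<subseteq> {0<..} \<Longrightarrow> continuous_on S upper_fun"
  unfolding upper_fun_def by (intro continuous_intros continuous_on_delay) auto

lemma continuous_on_lower: "S \<subseteq> {0<..} \<Longrightarrow> continuous_on S lower_fun"
  unfolding lower_fun_def by (intro continuous_intros continuous_on_delay) auto

lemma upper_decreasing_upto:
  assumes "\<And>t. 2 < t \<Longrightarrow> t < s \<Longrightarrow> lower_fun (t - 1) < upper_fun t"
    and "0 < a" "a < b" "b \<le> s"
  shows "upper_fun b < upper_fun a"
proof -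
  have *: "upper_fun b < upper_fun a" if "2 \<le> a" "a < b" "b \<le> s" for a b
  proof (rule DERIV_neg_imp_decreasing_open[OF that(2)])
    fix x assume "a < x" "x < b"
    then show "\<exists>y. (upper_fun has_real_derivative y) (at x) \<and> y < 0"
      using that upper_deriv[of x] assms(1)[of x]
      by (intro exI[of _ "(lower_fun (x - 1) - upper_fun x) / x"]) (auto simp: divide_simps)
  qed (use that in \<open>auto intro!: continuous_on_upper\<close>)
  consider "2 \<le> a" | "b \<le> 2" | "a < 2" "2 < b" by linarith
  then show ?thesis
  proof cases
    case 2
    then show ?thesis using assms by (simp add: upper_fun_initial divide_simps)
  next
    case 3
    then have "upper_fun b < upper_fun 2" using assms by (intro *) auto
    also have "\<dots> < upper_fun a" using 3 assms by (simp add: upper_fun_initial divide_simps)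
    finally show ?thesis .
  qed (use assms * in blast)
qed

lemma lower_increasing_upto:
  assumes "\<And>t. 2 < t \<Longrightarrow> t < s \<Longrightarrow> lower_fun t < upper_fun (t - 1)"
    and "a < b" "2 < b" "b \<le> s"
  shows "lower_fun a < lower_fun b"
proof -
  have *: "lower_fun a < lower_fun b" if "2 \<le> a" "a < b" "b \<le> s" for a b
  proof (rule DERIV_pos_imp_increasing_open[OF that(2)])
    fix x assume "a < x" "x < b"
    then show "\<exists>y. (lower_fun has_real_derivative y) (at x) \<and> y > 0"
      using that lower_deriv[of x] assms(1)[of x]
      by (intro exI[of _ "(upper_fun (x - 1) - lower_fun x) / x"]) (auto simp: divide_simps)
  qed (use that in \<open>auto intro!: continuous_on_lower\<close>)
  show ?thesis
    using assms *[of a b] *[of 2 b] lower_fun_initial[of a] lower_fun_initial[of 2]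
    by (cases "a \<ge> 2") auto
qed

text \<open>Comparison and monotonicity feed each other: the comparisons before \<open>s\<close> fix
  the signs of both derivatives, the resulting monotonicity up to \<open>s\<close> shifts an
  argument by 1, and \<open>lower_fun < upper_fun\<close> at equal arguments does the rest. Applying
  \<open>first_failure\<close> to the minimum of both differences runs this bootstrap.\<close>

lemma upper_lower_shifted:
  assumes "s \<ge> 2"
  shows "lower_fun (s - 1) < upper_fun s" "lower_fun s < upper_fun (s - 1)"
proof -
  define m where "m = (\<lambda>s. min (upper_fun s - lower_fun (s - 1)) (upper_fun (s - 1) - lower_fun s))"
  have "m s > 0"
  proof (rule first_failure[where a = 2 and m = m, OF _ _ assms])
    have "continuous_on {2..} (\<lambda>s. upper_fun (s - 1))" "continuous_on {2..} (\<lambda>s. lower_fun (s - 1))"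
      by (auto intro!: continuous_on_compose2[OF continuous_on_upper[of "{0<..}"]]
          continuous_on_compose2[OF continuous_on_lower[of "{0<..}"]] continuous_intros)
    then show "continuous_on {2..} m"
      unfolding m_def by (intro continuous_intros continuous_on_upper continuous_on_lower) auto
    fix s :: real assume s: "2 \<le> s" and IH: "\<And>t. 2 \<le> t \<Longrightarrow> t < s \<Longrightarrow> 0 < m t"
    have u: "upper_fun s < upper_fun (s - 1)"
      by (rule upper_decreasing_upto[where s = s]) (use IH s in \<open>auto simp: m_def\<close>)
    have l: "lower_fun (s - 1) \<le> lower_fun s"
    proof (cases "s = 2")
      case False
      have "lower_fun (s - 1) < lower_fun s"
        by (rule lower_increasing_upto[where s = s]) (use IH s False in \<open>auto simp: m_def\<close>)
      then show ?thesis by simp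
    qed (simp add: lower_fun_initial)
    show "0 < m s" using u l lower_less_upper[of s] s by (auto simp: m_def)
  qed
  then show "lower_fun (s - 1) < upper_fun s" "lower_fun s < upper_fun (s - 1)"
    by (auto simp: m_def)
qed

lemma upper_decreasing: "0 < a \<Longrightarrow> a < b \<Longrightarrow> upper_fun b < upper_fun a"
  by (rule upper_decreasing_upto[where s = b]) (auto intro: upper_lower_shifted)

lemma lower_increasing: "a < b \<Longrightarrow> 2 < b \<Longrightarrow> lower_fun a < lower_fun b"
  by (rule lower_increasing_upto[where s = b]) (auto intro: upper_lower_shifted)

lemma lower_mono: "a \<le> b \<Longrightarrow> lower_fun a \<le> lower_fun b"
  using lower_increasing[of a b] lower_fun_initial[of a] lower_fun_initial[of b]
  by (cases "a = b"; cases "2 < b") auto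

lemma lower_pos: "s > 2 \<Longrightarrow> lower_fun s > 0"
  using lower_increasing[of 2 s] lower_fun_initial[of 2] by simp

text \<open>Monotonicity moves both values to the larger of the two arguments. The separation puts a
  single number between all lower and all upper values, which later serves as their common
  limit.\<close>

lemma lower_less_upper_any:
  assumes "0 < a" "0 < b" shows "lower_fun b < upper_fun a"
proof (cases "a \<le> b")
  case True
  then show ?thesis
    using lower_less_upper[of b] upper_decreasing[of a b] assms by (cases "a = b") auto
next
  case False
  then show ?thesis using lower_mono[of b a] lower_less_upper[of a] assms by simp
qed

section \<open>Sieve functions with slack\<close>

text \<open>Turns a delay equation into a bound on finite differences, the only form in which the
  sieve uses it; no integral has to be carried into the partial summation.\<close>

lemma increment_ge_of_deriv:
  fixes B \<phi> :: "real \<Rightarrow> real"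
  assumes "a \<le> b" "continuous_on {a..b} B"
    and "\<And>x. a < x \<Longrightarrow> x < b \<Longrightarrow> (B has_real_derivative - \<phi> (x - 1)) (at x)"
    and "\<And>x. a < x \<Longrightarrow> x < b \<Longrightarrow> \<phi> (b - 1) \<le> \<phi> (x - 1)"
  shows "(b - a) * \<phi> (b - 1) \<le> B a - B b"
proof (cases "a = b")
  case False
  then have "\<exists>l z. a < z \<and> z < b \<and> (B has_real_derivative l) (at z) \<and> B b - B a = (b - a) * l"
    using assms by (intro MVT) (auto intro: real_differentiable_def[THEN iffD2])
  then obtain l z where z: "a < z" "z < b" "(B has_real_derivative l) (at z)" "B b - B a = (b - a) * l"
    by blast
  have "l = - \<phi> (z - 1)" using DERIV_unique[OF z(3) assms(3)[OF z(1,2)]] .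
  then have "B a - B b = (b - a) * \<phi> (z - 1)" using z(4) by (simp add: algebra_simps)
  then show ?thesis using assms(4)[OF z(1,2)] assms(1) by (simp add: mult_left_mono)
qed simp

text \<open>\<open>\<phi>p\<close> is F - 1 and \<open>\<phi>m\<close> is 1 - f. After division by
  the supremum \<open>c\<close> of \<open>lower_fun\<close> the two functions lie on opposite sides
  of 1, so the two deviations are positive and add up to \<open>dickman_like s / (c * s)\<close>;
  one decay estimate therefore bounds both.\<close>

lemma linear_sieve_functions:
  obtains \<phi>p \<phi>m :: "real \<Rightarrow> real" and C :: real
  where "\<And>s. s \<le> 2 \<Longrightarrow> \<phi>m s = 1" "\<And>s. s > 2 \<Longrightarrow> \<phi>m s < 1"
    "\<And>s. \<phi>m s > 0" "\<And>s. s > 0 \<Longrightarrow> \<phi>p s > 0"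
    "\<And>a b. a \<le> b \<Longrightarrow> \<phi>m b \<le> \<phi>m a"
    "\<And>a b. 0 < a \<Longrightarrow> a \<le> b \<Longrightarrow> \<phi>p b \<le> \<phi>p a"
    "\<And>a b. 0 < a \<Longrightarrow> a \<le> b \<Longrightarrow> (b - a) * \<phi>m (b - 1) \<le> a * \<phi>p a - b * \<phi>p b"
    "\<And>a b. 2 \<le> a \<Longrightarrow> a \<le> b \<Longrightarrow> (b - a) * \<phi>p (b - 1) \<le> a * \<phi>m a - b * \<phi>m b"
    "C > 0"
    "\<And>s. \<phi>m s \<le> C * exp (- s)" "\<And>s. s \<ge> 1/2 \<Longrightarrow> \<phi>p s \<le> C * exp (- s)"
proof -
  define c where "c = (SUP s. lower_fun s)"
  have bdd: "bdd_above (range lower_fun)"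
  proof (rule bdd_aboveI[of _ "upper_fun 1"])
    fix y assume "y \<in> range lower_fun"
    then obtain t where "y = lower_fun t" by blast
    then show "y \<le> upper_fun 1"
      using lower_less_upper_any[of 1 t] lower_fun_initial[of t] upper_fun_initial[of 1]
      by (cases "t > 0") auto
  qed
  have lc: "lower_fun s \<le> c" for s unfolding c_def by (rule cSUP_upper[OF _ bdd]) simp
  have lc': "lower_fun s < c" for s
  proof -
    have "lower_fun s < lower_fun (max s 2 + 1)" by (rule lower_increasing) auto
    then show ?thesis using lc[of "max s 2 + 1"] by linarith
  qed
  have cu: "c \<le> upper_fun s" if "s > 0" for s
    unfolding c_def
  proof (rule cSUP_least)
    fix t show "lower_fun t \<le> upper_fun s"
      using lower_less_upper_any[OF that, of t] lower_fun_initial[of t] lower_less_upper_any[OF that, of 1] lower_fun_initial[of 1]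
      by (cases "t > 0") auto
  qed simp
  have cu': "c < upper_fun s" if "s > 0" for s
    using upper_decreasing[of s "s + 1"] cu[of "s + 1"] that by auto
  have c0: "c > 0" using lower_pos[of 3] lc[of 3] by simp
  define \<phi>p where "\<phi>p = (\<lambda>s. upper_fun s / c - 1)"
  define \<phi>m where "\<phi>m = (\<lambda>s. 1 - lower_fun s / c)"
  \<comment> \<open>The first summand stems from \<open>1 / s \<le> 2\<close> on
    \<open>s \<ge> 1/2\<close>, the second from \<open>\<phi>m s = 1\<close> on
    \<open>s \<le> 2\<close>.\<close>
  define C where "C = 2 * exp 4 / c + exp 2"
  have C0: "C > 0" using c0 by (simp add: C_def add_pos_pos)
  have sum: "\<phi>p s + \<phi>m s = dickman_like s / (c * s)" for s
    using upper_minus_lower[of s] by (simp add: \<phi>p_def \<phi>m_def diff_divide_distrib[symmetric] mult.commute)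
  have pp: "\<phi>p s > 0" if "s > 0" for s
    using cu'[OF that] c0 by (simp add: \<phi>p_def)
  have mp: "\<phi>m s > 0" for s using lc'[of s] c0 by (simp add: \<phi>m_def)
  have dec: "\<phi>p s + \<phi>m s \<le> 2 * exp 4 / c * exp (- s)" if "s \<ge> 1/2" for s
  proof -
    have "dickman_like s / (c * s) \<le> dickman_like s / (c / 2)"
      using that c0 dickman_like_pos[of s] by (intro divide_left_mono) auto
    also have "\<dots> \<le> (exp 4 * exp (- s)) / (c / 2)"
      using c0 by (intro divide_right_mono dickman_like_decay) auto
    finally show ?thesis by (simp add: sum mult_ac)
  qed
  have pm_anti: "\<phi>p b \<le> \<phi>p a" if "0 < a" "a \<le> b" for a b
    using upper_decreasing[of a b] that c0 by (cases "a = b") (auto simp: \<phi>p_def divide_right_mono)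
  have m_anti: "\<phi>m b \<le> \<phi>m a" if "a \<le> b" for a b
    using lower_mono[OF that] c0 by (auto simp: \<phi>m_def divide_right_mono)
  have m2: "\<phi>m s = 1" if "s \<le> 2" for s using that by (simp add: \<phi>m_def lower_fun_initial)
  have Bp: "(b - a) * \<phi>m (b - 1) \<le> a * \<phi>p a - b * \<phi>p b" if "0 < a" "a \<le> b" for a b
  proof -
    \<comment> \<open>Up to 2, \<open>s * \<phi>p s\<close> is \<open>1 / c - s\<close> and
      \<open>\<phi>m\<close> is 1, so equality holds without the delay equation; intervals across 2
      are cut there.\<close>
    have low: "(b - a) * \<phi>m (b - 1) \<le> a * \<phi>p a - b * \<phi>p b" if "0 < a" "a \<le> b" "b \<le> 2" for a b
      using that by (simp add: m2 \<phi>p_def upper_fun_initial algebra_simps)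
    have high: "(b - a) * \<phi>m (b - 1) \<le> a * \<phi>p a - b * \<phi>p b" if "2 \<le> a" "a \<le> b" for a b
    proof (rule increment_ge_of_deriv[where B = "\<lambda>s. s * \<phi>p s" and \<phi> = \<phi>m, OF that(2)])
      show "continuous_on {a..b} (\<lambda>s. s * \<phi>p s)"
        unfolding \<phi>p_def using that c0 by (intro continuous_intros continuous_on_upper) auto
      fix x assume "a < x" "x < b"
      then have "((\<lambda>s. (s * upper_fun s) / c - s) has_real_derivative lower_fun (x - 1) / c - 1) (at x)"
        using that by (intro DERIV_diff DERIV_cdivide times_upper_deriv DERIV_ident) auto
      then show "((\<lambda>s. s * \<phi>p s) has_real_derivative - \<phi>m (x - 1)) (at x)"
        by (simp add: \<phi>p_def \<phi>m_def algebra_simps)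
    qed (auto intro: m_anti)
    show ?thesis
    proof (cases "b \<le> 2 \<or> 2 \<le> a")
      case True then show ?thesis using low high that by auto
    next
      case False
      have "(b - a) * \<phi>m (b - 1) = (b - 2) * \<phi>m (b - 1) + (2 - a) * \<phi>m (b - 1)"
        by (simp add: algebra_simps)
      also have "(2 - a) * \<phi>m (b - 1) \<le> (2 - a) * \<phi>m (2 - 1)"
        using False by (intro mult_left_mono m_anti) auto
      also have "\<dots> \<le> a * \<phi>p a - 2 * \<phi>p 2" using low[of a 2] that False by simp
      also have "(b - 2) * \<phi>m (b - 1) \<le> 2 * \<phi>p 2 - b * \<phi>p b" using high[of 2 b] False by simp
      finally show ?thesis by simp
    qed
  qed
  have Bm: "(b - a) * \<phi>p (b - 1) \<le> a * \<phi>m a - b * \<phi>m b" if "2 \<le> a" "a \<le> b" for a b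
  proof (rule increment_ge_of_deriv[where B = "\<lambda>s. s * \<phi>m s" and \<phi> = \<phi>p, OF that(2)])
    show "continuous_on {a..b} (\<lambda>s. s * \<phi>m s)"
      unfolding \<phi>m_def using that c0 by (intro continuous_intros continuous_on_lower) auto
    fix x assume x: "a < x" "x < b"
    then have "((\<lambda>s. s - (s * lower_fun s) / c) has_real_derivative 1 - upper_fun (x - 1) / c) (at x)"
      using that by (intro DERIV_diff DERIV_cdivide times_lower_deriv DERIV_ident) auto
    then show "((\<lambda>s. s * \<phi>m s) has_real_derivative - \<phi>p (x - 1)) (at x)"
      by (simp add: \<phi>m_def \<phi>p_def algebra_simps)
    show "\<phi>p (b - 1) \<le> \<phi>p (x - 1)" using x that by (intro pm_anti) auto
  qed
  have p_decay: "\<phi>p s \<le> C * exp (- s)" if "s \<ge> 1/2" for s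
  proof -
    have "\<phi>p s \<le> 2 * exp 4 / c * exp (- s)" using dec[OF that] mp[of s] by simp
    moreover have "0 \<le> exp 2 * exp (- s)" by simp
    ultimately show ?thesis unfolding C_def distrib_right by linarith
  qed
  have m_decay: "\<phi>m s \<le> C * exp (- s)" for s
  proof (cases "s \<le> 2")
    case True
    have "1 \<le> exp 2 * exp (- s)" using True by (simp add: exp_add[symmetric])
    moreover have "0 \<le> 2 * exp 4 / c * exp (- s)" using c0 by simp
    ultimately show ?thesis using m2[OF True] unfolding C_def distrib_right by linarith
  next
    case False
    then have "\<phi>m s \<le> 2 * exp 4 / c * exp (- s)" using dec[of s] pp[of s] by simp
    moreover have "0 \<le> exp 2 * exp (- s)" by simp
    ultimately show ?thesis unfolding C_def distrib_right by linarith
  qed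
  have m1: "\<phi>m s < 1" if "s > 2" for s using lower_pos[OF that] c0 by (simp add: \<phi>m_def)
  show ?thesis
    by (rule that[of \<phi>m \<phi>p C];
        (rule m2 m1 mp pp m_anti pm_anti Bp Bm C0 m_decay p_decay; assumption))
qed

text \<open>\<open>\<Phi>p (s) = \<phi>p (s - \<eta>) + \<kappa> exp (- s)\<close> and likewise \<open>\<Phi>m\<close>, with \<open>\<beta> = 2 + \<eta>\<close>: for \<open>s \<le> 4\<close> the shift gains the
  factor \<open>1 - \<eta> / s\<close>, for \<open>s \<ge> 4\<close> the exponential gains the factor \<open>exp 1 / s < 1\<close>.\<close>

lemma strict_sieve_functions:
  fixes \<delta> :: real
  assumes "0 < \<delta>" "\<delta> < 1"
  obtains \<Phi>p \<Phi>m Bp Bm :: "real \<Rightarrow> real" and \<beta> \<epsilon> :: real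
  where "2 < \<beta>" "\<beta> < 2 + \<delta>" "\<epsilon> > 0" "\<Phi>m (2 + \<delta>) < 1"
    "\<And>s. \<Phi>m s > 0" "\<And>s. s \<ge> 1 \<Longrightarrow> \<Phi>p s > 0"
    "\<And>s. s \<le> \<beta> \<Longrightarrow> \<Phi>m s \<ge> 1"
    "\<And>a b. a \<le> b \<Longrightarrow> \<Phi>m b \<le> \<Phi>m a"
    "\<And>a b. 1 \<le> a \<Longrightarrow> a \<le> b \<Longrightarrow> \<Phi>p b \<le> \<Phi>p a"
    "\<And>a b. 1 \<le> a \<Longrightarrow> a \<le> b \<Longrightarrow> (b - a) * \<Phi>m (b - 1) \<le> Bp a - Bp b"
    "\<And>a b. \<beta> \<le> a \<Longrightarrow> a \<le> b \<Longrightarrow> (b - a) * \<Phi>p (b - 1) \<le> Bm a - Bm b"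
    "\<And>s. s \<ge> 1 \<Longrightarrow> Bp s \<ge> 0" "\<And>s. s \<ge> \<beta> \<Longrightarrow> Bm s \<ge> 0"
    "\<And>s. s \<ge> 1 \<Longrightarrow> (1 + \<epsilon>) / s * Bp s + \<epsilon> * \<Phi>m (s - 1) \<le> \<Phi>p s"
    "\<And>s. s \<ge> \<beta> \<Longrightarrow> (1 + \<epsilon>) / s * Bm s + \<epsilon> * \<Phi>p (s - 1) \<le> \<Phi>m s"
proof -
  obtain \<phi>p \<phi>m :: "real \<Rightarrow> real" and C where
    m2: "\<And>s. s \<le> 2 \<Longrightarrow> \<phi>m s = 1" and m1: "\<And>s. s > 2 \<Longrightarrow> \<phi>m s < 1" and
    mp: "\<And>s. \<phi>m s > 0" and pp: "\<And>s. s > 0 \<Longrightarrow> \<phi>p s > 0" and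
    ma: "\<And>a b. a \<le> b \<Longrightarrow> \<phi>m b \<le> \<phi>m a" and
    pa: "\<And>a b. 0 < a \<Longrightarrow> a \<le> b \<Longrightarrow> \<phi>p b \<le> \<phi>p a" and
    bp: "\<And>a b. 0 < a \<Longrightarrow> a \<le> b \<Longrightarrow> (b - a) * \<phi>m (b - 1) \<le> a * \<phi>p a - b * \<phi>p b" and
    bm: "\<And>a b. 2 \<le> a \<Longrightarrow> a \<le> b \<Longrightarrow> (b - a) * \<phi>p (b - 1) \<le> a * \<phi>m a - b * \<phi>m b" and
    C: "C > 0" and
    md: "\<And>s. \<phi>m s \<le> C * exp (- s)" and pd: "\<And>s. s \<ge> 1/2 \<Longrightarrow> \<phi>p s \<le> C * exp (- s)"
    by (rule linear_sieve_functions) (rule that; assumption)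
  define \<eta> where "\<eta> = \<delta> / 2"
  have \<eta>: "0 < \<eta>" "\<eta> < 1/2" "\<eta> < \<delta>" using assms by (auto simp: \<eta>_def)
  \<comment> \<open>The bounds by \<open>\<eta> / 8\<close> times the values at 4 let the gain of
    the shift on \<open>s \<le> 4\<close> pay for two copies of \<open>\<kappa>\<close>; the last
    bound keeps \<open>\<Phi>m (2 + \<delta>)\<close> below 1.\<close>
  define \<kappa> where "\<kappa> = min (1/2) (min (\<eta> / 8 * min (\<phi>p 4) (\<phi>m 4)) (1 - \<phi>m (2 + \<delta> - \<eta>)))"
  have \<kappa>: "0 < \<kappa>" "\<kappa> \<le> 1" "\<kappa> \<le> \<eta> / 8 * \<phi>p 4" "\<kappa> \<le> \<eta> / 8 * \<phi>m 4" "\<kappa> \<le> 1 - \<phi>m (2 + \<delta> - \<eta>)"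
  proof -
    have "\<eta> / 8 * min (\<phi>p 4) (\<phi>m 4) > 0" using \<eta> mp pp by (intro mult_pos_pos) auto
    moreover have "\<eta> / 8 * min (\<phi>p 4) (\<phi>m 4) \<le> \<eta> / 8 * \<phi>p 4"
      "\<eta> / 8 * min (\<phi>p 4) (\<phi>m 4) \<le> \<eta> / 8 * \<phi>m 4"
      using \<eta> by (intro mult_left_mono; simp)+
    moreover have "\<phi>m (2 + \<delta> - \<eta>) < 1" using \<eta> by (intro m1) simp
    ultimately show "0 < \<kappa>" "\<kappa> \<le> 1" "\<kappa> \<le> \<eta> / 8 * \<phi>p 4" "\<kappa> \<le> \<eta> / 8 * \<phi>m 4"
      "\<kappa> \<le> 1 - \<phi>m (2 + \<delta> - \<eta>)"
      unfolding \<kappa>_def by linarith+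
  qed
  \<comment> \<open>\<open>C'\<close> collects the value at \<open>s\<close>, the value at
    \<open>s - 1\<close> and two exponential corrections, each a multiple of
    \<open>exp (- s)\<close>. Then \<open>\<epsilon>\<close> makes the total loss
    \<open>\<epsilon> * C' * exp (- s)\<close> equal to
    \<open>\<kappa> * (1 - exp 1 / 4) * exp (- s)\<close>, the gain of the exponential beyond
    4.\<close>
  define C' where "C' = C * exp 1 + C * exp 2 + 2 * exp 1"
  have C': "C' > 0" using C by (simp add: C'_def add_pos_pos)
  define \<epsilon> where "\<epsilon> = \<kappa> * (1 - exp 1 / 4) / C'"
  have e3: "exp (1::real) < 4" using exp_le by simp
  have \<epsilon>: "\<epsilon> > 0" using \<kappa> C' e3 by (simp add: \<epsilon>_def)
  define \<Phi>p where "\<Phi>p = (\<lambda>s. \<phi>p (s - \<eta>) + \<kappa> * exp (- s))"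
  define \<Phi>m where "\<Phi>m = (\<lambda>s. \<phi>m (s - \<eta>) + \<kappa> * exp (- s))"
  \<comment> \<open>\<open>exp (1 - s)\<close> has derivative \<open>- exp (- (s - 1))\<close>, so
    it is to the correction term what \<open>s * \<phi>p s\<close> is to
    \<open>\<phi>m\<close>.\<close>
  define Bp where "Bp = (\<lambda>s. (s - \<eta>) * \<phi>p (s - \<eta>) + \<kappa> * exp (1 - s))"
  define Bm where "Bm = (\<lambda>s. (s - \<eta>) * \<phi>m (s - \<eta>) + \<kappa> * exp (1 - s))"
  have ex: "(b - a) * (\<kappa> * exp (1 - b)) \<le> \<kappa> * exp (1 - a) - \<kappa> * exp (1 - b)" for a b :: real
  proof -
    have "1 + (b - a) \<le> exp (b - a)" by (rule exp_ge_add_one_self)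
    then have "\<kappa> * exp (1 - b) * (1 + (b - a)) \<le> \<kappa> * exp (1 - b) * exp (b - a)"
      using \<kappa> by (intro mult_left_mono) auto
    also have "\<dots> = \<kappa> * exp (1 - a)" by (simp add: exp_add[symmetric] mult.assoc)
    finally show ?thesis by (simp add: algebra_simps)
  qed
  \<comment> \<open>Both required inequalities have this shape: \<open>f\<close> stands for the
    shifted function at \<open>s\<close>, \<open>h\<close> for the other shifted function at
    \<open>s - 1\<close>.\<close>
  have key: "(1 + \<epsilon>) / s * ((s - \<eta>) * f + \<kappa> * exp (1 - s)) + \<epsilon> * (h + \<kappa> * exp (- (s - 1)))
      \<le> f + \<kappa> * exp (- s)"
    if s: "s \<ge> 1" and f: "0 \<le> f" "f \<le> C * exp (- (s - \<eta>))" and h: "0 \<le> h" "h \<le> C * exp (- (s - 1 - \<eta>))"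
      and f3: "s \<le> 4 \<Longrightarrow> \<kappa> \<le> \<eta> / 8 * f" for s f h
  proof -
    have e1: "exp (1 - s) = exp 1 * exp (- s)" by (simp add: exp_add[symmetric])
    have "f + exp 1 * exp (- s) + h + exp 1 * exp (- s) \<le> C' * exp (- s)"
    proof -
      have "exp (- (s - \<eta>)) \<le> exp (1 - s)" "exp (- (s - 1 - \<eta>)) \<le> exp (2 - s)"
        using \<eta> by auto
      then have "f \<le> C * exp (1 - s)" "h \<le> C * exp (2 - s)"
        using f h C by (meson mult_left_mono order.trans less_imp_le)+
      then show ?thesis
        unfolding C'_def using exp_add[of 1 "- s"] exp_add[of 2 "-s"] by (simp add: algebra_simps)
    qed
    moreover have "(s - \<eta>) / s * f \<le> f"
      using s \<eta> f by (intro mult_left_le_one_le) auto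
    moreover have "\<kappa> * exp (1 - s) / s \<le> exp 1 * exp (- s)"
    proof -
      have "\<kappa> * exp (1 - s) / s \<le> 1 * exp (1 - s) / 1"
        using s \<kappa> by (intro frac_le mult_right_mono) auto
      then show ?thesis by (simp add: e1)
    qed
    moreover have "\<kappa> * exp (- (s - 1)) \<le> exp 1 * exp (- s)"
      using \<kappa> by (simp add: e1)
    ultimately have "(s - \<eta>) / s * f + \<kappa> * exp (1 - s) / s + (h + \<kappa> * exp (- (s - 1))) \<le> C' * exp (- s)"
      by linarith
    then have "\<epsilon> * ((s - \<eta>) / s * f + \<kappa> * exp (1 - s) / s + (h + \<kappa> * exp (- (s - 1)))) \<le> \<epsilon> * (C' * exp (- s))"
      using \<epsilon> by (intro mult_left_mono) auto
    also have "\<dots> = \<kappa> * (1 - exp 1 / 4) * exp (- s)" using C' by (simp add: \<epsilon>_def)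
    also have "\<dots> \<le> \<eta> / s * f + \<kappa> * exp (- s) - \<kappa> * exp (1 - s) / s"
    proof (cases "s \<le> 4")
      case True
      have "2 * \<kappa> \<le> \<eta> / 4 * f" using f3[OF True] by simp
      also have "\<dots> \<le> \<eta> / s * f"
        using s True \<eta> f by (intro mult_right_mono divide_left_mono) auto
      finally have 1: "2 * \<kappa> \<le> \<eta> / s * f" .
      have "exp (1 - s) / s \<le> 1 / 1" using s by (intro frac_le) auto
      then have 2: "\<kappa> * exp (1 - s) / s \<le> \<kappa>" using \<kappa> mult_left_mono[of "exp (1 - s) / s" 1 \<kappa>] by simp
      have "(1 - exp 1 / 4) * exp (- s) \<le> 1 * 1"
        using s e3 by (intro mult_mono) auto
      then have 3: "\<kappa> * (1 - exp 1 / 4) * exp (- s) \<le> \<kappa>"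
        using \<kappa> mult_left_mono[of "(1 - exp 1 / 4) * exp (- s)" 1 \<kappa>] by (simp add: mult.assoc)
      have "\<kappa> * exp (- s) > 0" using \<kappa> by simp
      then show ?thesis using 1 2 3 by linarith
    next
      case False
      have "\<kappa> * exp (1 - s) / s \<le> \<kappa> * exp (1 - s) / 4"
        using False \<kappa> by (intro divide_left_mono) auto
      also have "\<dots> = \<kappa> * exp (- s) * (exp 1 / 4)" by (simp add: e1)
      finally have "\<kappa> * (1 - exp 1 / 4) * exp (- s) \<le> \<kappa> * exp (- s) - \<kappa> * exp (1 - s) / s"
        by (simp add: algebra_simps)
      moreover have "0 \<le> \<eta> / s * f" using \<eta> s f by simp
      ultimately show ?thesis by linarith
    qed
    finally have "\<epsilon> * ((s - \<eta>) / s * f + \<kappa> * exp (1 - s) / s + (h + \<kappa> * exp (- (s - 1))))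
        \<le> \<eta> / s * f + \<kappa> * exp (- s) - \<kappa> * exp (1 - s) / s" .
    moreover have "\<eta> / s * f = f - (s - \<eta>) / s * f" using s by (simp add: field_simps)
    moreover have "(1 + e) / s * (P * F + Q) + e * H = e * (P / s * F + Q / s + H) + P / s * F + Q / s"
      for e P Q F H :: real
      by (simp add: algebra_simps add_divide_distrib)
    then have "(1 + \<epsilon>) / s * ((s - \<eta>) * f + \<kappa> * exp (1 - s)) + \<epsilon> * (h + \<kappa> * exp (- (s - 1)))
      = \<epsilon> * ((s - \<eta>) / s * f + \<kappa> * exp (1 - s) / s + (h + \<kappa> * exp (- (s - 1))))
        + (s - \<eta>) / s * f + \<kappa> * exp (1 - s) / s" .
    ultimately show ?thesis by (smt (verit))
  qed
  show ?thesis
  proof (rule that[of "2 + \<eta>" \<epsilon> \<Phi>m \<Phi>p Bp Bm])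
    show "\<Phi>m (2 + \<delta>) < 1"
    proof -
      have "\<kappa> * exp (- (2 + \<delta>)) < \<kappa> * 1" using \<kappa> assms by (intro mult_strict_left_mono) auto
      then show ?thesis using \<kappa>(5) by (simp add: \<Phi>m_def)
    qed
    show "\<Phi>m s > 0" for s using mp[of "s - \<eta>"] \<kappa> by (simp add: \<Phi>m_def add_pos_pos)
    show "\<Phi>p s > 0" if "s \<ge> 1" for s
      using pp[of "s - \<eta>"] \<kappa> \<eta> that by (simp add: \<Phi>p_def add_pos_pos)
    show "\<Phi>m s \<ge> 1" if "s \<le> 2 + \<eta>" for s using m2[of "s - \<eta>"] that \<kappa> by (simp add: \<Phi>m_def)
    show "\<Phi>m b \<le> \<Phi>m a" if "a \<le> b" for a b
      using ma[of "a - \<eta>" "b - \<eta>"] that \<kappa> by (auto simp: \<Phi>m_def intro!: add_mono)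
    show "\<Phi>p b \<le> \<Phi>p a" if "1 \<le> a" "a \<le> b" for a b
      using pa[of "a - \<eta>" "b - \<eta>"] that \<kappa> \<eta> by (auto simp: \<Phi>p_def intro!: add_mono)
    show "(b - a) * \<Phi>m (b - 1) \<le> Bp a - Bp b" if "1 \<le> a" "a \<le> b" for a b
      using bp[of "a - \<eta>" "b - \<eta>"] ex[of b a] that \<eta>
      by (simp add: \<Phi>m_def Bp_def distrib_left diff_diff_eq add.commute)
    show "(b - a) * \<Phi>p (b - 1) \<le> Bm a - Bm b" if "2 + \<eta> \<le> a" "a \<le> b" for a b
      using bm[of "a - \<eta>" "b - \<eta>"] ex[of b a] that \<eta>
      by (simp add: \<Phi>p_def Bm_def distrib_left diff_diff_eq add.commute)
    show "Bp s \<ge> 0" if "s \<ge> 1" for s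
      using pp[of "s - \<eta>"] \<kappa> \<eta> that by (simp add: Bp_def)
    show "Bm s \<ge> 0" if "s \<ge> 2 + \<eta>" for s
      using mp[of "s - \<eta>"] \<kappa> \<eta> that by (simp add: Bm_def)
    show "(1 + \<epsilon>) / s * Bp s + \<epsilon> * \<Phi>m (s - 1) \<le> \<Phi>p s" if s: "s \<ge> 1" for s
      unfolding Bp_def \<Phi>m_def \<Phi>p_def
    proof (rule key[OF s])
      show "0 \<le> \<phi>p (s - \<eta>)" using pp[of "s - \<eta>"] s \<eta> by simp
      show "\<phi>p (s - \<eta>) \<le> C * exp (- (s - \<eta>))" using s \<eta> by (intro pd) auto
      show "0 \<le> \<phi>m (s - 1 - \<eta>)" using mp less_imp_le by blast
      assume "s \<le> 4"
      then have "\<phi>p 4 \<le> \<phi>p (s - \<eta>)" using s \<eta> by (intro pa) auto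
      then have "\<eta> / 8 * \<phi>p 4 \<le> \<eta> / 8 * \<phi>p (s - \<eta>)" using \<eta> by (intro mult_left_mono) auto
      then show "\<kappa> \<le> \<eta> / 8 * \<phi>p (s - \<eta>)" using \<kappa> by linarith
    qed (rule md)
    show "(1 + \<epsilon>) / s * Bm s + \<epsilon> * \<Phi>p (s - 1) \<le> \<Phi>m s" if s: "s \<ge> 2 + \<eta>" for s
      unfolding Bm_def \<Phi>m_def \<Phi>p_def
    proof (rule key)
      show "1 \<le> s" using s \<eta> by simp
      show "0 \<le> \<phi>m (s - \<eta>)" using mp less_imp_le by blast
      show "0 \<le> \<phi>p (s - 1 - \<eta>)" using pp[of "s - 1 - \<eta>"] s \<eta> by simp
      show "\<phi>p (s - 1 - \<eta>) \<le> C * exp (- (s - 1 - \<eta>))" using s \<eta> by (intro pd) auto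
      assume "s \<le> 4"
      then have "\<phi>m 4 \<le> \<phi>m (s - \<eta>)" using s \<eta> by (intro ma) auto
      then have "\<eta> / 8 * \<phi>m 4 \<le> \<eta> / 8 * \<phi>m (s - \<eta>)" using \<eta> by (intro mult_left_mono) auto
      then show "\<kappa> \<le> \<eta> / 8 * \<phi>m (s - \<eta>)" using \<kappa> by linarith
    qed (rule md)
  qed (use \<eta> \<epsilon> in auto)
qed

section \<open>The linear sieve\<close>

text \<open>Abel summation with \<open>c * t n\<close> as a majorant of \<open>V n\<close>, where
  \<open>t n\<close> decreases towards \<open>s\<close>. The increments of the majorant times
  \<open>\<psi>\<close> are dominated by increments of \<open>B\<close>. The term with
  \<open>K - 1\<close> is the mismatch at the upper end, where the majorant exceeds
  \<open>V z\<close> by the factor \<open>K\<close>.\<close>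

lemma sieve_partial_summation:
  fixes V :: "nat \<Rightarrow> real" and \<psi> B :: "real \<Rightarrow> real" and L K s :: real
  assumes w: "2 \<le> w" "w < z" and L: "0 < L" and s: "s = L / ln (real z)"
    and dec: "\<And>n. w \<le> n \<Longrightarrow> n < z \<Longrightarrow> V (Suc n) \<le> V n"
    and bound: "\<And>n. w \<le> n \<Longrightarrow> n < z \<Longrightarrow> V n \<le> K * V z * ln (real z) / ln (real n)"
    and Kp: "0 \<le> K" "0 \<le> V z"
    and \<psi>: "\<And>a b. s \<le> a \<Longrightarrow> a \<le> b \<Longrightarrow> \<psi> b \<le> \<psi> a" "\<And>a. s \<le> a \<Longrightarrow> 0 \<le> \<psi> a"
    and B: "\<And>a b. s \<le> a \<Longrightarrow> a \<le> b \<Longrightarrow> (b - a) * \<psi> b \<le> B a - B b" "\<And>a. s \<le> a \<Longrightarrow> 0 \<le> B a"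
    and K1: "1 \<le> K"
  shows "(\<Sum>n=w..<z. (V n - V (Suc n)) * \<psi> (L / ln (real n))) \<le> V z * (K / s * B s + (K - 1) * \<psi> s)"
proof -
  define t where "t = (\<lambda>n::nat. L / ln (real n))"
  define c where "c = V z * K / s"
  have lnz: "0 < ln (real z)" using w by simp
  have s0: "s > 0" using L lnz s by simp
  have c0: "c \<ge> 0" using Kp s0 by (simp add: c_def)
  have tmono: "t n \<le> t m" if "2 \<le> m" "m \<le> n" for m n
    using that L unfolding t_def by (intro divide_left_mono mult_pos_pos) auto
  have ts: "s \<le> t n" if "w \<le> n" "n \<le> z" for n
    using tmono[of n z] that w by (simp add: s t_def)
  have Vc: "V n \<le> c * t n" if "w \<le> n" "n < z" for n
  proof -
    have "c * t n = K * V z * ln (real z) / ln (real n)"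
      using L lnz by (simp add: c_def t_def s)
    then show ?thesis using bound[OF that] by simp
  qed
  \<comment> \<open>Keeping \<open>- V (Suc k) * \<psi> (t k)\<close> in the invariant lets the next
    \<open>V (Suc k)\<close> meet the nonnegative increment of \<open>\<psi>\<close>, against which
    it may be replaced by its majorant.\<close>
  have inv: "(\<Sum>n=w..<Suc k. (V n - V (Suc n)) * \<psi> (t n)) \<le> c * (B (t k) + t k * \<psi> (t k)) - V (Suc k) * \<psi> (t k)"
    if "w \<le> k" "k < z" for k
    using that
  proof (induction k rule: dec_induct)
    case base
    have "V w * \<psi> (t w) \<le> c * t w * \<psi> (t w)"
      using Vc[of w] \<psi>(2)[OF ts[of w]] w by (intro mult_right_mono) auto
    moreover have "0 \<le> c * B (t w)" using c0 B(2)[OF ts[of w]] w by simp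
    ultimately show ?case by (simp add: algebra_simps)
  next
    case (step k)
    have k: "w \<le> k" "Suc k < z" "k < z" using step by auto
    have tk: "t (Suc k) \<le> t k" "s \<le> t (Suc k)" using tmono[of k "Suc k"] ts[of "Suc k"] k w by auto
    have d: "\<psi> (t k) \<le> \<psi> (t (Suc k))" using \<psi>(1)[OF tk(2,1)] .
    have "V (Suc k) * (\<psi> (t (Suc k)) - \<psi> (t k)) \<le> c * t (Suc k) * (\<psi> (t (Suc k)) - \<psi> (t k))"
      using Vc[of "Suc k"] k d by (intro mult_right_mono) auto
    moreover have "c * ((t k - t (Suc k)) * \<psi> (t k)) \<le> c * (B (t (Suc k)) - B (t k))"
      using B(1)[OF tk(2,1)] c0 by (intro mult_left_mono)
    moreover have "(\<Sum>n=w..<Suc (Suc k). (V n - V (Suc n)) * \<psi> (t n))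
        = (\<Sum>n=w..<Suc k. (V n - V (Suc n)) * \<psi> (t n)) + (V (Suc k) - V (Suc (Suc k))) * \<psi> (t (Suc k))"
      using k by simp
    ultimately show ?case using step.IH[OF k(3)] by (simp add: algebra_simps)
  qed
  obtain k where k: "z = Suc k" "w \<le> k" using w by (cases z) auto
  have tk: "s \<le> t k" using ts[of k] k by simp
  have "(\<Sum>n=w..<z. (V n - V (Suc n)) * \<psi> (t n)) \<le> c * (B (t k) + t k * \<psi> (t k)) - V z * \<psi> (t k)"
    using inv[of k] k by simp
  also have "c * (B (t k) + t k * \<psi> (t k)) \<le> c * (B s + s * \<psi> (t k))"
    using B(1)[OF order_refl tk] c0 by (intro mult_left_mono) (simp_all add: algebra_simps)
  also have "c * (B s + s * \<psi> (t k)) - V z * \<psi> (t k) = V z * (K / s * B s) + V z * (K - 1) * \<psi> (t k)"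
    using s0 by (simp add: c_def field_simps)
  also have "\<dots> \<le> V z * (K / s * B s) + V z * (K - 1) * \<psi> s"
    using mult_left_mono[OF \<psi>(1)[OF order_refl tk], of "V z * (K - 1)"] Kp K1 by simp
  finally show ?thesis by (simp add: t_def algebra_simps)
qed

section \<open>Sifting functions, Buchstab's identity and the linear sieve bound\<close>

locale sifting =
  fixes P M :: "nat set" and a \<gamma> :: "nat \<Rightarrow> real" and X :: real
  assumes finite_M: "finite M" and a_nonneg: "\<And>n. a n \<ge> 0"
    and primes: "\<And>p. p \<in> P \<Longrightarrow> prime p"
    and X_nonneg: "X \<ge> 0"
    and gamma_one: "\<gamma> 1 = 1" and gamma_nonneg: "\<And>d. \<gamma> d \<ge> 0"
    and gamma_less: "\<And>p. p \<in> P \<Longrightarrow> \<gamma> p < 1"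
    and gamma_mult: "\<And>q p. p \<in> P \<Longrightarrow> q > 0 \<Longrightarrow> \<not> p dvd q \<Longrightarrow> \<gamma> (q * p) = \<gamma> q * \<gamma> p"
begin

definition sifted :: "nat \<Rightarrow> nat \<Rightarrow> real" where
  "sifted q z = (\<Sum>n | n \<in> M \<and> q dvd n \<and> (\<forall>p\<in>P. p < z \<longrightarrow> \<not> p dvd n). a n)"

definition remainder :: "nat \<Rightarrow> real" where
  "remainder d = (\<Sum>n | n \<in> M \<and> d dvd n. a n) - X * \<gamma> d"

definition V :: "nat \<Rightarrow> real" where
  "V z = (\<Prod>p\<in>P \<inter> {..<z}. 1 - \<gamma> p)"

text \<open>The squarefree products of primes of \<open>P\<close> below \<open>z\<close>, built one
  prime at a time so that sums over them split along the same recursion as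
  \<open>sifted\<close>.\<close>

primrec divisors_upto :: "nat \<Rightarrow> nat set" where
  "divisors_upto 0 = {1}"
| "divisors_upto (Suc z) = divisors_upto z \<union> (if z \<in> P then (\<lambda>d. d * z) ` divisors_upto z else {})"

definition total_error :: "nat \<Rightarrow> real \<Rightarrow> nat \<Rightarrow> real" where
  "total_error q y z = (\<Sum>d | d \<in> divisors_upto z \<and> real d \<le> y. \<bar>remainder (q * d)\<bar>)"

lemma P_pos: "p \<in> P \<Longrightarrow> p > 0" using primes prime_gt_0_nat by blast

lemma lessThan_Suc_P: "P \<inter> {..<Suc z} = (if z \<in> P then insert z (P \<inter> {..<z}) else P \<inter> {..<z})"
  by (auto simp: less_Suc_eq)

lemma V_Suc: "V (Suc z) = (if z \<in> P then (1 - \<gamma> z) * V z else V z)"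
  by (simp add: V_def lessThan_Suc_P)

lemma V_pos: "V z > 0"
  unfolding V_def by (rule prod_pos) (use gamma_less in auto)

lemma V_decreasing: "V (Suc z) \<le> V z"
  using V_pos[of z] gamma_nonneg[of z] by (simp add: V_Suc algebra_simps)

lemma finite_divisors_upto: "finite (divisors_upto z)"
  by (induction z) auto

lemma divisors_upto_bounds: "d \<in> divisors_upto z \<Longrightarrow> 0 < d \<and> d \<le> fact z"
proof (induction z arbitrary: d)
  case (Suc z)
  show ?case
  proof (cases "d \<in> divisors_upto z")
    case True
    then show ?thesis using Suc.IH[of d] fact_mono_nat[of z "Suc z"] by auto
  next
    case False
    then obtain e where e: "z \<in> P" "e \<in> divisors_upto z" "d = e * z"
      using Suc.prems by (auto split: if_splits)
    have "e * z \<le> fact z * Suc z" using Suc.IH[OF e(2)] by (intro mult_le_mono) auto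
    then show ?thesis using e Suc.IH[OF e(2)] P_pos[OF e(1)] by (simp add: mult.commute)
  qed
qed simp

lemma prime_dvd_divisors_upto: "d \<in> divisors_upto z \<Longrightarrow> prime p \<Longrightarrow> p dvd d \<Longrightarrow> p \<in> P \<and> p < z"
proof (induction z arbitrary: d)
  case (Suc z)
  show ?case
  proof (cases "d \<in> divisors_upto z")
    case True
    then show ?thesis using Suc.IH[of d] Suc.prems by auto
  next
    case False
    then obtain e where e: "z \<in> P" "e \<in> divisors_upto z" "d = e * z"
      using Suc.prems by (auto split: if_splits)
    then have "p dvd e \<or> p dvd z" using Suc.prems by (simp add: prime_dvd_mult_iff)
    then show ?thesis
      using Suc.IH[OF e(2)] Suc.prems primes[OF e(1)] e(1) primes_dvd_imp_eq by auto
  qed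
qed simp

lemma squarefree_divisors_upto: "d \<in> divisors_upto z \<Longrightarrow> squarefree d"
proof (induction z arbitrary: d)
  case (Suc z)
  show ?case
  proof (cases "d \<in> divisors_upto z")
    case False
    then obtain e where e: "z \<in> P" "e \<in> divisors_upto z" "d = e * z"
      using Suc.prems by (auto split: if_splits)
    have "coprime z e"
      using prime_dvd_divisors_upto[OF e(2) primes[OF e(1)]] primes[OF e(1)]
      by (auto intro: prime_imp_coprime)
    then show ?thesis
      using e Suc.IH[OF e(2)] primes[OF e(1)]
      by (simp add: squarefree_mult_coprime squarefree_prime coprime_commute)
  qed (use Suc in auto)
qed simp

lemma sifted_nonneg: "sifted q z \<ge> 0"
  unfolding sifted_def by (intro sum_nonneg a_nonneg)

lemma total_error_nonneg: "total_error q y z \<ge> 0"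
  unfolding total_error_def by (intro sum_nonneg) simp

lemma sifted_Suc:
  assumes "z \<in> P \<Longrightarrow> \<not> z dvd q"
  shows "sifted q (Suc z) = sifted q z - (if z \<in> P then sifted (q * z) z else 0)"
proof (cases "z \<in> P")
  case True
  have "coprime q z" using assms True primes[OF True] by (metis coprime_commute prime_imp_coprime)
  then have qz: "q * z dvd n \<longleftrightarrow> q dvd n \<and> z dvd n" for n
    by (meson divides_mult dvd_mult_left dvd_mult_right)
  have "{n. n \<in> M \<and> q dvd n \<and> (\<forall>p\<in>P. p < z \<longrightarrow> \<not> p dvd n)}
      = {n. n \<in> M \<and> q dvd n \<and> (\<forall>p\<in>P. p < Suc z \<longrightarrow> \<not> p dvd n)}
      \<union> {n. n \<in> M \<and> q * z dvd n \<and> (\<forall>p\<in>P. p < z \<longrightarrow> \<not> p dvd n)}"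
    using True by (auto simp: qz less_Suc_eq)
  moreover have "{n. n \<in> M \<and> q dvd n \<and> (\<forall>p\<in>P. p < Suc z \<longrightarrow> \<not> p dvd n)}
      \<inter> {n. n \<in> M \<and> q * z dvd n \<and> (\<forall>p\<in>P. p < z \<longrightarrow> \<not> p dvd n)} = {}"
    using True by (auto simp: qz)
  ultimately have "sifted q z = sifted q (Suc z) + sifted (q * z) z"
    unfolding sifted_def using finite_M by (simp add: sum.union_disjoint)
  then show ?thesis using True by simp
next
  case False
  then have "{n. n \<in> M \<and> q dvd n \<and> (\<forall>p\<in>P. p < z \<longrightarrow> \<not> p dvd n)}
      = {n. n \<in> M \<and> q dvd n \<and> (\<forall>p\<in>P. p < Suc z \<longrightarrow> \<not> p dvd n)}"
    by (auto simp: less_Suc_eq)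
  then show ?thesis using False by (simp add: sifted_def)
qed

lemma total_error_Suc:
  "total_error q y (Suc z) = total_error q y z + (if z \<in> P then total_error (q * z) (y / real z) z else 0)"
proof (cases "z \<in> P")
  case True
  have z0: "z > 0" using P_pos True by simp
  have nz: "\<not> z dvd d" if "d \<in> divisors_upto z" for d
    using prime_dvd_divisors_upto[OF that primes[OF True]] by auto
  define A where "A = {d. d \<in> divisors_upto z \<and> real d \<le> y}"
  define B where "B = {d. d \<in> divisors_upto z \<and> real d \<le> y / real z}"
  have "{d. d \<in> divisors_upto (Suc z) \<and> real d \<le> y} = A \<union> (\<lambda>d. d * z) ` B"
    using True z0 by (auto simp: A_def B_def field_simps)
  moreover have "A \<inter> (\<lambda>d. d * z) ` B = {}" using nz by (auto simp: A_def dest: nz)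
  moreover have "finite A" "finite B" using finite_divisors_upto by (auto simp: A_def B_def)
  moreover have "inj_on (\<lambda>d. d * z) B" using z0 by (auto intro: inj_onI)
  ultimately have "total_error q y (Suc z) = (\<Sum>d\<in>A. \<bar>remainder (q * d)\<bar>) + (\<Sum>d\<in>B. \<bar>remainder (q * (d * z))\<bar>)"
    unfolding total_error_def by (simp add: sum.union_disjoint sum.reindex)
  then show ?thesis using True by (simp add: total_error_def A_def B_def mult_ac)
qed (simp add: total_error_def)

lemma atLeastLessThan_Suc_P:
  "w \<le> z \<Longrightarrow> P \<inter> {w..<Suc z} = (if z \<in> P then insert z (P \<inter> {w..<z}) else P \<inter> {w..<z})"
  by (auto simp: less_Suc_eq)

lemma buchstab:
  assumes "w \<le> z" "\<And>p. p \<in> P \<Longrightarrow> p < z \<Longrightarrow> \<not> p dvd q"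
  shows "sifted q z = sifted q w - (\<Sum>p\<in>P \<inter> {w..<z}. sifted (q * p) p)"
  using assms
proof (induction z rule: dec_induct)
  case (step z)
  then show ?case using sifted_Suc[of z q] by (auto simp: atLeastLessThan_Suc_P)
qed simp

text \<open>The exact companion of \<open>buchstab\<close>: a divisor either has all its primes
  below \<open>w\<close> or is cut at its largest prime \<open>p\<close>, the cofactor having only
  primes below \<open>p\<close> and size at most \<open>y / p\<close>. Errors of the recursion thus
  add up to one sum with no multiplicities.\<close>

lemma total_error_split:
  assumes "w \<le> z"
  shows "total_error q y z = total_error q y w + (\<Sum>p\<in>P \<inter> {w..<z}. total_error (q * p) (y / real p) p)"
  using assms
proof (induction z rule: dec_induct)
  case (step z)
  then show ?case by (simp add: atLeastLessThan_Suc_P total_error_Suc)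
qed simp

lemma V_split:
  assumes "w \<le> z"
  shows "V w = V z + (\<Sum>p\<in>P \<inter> {w..<z}. \<gamma> p * V p)"
  using assms
proof (induction z rule: dec_induct)
  case (step z)
  then show ?case by (simp add: atLeastLessThan_Suc_P V_Suc algebra_simps)
qed simp

text \<open>On \<open>P\<close> the product \<open>\<gamma> p * V p\<close> is the drop of
  \<open>V\<close> at \<open>p\<close>, and off \<open>P\<close> nothing drops, so a sum over primes
  becomes a sum over all integers, ready for partial summation.\<close>

lemma sum_P_telescope:
  assumes "w \<le> z"
  shows "(\<Sum>p\<in>P \<inter> {w..<z}. \<gamma> p * V p * f p) = (\<Sum>n=w..<z. (V n - V (Suc n)) * f n)"
  using assms
proof (induction z rule: dec_induct)
  case (step z)
  then show ?case by (simp add: atLeastLessThan_Suc_P V_Suc algebra_simps)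
qed simp

text \<open>Inclusion-exclusion without truncation: all elements of \<open>divisors_upto z\<close>
  are at most \<open>fact z\<close>, so the level \<open>y\<close> cuts nothing off.\<close>

lemma legendre:
  assumes "q > 0" "\<And>p. p \<in> P \<Longrightarrow> p < z \<Longrightarrow> \<not> p dvd q" "fact z \<le> y"
  shows "\<bar>sifted q z - X * \<gamma> q * V z\<bar> \<le> total_error q y z"
proof -
  have "\<bar>sifted q z - X * \<gamma> q * V z\<bar> \<le> (\<Sum>d\<in>divisors_upto z. \<bar>remainder (q * d)\<bar>)"
    using assms(1,2)
  proof (induction z arbitrary: q)
    case 0
    have "V 0 = 1" by (simp add: V_def)
    then show ?case by (simp add: sifted_def remainder_def)
  next
    case (Suc z)
    have IH: "\<bar>sifted q z - X * \<gamma> q * V z\<bar> \<le> (\<Sum>d\<in>divisors_upto z. \<bar>remainder (q * d)\<bar>)"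
      using Suc by auto
    show ?case
    proof (cases "z \<in> P")
      case True
      have nq: "\<not> z dvd q" using Suc.prems True by simp
      have z0: "z > 0" using P_pos True by simp
      have "\<not> p dvd q * z" if "p \<in> P" "p < z" for p
        using that Suc.prems primes[OF that(1)] primes[OF True] primes_dvd_imp_eq
        by (auto simp: prime_dvd_mult_iff)
      then have IH2: "\<bar>sifted (q * z) z - X * \<gamma> (q * z) * V z\<bar> \<le> (\<Sum>d\<in>divisors_upto z. \<bar>remainder (q * z * d)\<bar>)"
        using Suc.prems z0 by (intro Suc.IH) auto
      have nz: "\<not> z dvd d" if "d \<in> divisors_upto z" for d
        using prime_dvd_divisors_upto[OF that primes[OF True]] by auto
      have dj: "divisors_upto z \<inter> (\<lambda>d. d * z) ` divisors_upto z = {}" by (auto dest: nz)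
      have "inj_on (\<lambda>d. d * z) (divisors_upto z)" using z0 by (auto intro: inj_onI)
      then have "(\<Sum>d\<in>divisors_upto (Suc z). \<bar>remainder (q * d)\<bar>) =
          (\<Sum>d\<in>divisors_upto z. \<bar>remainder (q * d)\<bar>) + (\<Sum>d\<in>divisors_upto z. \<bar>remainder (q * z * d)\<bar>)"
        using True dj by (simp add: sum.union_disjoint finite_divisors_upto sum.reindex mult_ac)
      moreover have "sifted q (Suc z) - X * \<gamma> q * V (Suc z)
          = (sifted q z - X * \<gamma> q * V z) - (sifted (q * z) z - X * \<gamma> (q * z) * V z)"
        using True nq Suc.prems gamma_mult[OF True _ nq] sifted_Suc[of z q] by (simp add: V_Suc algebra_simps)
      ultimately show ?thesis using IH IH2 by linarith
    qed (use IH sifted_Suc[of z q] in \<open>simp add: V_Suc\<close>)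
  qed
  moreover have "real d \<le> y" if "d \<in> divisors_upto z" for d
  proof -
    have "real d \<le> real (fact z)" using divisors_upto_bounds[OF that] by (simp only: of_nat_le_iff)
    then show ?thesis using assms(3) by simp
  qed
  then have "{d. d \<in> divisors_upto z \<and> real d \<le> y} = divisors_upto z" by auto
  then have "(\<Sum>d\<in>divisors_upto z. \<bar>remainder (q * d)\<bar>) = total_error q y z"
    by (simp add: total_error_def)
  ultimately show ?thesis by simp
qed

text \<open>Primes below \<open>w\<close> are sieved exactly by Legendre's formula, which enlarges the level by at most the
  constant \<open>fact w\<close>; the dimension condition is needed only above \<open>w\<close>, where \<open>\<epsilon>\<close> can be as small as the
  slack of the sieve functions requires.  A prime \<open>p\<close> for which \<open>\<Phi>m\<close> gives no information is dropped in the
  upper bound, which costs nothing because \<open>\<Phi>m \<ge> 1\<close> there.\<close>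

theorem linear_sieve:
  fixes \<Phi>p \<Phi>m Bp Bm :: "real \<Rightarrow> real" and \<beta> \<epsilon> :: real
  assumes \<beta>: "2 < \<beta>" and \<epsilon>: "\<epsilon> > 0"
    and mp: "\<And>s. \<Phi>m s > 0" and pp: "\<And>s. s \<ge> 1 \<Longrightarrow> \<Phi>p s > 0"
    and m1: "\<And>s. s \<le> \<beta> \<Longrightarrow> \<Phi>m s \<ge> 1"
    and ma: "\<And>a b. a \<le> b \<Longrightarrow> \<Phi>m b \<le> \<Phi>m a"
    and pa: "\<And>a b. 1 \<le> a \<Longrightarrow> a \<le> b \<Longrightarrow> \<Phi>p b \<le> \<Phi>p a"
    and bp: "\<And>a b. 1 \<le> a \<Longrightarrow> a \<le> b \<Longrightarrow> (b - a) * \<Phi>m (b - 1) \<le> Bp a - Bp b"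
    and bm: "\<And>a b. \<beta> \<le> a \<Longrightarrow> a \<le> b \<Longrightarrow> (b - a) * \<Phi>p (b - 1) \<le> Bm a - Bm b"
    and bp0: "\<And>s. s \<ge> 1 \<Longrightarrow> Bp s \<ge> 0" and bm0: "\<And>s. s \<ge> \<beta> \<Longrightarrow> Bm s \<ge> 0"
    and p_ineq: "\<And>s. s \<ge> 1 \<Longrightarrow> (1 + \<epsilon>) / s * Bp s + \<epsilon> * \<Phi>m (s - 1) \<le> \<Phi>p s"
    and m_ineq: "\<And>s. s \<ge> \<beta> \<Longrightarrow> (1 + \<epsilon>) / s * Bm s + \<epsilon> * \<Phi>p (s - 1) \<le> \<Phi>m s"
    and w: "2 \<le> w"
    and dim: "\<And>n m. w \<le> n \<Longrightarrow> n \<le> m \<Longrightarrow> V n \<le> (1 + \<epsilon>) * V m * ln (real m) / ln (real n)"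
    and z: "2 \<le> z" and q: "0 < q" "\<And>p. p \<in> P \<Longrightarrow> p < z \<Longrightarrow> \<not> p dvd q"
    and D: "1 \<le> D"
  shows "ln D \<ge> ln (real z) \<Longrightarrow>
      sifted q z \<le> X * \<gamma> q * V z * (1 + \<Phi>p (ln D / ln (real z))) + total_error q (D * fact w) z"
    and "ln D \<ge> \<beta> * ln (real z) \<Longrightarrow>
      sifted q z \<ge> X * \<gamma> q * V z * (1 - \<Phi>m (ln D / ln (real z))) - total_error q (D * fact w) z"
proof -
  have "(ln D \<ge> ln (real z) \<longrightarrow>
      sifted q z \<le> X * \<gamma> q * V z * (1 + \<Phi>p (ln D / ln (real z))) + total_error q (D * fact w) z) \<and>
    (ln D \<ge> \<beta> * ln (real z) \<longrightarrow>
      sifted q z \<ge> X * \<gamma> q * V z * (1 - \<Phi>m (ln D / ln (real z))) - total_error q (D * fact w) z)"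
    using z q D
  proof (induction z arbitrary: q D rule: less_induct)
    case (less z)
    define s where "s = ln D / ln (real z)"
    have lnz: "ln (real z) > 0" using less.prems by simp
    have Xg: "X * \<gamma> q \<ge> 0" using X_nonneg gamma_nonneg by simp
    have sU: "ln D \<ge> ln (real z) \<longleftrightarrow> s \<ge> 1" and sL: "ln D \<ge> \<beta> * ln (real z) \<longleftrightarrow> s \<ge> \<beta>"
      using lnz by (simp_all add: s_def field_simps)
    let ?y = "D * fact w"
    show ?case
    proof (cases "z \<le> w")
      case True
      have "fact z \<le> (fact w :: real)" using True by (rule fact_mono)
      also have "\<dots> \<le> ?y" using less.prems by simp
      finally have "\<bar>sifted q z - X * \<gamma> q * V z\<bar> \<le> total_error q ?y z"
        using less.prems by (intro legendre) auto
      moreover have "X * \<gamma> q * V z * \<Phi>p s \<ge> 0" if "s \<ge> 1"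
        using Xg V_pos[of z] pp[OF that] by simp
      moreover have "X * \<gamma> q * V z * \<Phi>m s \<ge> 0"
        using Xg V_pos[of z] mp[of s] by simp
      ultimately show ?thesis unfolding sU sL s_def[symmetric] by (auto simp: algebra_simps)
    next
      case False
      then have wz: "w < z" "w \<le> z" by auto
      have "fact w \<le> ?y" using less.prems by simp
      then have leg: "\<bar>sifted q w - X * \<gamma> q * V w\<bar> \<le> total_error q ?y w"
        using less.prems wz by (intro legendre) auto
      let ?Q = "P \<inter> {w..<z}"
      define t where "t = (\<lambda>p::nat. ln D / ln (real p))"
      have p2: "2 \<le> p" "p < z" "p \<in> P" "\<not> p dvd q" "ln (real p) > 0" if "p \<in> ?Q" for p
        using that w less.prems by auto
      have mult: "\<gamma> (q * p) = \<gamma> q * \<gamma> p" if "p \<in> ?Q" for p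
        using p2[OF that] less.prems by (intro gamma_mult) auto
      have IHq: "\<not> p' dvd q * p" if "p \<in> ?Q" "p' \<in> P" "p' < p" for p p'
        using that less.prems primes[of p'] primes[of p] primes_dvd_imp_eq[of p' p]
        by (auto simp: prime_dvd_mult_iff)
      have Dp: "1 \<le> D / real p" if "p \<in> ?Q" "s \<ge> 1" for p
      proof -
        have "real z \<le> D" using that(2) less.prems by (simp add: sU[symmetric])
        then show ?thesis using p2[OF that(1)] by (simp add: field_simps)
      qed
      \<comment> \<open>Removing \<open>p\<close> divides the level by \<open>p\<close> and so turns
        the argument into \<open>t p - 1\<close>. The constant \<open>fact w\<close> is passed on
        unchanged, so the levels match those in \<open>total_error_split\<close>.\<close>
      have lnDp: "ln (D / real p) / ln (real p) = t p - 1" if "p \<in> ?Q" for p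
        using p2[OF that] less.prems by (simp add: t_def ln_div diff_divide_distrib)
      have IH: "(ln (D / real p) \<ge> ln (real p) \<longrightarrow>
          sifted (q * p) p \<le> X * \<gamma> (q * p) * V p * (1 + \<Phi>p (ln (D / real p) / ln (real p)))
            + total_error (q * p) (D / real p * fact w) p) \<and>
        (ln (D / real p) \<ge> \<beta> * ln (real p) \<longrightarrow>
          sifted (q * p) p \<ge> X * \<gamma> (q * p) * V p * (1 - \<Phi>m (ln (D / real p) / ln (real p)))
            - total_error (q * p) (D / real p * fact w) p)" if "p \<in> ?Q" "s \<ge> 1" for p
        using p2[OF that(1)] less.prems IHq[OF that(1)] Dp[OF that] by (intro less.IH) auto
      have upper: "sifted q z \<le> X * \<gamma> q * V z * (1 + \<Phi>p s) + total_error q ?y z" if s: "s \<ge> 1"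
      proof -
        have low: "sifted (q * p) p \<ge> X * \<gamma> q * (\<gamma> p * V p) * (1 - \<Phi>m (t p - 1)) - total_error (q * p) (?y / real p) p"
          if p: "p \<in> ?Q" for p
        proof (cases "t p - 1 \<ge> \<beta>")
          case True
          then have "\<beta> \<le> ln (D / real p) / ln (real p)" using lnDp[OF p] by simp
          then have "ln (D / real p) \<ge> \<beta> * ln (real p)"
            by (simp only: pos_le_divide_eq[OF p2(5)[OF p]])
          then show ?thesis using IH[OF p s] by (simp add: mult[OF p] lnDp[OF p] mult.assoc)
        next
          case False
          then have "1 - \<Phi>m (t p - 1) \<le> 0" using m1[of "t p - 1"] by simp
          then have "X * \<gamma> q * (\<gamma> p * V p) * (1 - \<Phi>m (t p - 1)) \<le> 0"
            using Xg gamma_nonneg[of p] V_pos[of p] by (intro mult_nonneg_nonpos) auto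
          then show ?thesis
            using sifted_nonneg[of "q * p" p] total_error_nonneg[of "q * p" "?y / real p" p] by linarith
        qed
        have ab: "(\<Sum>p\<in>?Q. \<gamma> p * V p * \<Phi>m (t p - 1)) \<le> V z * ((1 + \<epsilon>) / s * Bp s + (1 + \<epsilon> - 1) * \<Phi>m (s - 1))"
          unfolding sum_P_telescope[OF wz(2), of "\<lambda>p. \<Phi>m (t p - 1)"] unfolding t_def
        proof (rule sieve_partial_summation[where \<psi> = "\<lambda>t. \<Phi>m (t - 1)" and B = Bp and L = "ln D"])
            show "0 < ln D" using s \<beta> lnz s_def zero_less_divide_iff[of "ln D" "ln (real z)"] by auto
            show "V n \<le> (1 + \<epsilon>) * V z * ln (real z) / ln (real n)" if "w \<le> n" "n < z" for n
              using that by (intro dim) auto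
            show "\<Phi>m (b - 1) \<le> \<Phi>m (a - 1)" if "s \<le> a" "a \<le> b" for a b
              using that by (intro ma) simp
            show "0 \<le> \<Phi>m (a - 1)" if "s \<le> a" for a using mp less_imp_le by blast
            show "(b - a) * \<Phi>m (b - 1) \<le> Bp a - Bp b" if "s \<le> a" "a \<le> b" for a b
              using that s by (intro bp) auto
            show "0 \<le> Bp a" if "s \<le> a" for a using that s by (intro bp0) auto
          qed (use w wz \<epsilon> V_decreasing less_imp_le[OF V_pos] in \<open>simp_all add: s_def\<close>)
        have "sifted q z = sifted q w - (\<Sum>p\<in>?Q. sifted (q * p) p)"
          using less.prems wz by (intro buchstab) auto
        also have "\<dots> \<le> (X * \<gamma> q * V w + total_error q ?y w)
            - (\<Sum>p\<in>?Q. X * \<gamma> q * (\<gamma> p * V p) * (1 - \<Phi>m (t p - 1)) - total_error (q * p) (?y / real p) p)"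
          using leg by (intro diff_mono sum_mono low) auto
        also have "\<dots> = X * \<gamma> q * (V w - (\<Sum>p\<in>?Q. \<gamma> p * V p) + (\<Sum>p\<in>?Q. \<gamma> p * V p * \<Phi>m (t p - 1)))
            + (total_error q ?y w + (\<Sum>p\<in>?Q. total_error (q * p) (?y / real p) p))"
          by (simp add: sum_subtractf sum.distrib sum_distrib_left algebra_simps)
        also have "\<dots> = X * \<gamma> q * (V z + (\<Sum>p\<in>?Q. \<gamma> p * V p * \<Phi>m (t p - 1))) + total_error q ?y z"
          using V_split[OF wz(2)] total_error_split[OF wz(2), of q ?y] by simp
        finally have "sifted q z \<le> X * \<gamma> q * (V z + (\<Sum>p\<in>?Q. \<gamma> p * V p * \<Phi>m (t p - 1))) + total_error q ?y z" .
        \<comment> \<open>The partial summation returns the factor \<open>1 + \<epsilon>\<close> and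
          the boundary term \<open>\<epsilon> * \<Phi>m (s - 1)\<close>; the slack in
          \<open>p_ineq\<close> restores \<open>\<Phi>p s\<close> itself, so nothing accumulates
          over the recursion.\<close>
        moreover have "V z * ((1 + \<epsilon>) / s * Bp s + (1 + \<epsilon> - 1) * \<Phi>m (s - 1)) \<le> V z * \<Phi>p s"
          using p_ineq[OF s] less_imp_le[OF V_pos[of z]] by (intro mult_left_mono) simp_all
        then have "X * \<gamma> q * (V z + (\<Sum>p\<in>?Q. \<gamma> p * V p * \<Phi>m (t p - 1))) \<le> X * \<gamma> q * (V z + V z * \<Phi>p s)"
          using Xg ab by (intro mult_left_mono) linarith+
        ultimately show ?thesis by (simp add: algebra_simps)
      qed
      have lower: "sifted q z \<ge> X * \<gamma> q * V z * (1 - \<Phi>m s) - total_error q ?y z" if s: "s \<ge> \<beta>"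
      proof -
        have s1: "s \<ge> 1" using s \<beta> by simp
        \<comment> \<open>No prime may be dropped in the lower bound;
          \<open>s \<ge> \<beta> > 2\<close> and \<open>p < z\<close> leave a level
          \<open>D / p \<ge> p\<close>, which makes the upper bound available at each of
          them.\<close>
        have t2: "t p - 1 \<ge> 1" if p: "p \<in> ?Q" for p
        proof -
          have "ln D \<ge> 2 * ln (real z)"
            using s sL mult_right_mono[of 2 \<beta> "ln (real z)"] lnz \<beta> by linarith
          also have "2 * ln (real z) \<ge> 2 * ln (real p)" using p2[OF p] by simp
          finally have "2 \<le> ln D / ln (real p)" by (simp only: pos_le_divide_eq[OF p2(5)[OF p]])
          then show ?thesis by (simp add: t_def)
        qed
        have up: "sifted (q * p) p \<le> X * \<gamma> q * (\<gamma> p * V p) * (1 + \<Phi>p (t p - 1)) + total_error (q * p) (?y / real p) p"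
          if p: "p \<in> ?Q" for p
        proof -
          have "1 \<le> ln (D / real p) / ln (real p)" using lnDp[OF p] t2[OF p] by simp
          then have "ln (D / real p) \<ge> ln (real p)"
            by (simp only: pos_le_divide_eq[OF p2(5)[OF p]] mult_1)
          then show ?thesis using IH[OF p s1] by (simp add: mult[OF p] lnDp[OF p] mult.assoc)
        qed
        have ab: "(\<Sum>p\<in>?Q. \<gamma> p * V p * \<Phi>p (t p - 1)) \<le> V z * ((1 + \<epsilon>) / s * Bm s + (1 + \<epsilon> - 1) * \<Phi>p (s - 1))"
          unfolding sum_P_telescope[OF wz(2), of "\<lambda>p. \<Phi>p (t p - 1)"] unfolding t_def
        proof (rule sieve_partial_summation[where \<psi> = "\<lambda>t. \<Phi>p (t - 1)" and B = Bm and L = "ln D"])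
            show "0 < ln D" using s \<beta> lnz s_def zero_less_divide_iff[of "ln D" "ln (real z)"] by auto
            show "V n \<le> (1 + \<epsilon>) * V z * ln (real z) / ln (real n)" if "w \<le> n" "n < z" for n
              using that by (intro dim) auto
            show "\<Phi>p (b - 1) \<le> \<Phi>p (a - 1)" if "s \<le> a" "a \<le> b" for a b
              using that s \<beta> by (intro pa) auto
            show "0 \<le> \<Phi>p (a - 1)" if "s \<le> a" for a
              using that s \<beta> pp[of "a - 1"] by simp
            show "(b - a) * \<Phi>p (b - 1) \<le> Bm a - Bm b" if "s \<le> a" "a \<le> b" for a b
              using that s by (intro bm) auto
            show "0 \<le> Bm a" if "s \<le> a" for a using that s by (intro bm0) auto
          qed (use w wz \<epsilon> V_decreasing less_imp_le[OF V_pos] in \<open>simp_all add: s_def\<close>)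
        have "X * \<gamma> q * (V w - (\<Sum>p\<in>?Q. \<gamma> p * V p) - (\<Sum>p\<in>?Q. \<gamma> p * V p * \<Phi>p (t p - 1)))
            - (total_error q ?y w + (\<Sum>p\<in>?Q. total_error (q * p) (?y / real p) p))
          = (X * \<gamma> q * V w - total_error q ?y w)
            - (\<Sum>p\<in>?Q. X * \<gamma> q * (\<gamma> p * V p) * (1 + \<Phi>p (t p - 1)) + total_error (q * p) (?y / real p) p)"
          by (simp add: sum.distrib sum_distrib_left algebra_simps)
        also have "\<dots> \<le> sifted q w - (\<Sum>p\<in>?Q. sifted (q * p) p)"
          using leg by (intro diff_mono sum_mono up) auto
        also have "\<dots> = sifted q z"
          using less.prems wz by (intro buchstab[symmetric]) auto
        finally have "X * \<gamma> q * (V z - (\<Sum>p\<in>?Q. \<gamma> p * V p * \<Phi>p (t p - 1))) - total_error q ?y z \<le> sifted q z"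
          using V_split[OF wz(2)] total_error_split[OF wz(2), of q ?y] by simp
        moreover have "V z * ((1 + \<epsilon>) / s * Bm s + (1 + \<epsilon> - 1) * \<Phi>p (s - 1)) \<le> V z * \<Phi>m s"
          using m_ineq[OF s] less_imp_le[OF V_pos[of z]] by (intro mult_left_mono) simp_all
        then have "X * \<gamma> q * (V z - V z * \<Phi>m s) \<le> X * \<gamma> q * (V z - (\<Sum>p\<in>?Q. \<gamma> p * V p * \<Phi>p (t p - 1)))"
          using Xg ab by (intro mult_left_mono) linarith+
        ultimately show ?thesis by (simp add: algebra_simps)
      qed
      show ?thesis using upper lower unfolding sU sL s_def[symmetric] by blast
    qed
  qed
  then show "ln D \<ge> ln (real z) \<Longrightarrow>
      sifted q z \<le> X * \<gamma> q * V z * (1 + \<Phi>p (ln D / ln (real z))) + total_error q (D * fact w) z"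
    and "ln D \<ge> \<beta> * ln (real z) \<Longrightarrow>
      sifted q z \<ge> X * \<gamma> q * V z * (1 - \<Phi>m (ln D / ln (real z))) - total_error q (D * fact w) z"
    by blast+
qed

end

section \<open>Mertens estimates and the sieve dimension\<close>

lemma ln_eq_sum_multiplicity:
  assumes "n > 0"
  shows "ln (real n) = (\<Sum>p\<in>prime_factors n. real (multiplicity p n) * ln (real p))"
proof -
  have "real n = (\<Prod>p\<in>prime_factors n. real p ^ multiplicity p n)"
    using prod_prime_factors[of n] assms by (simp flip: of_nat_power of_nat_prod)
  then have "ln (real n) = (\<Sum>p\<in>prime_factors n. ln (real p ^ multiplicity p n))"
    by (simp only:) (rule ln_prod, auto dest: in_prime_factors_imp_prime intro: prime_gt_0_nat)
  then show ?thesis by (simp add: ln_realpow)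
qed

section \<open>Chebyshev's upper bound\<close>

definition prime_theta :: "nat \<Rightarrow> real" where
  "prime_theta n = (\<Sum>p | prime p \<and> p \<le> n. ln (real p))"

lemma finite_primes_le: "finite {p::nat. prime p \<and> p \<le> n}"
  by (rule finite_subset[of _ "{..n}"]) auto

lemma prime_theta_Suc:
  "prime_theta (Suc n) = prime_theta n + (if prime (Suc n) then ln (real (Suc n)) else 0)"
proof -
  have "{p. prime p \<and> p \<le> Suc n} = (if prime (Suc n) then insert (Suc n) {p. prime p \<and> p \<le> n} else {p. prime p \<and> p \<le> n})"
    by (auto simp: le_Suc_eq)
  then show ?thesis using finite_primes_le[of n] by (simp add: prime_theta_def)
qed

text \<open>The primes in \<open>(m, 2m]\<close> all divide the central binomial coefficient, which
  is at most \<open>4^m\<close>; then \<open>ln 2 \<le> 1\<close> rounds \<open>2 * ln 2\<close> up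
  to 2.\<close>

lemma prime_theta_double: "prime_theta (2 * m) \<le> prime_theta m + real m * 2"
proof -
  define N where "N = 2 * m choose m"
  have N0: "N > 0" by (simp add: N_def)
  define A where "A = {p::nat. prime p \<and> m < p \<and> p \<le> 2 * m}"
  have fA: "finite A" by (rule finite_subset[of _ "{..2*m}"]) (auto simp: A_def)
  have "A \<subseteq> prime_factors N"
  proof
    fix p assume p: "p \<in> A"
    have "fact m * fact m * N = fact (2 * m)"
      using binomial_fact_lemma[of m "2 * m"] by (simp add: N_def mult_2)
    moreover have "p dvd fact (2 * m)" using p by (simp add: A_def prime_dvd_fact_iff)
    ultimately have "p dvd fact m \<or> p dvd N"
      using p by (metis (no_types, lifting) A_def mem_Collect_eq prime_dvd_mult_iff)
    then have "p dvd N" using p by (auto simp: A_def prime_dvd_fact_iff)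
    then show "p \<in> prime_factors N" using p N0 by (auto simp: A_def in_prime_factors_iff)
  qed
  then have "(\<Sum>p\<in>A. ln (real p)) \<le> (\<Sum>p\<in>prime_factors N. ln (real p))"
  proof (intro sum_mono2)
    fix b assume "b \<in> prime_factors N - A"
    then show "0 \<le> ln (real b)" using prime_ge_1_nat[of b] in_prime_factors_imp_prime[of b N] by auto
  qed auto
  also have "\<dots> \<le> (\<Sum>p\<in>prime_factors N. real (multiplicity p N) * ln (real p))"
  proof (rule sum_mono)
    fix p assume p: "p \<in> prime_factors N"
    have "1 * ln (real p) \<le> real (multiplicity p N) * ln (real p)"
      using p prime_ge_1_nat[of p] by (intro mult_right_mono) (auto simp: prime_factors_multiplicity)
    then show "ln (real p) \<le> real (multiplicity p N) * ln (real p)" by simp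
  qed
  also have "\<dots> = ln (real N)" using ln_eq_sum_multiplicity[OF N0] by simp
  also have "\<dots> \<le> ln (real (2 ^ (2 * m)))"
  proof -
    have "N \<le> (\<Sum>k\<le>2*m. 2 * m choose k)" unfolding N_def by (rule member_le_sum) auto
    also have "\<dots> = 2 ^ (2 * m)" by (rule choose_row_sum)
    finally show ?thesis using N0 by (simp only: ln_le_cancel_iff of_nat_0_less_iff of_nat_le_iff)
  qed
  also have "\<dots> = real m * (2 * ln 2)" by (simp add: ln_realpow)
  also have "\<dots> \<le> real m * 2" using ln_le_minus_one[of 2] by (intro mult_left_mono) auto
  finally have "(\<Sum>p\<in>A. ln (real p)) \<le> real m * 2" .
  moreover have "{p. prime p \<and> p \<le> 2 * m} = {p. prime p \<and> p \<le> m} \<union> A"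
    "{p. prime p \<and> p \<le> m} \<inter> A = {}" by (auto simp: A_def)
  then have "prime_theta (2 * m) = prime_theta m + (\<Sum>p\<in>A. ln (real p))"
    unfolding prime_theta_def using fA finite_primes_le by (simp add: sum.union_disjoint)
  ultimately show ?thesis by simp
qed

text \<open>The constant 4 survives doubling with room to spare: \<open>4 m + 2 m\<close> stays
  \<open>2 m\<close> below \<open>8 m\<close>, which covers \<open>ln (2 m + 1)\<close> when
  \<open>n\<close> is odd.\<close>

lemma prime_theta_le: "prime_theta n \<le> 4 * real n"
proof (induction n rule: less_induct)
  case (less n)
  show ?case
  proof (cases "n = 0")
    case True
    then show ?thesis by (simp add: prime_theta_def)
  next
    case False
    define m where "m = n div 2"
    have m: "m < n" using False by (simp add: m_def)
    have d: "prime_theta (2 * m) \<le> 6 * real m"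
      using less.IH[OF m] prime_theta_double[of m] by linarith
    show ?thesis
    proof (cases "even n")
      case True
      then have "n = 2 * m" by (simp add: m_def)
      then show ?thesis using d by simp
    next
      case False
      then have n: "n = Suc (2 * m)" by (simp add: m_def)
      have "ln (real (Suc (2 * m))) \<le> 2 * real m"
        using ln_le_minus_one[of "real (Suc (2 * m))"] by simp
      then have "prime_theta n \<le> prime_theta (2 * m) + 2 * real m"
        by (simp add: n prime_theta_Suc)
      then show ?thesis using d n by simp
    qed
  qed
qed

text \<open>Legendre's formula. The upper limit \<open>N\<close> is independent of \<open>n\<close>,
  so the range of summation stays fixed during the induction.\<close>

lemma multiplicity_fact_eq:
  assumes p: "prime p" and "n \<le> N"
  shows "multiplicity p (fact n :: nat) = (\<Sum>j=1..N. n div p ^ j)"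
  using assms(2)
proof (induction n)
  case (Suc n)
  have "multiplicity p (fact (Suc n) :: nat) = multiplicity p (Suc n) + multiplicity p (fact n :: nat)"
    using p by (simp add: prime_elem_multiplicity_mult_distrib del: mult_Suc)
  moreover have "multiplicity p (Suc n) = (\<Sum>j=1..N. if p ^ j dvd Suc n then 1 else 0)"
  proof -
    have pd: "p ^ j dvd Suc n \<longleftrightarrow> j \<le> multiplicity p (Suc n)" for j
      using p by (intro power_dvd_iff_le_multiplicity) (auto simp: prime_gt_1_nat)
    \<comment> \<open>The multiplicity is smaller than \<open>2\<close> to its own power, hence less
      than \<open>Suc n\<close>, so stopping the sum at \<open>N\<close> loses nothing.\<close>
    have "multiplicity p (Suc n) < 2 ^ multiplicity p (Suc n)" by (rule less_exp)
    also have "\<dots> \<le> p ^ multiplicity p (Suc n)" using prime_ge_2_nat[OF p] by (intro power_mono) auto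
    also have "\<dots> \<le> Suc n" using multiplicity_dvd[of p "Suc n"] by (intro dvd_imp_le) auto
    finally have "multiplicity p (Suc n) \<le> N" using Suc.prems by simp
    then have "{1..N} \<inter> {j. j \<le> multiplicity p (Suc n)} = {1..multiplicity p (Suc n)}" by auto
    then show ?thesis by (simp add: pd sum.If_cases)
  qed
  moreover have "Suc n div d = n div d + (if d dvd Suc n then 1 else 0)" for d
    by (simp add: div_Suc dvd_eq_mod_eq_0)
  ultimately show ?case using Suc by (simp add: sum.distrib)
qed simp

lemma ln_fact_eq: "ln (fact n) = (\<Sum>p | prime p \<and> p \<le> n. real (multiplicity p (fact n :: nat)) * ln (real p))"
proof -
  have "prime_factors (fact n :: nat) = {p. prime p \<and> p \<le> n}"
    by (auto simp: prime_factors_dvd prime_dvd_fact_iff)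
  then show ?thesis using ln_eq_sum_multiplicity[of "fact n"] by simp
qed

section \<open>Mertens' first theorem and sums of reciprocal primes\<close>

definition mertens_sum :: "nat \<Rightarrow> real" where
  "mertens_sum n = (\<Sum>p | prime p \<and> p \<le> n. ln (real p) / real p)"

lemma mertens_sum_Suc:
  "mertens_sum (Suc n) = mertens_sum n + (if prime (Suc n) then ln (real (Suc n)) / real (Suc n) else 0)"
proof -
  have "{p. prime p \<and> p \<le> Suc n} = (if prime (Suc n) then insert (Suc n) {p. prime p \<and> p \<le> n} else {p. prime p \<and> p \<le> n})"
    by (auto simp: le_Suc_eq)
  then show ?thesis using finite_primes_le[of n] by (simp add: mertens_sum_def)
qed

text \<open>Of the multiplicity of \<open>p\<close> in \<open>n!\<close> only the multiples of
  \<open>p\<close> itself are kept. Dropping the rounding of \<open>n / p\<close> costs at most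
  \<open>prime_theta n \<le> 4 n\<close>, the source of the constant, and
  \<open>n! \<le> n^n\<close> gives the main term.\<close>

lemma mertens_upper:
  assumes n: "n \<ge> 1"
  shows "mertens_sum n \<le> ln (real n) + 4"
proof -
  have "real n * mertens_sum n - prime_theta n = (\<Sum>p | prime p \<and> p \<le> n. (real n / real p - 1) * ln (real p))"
    by (simp add: mertens_sum_def prime_theta_def sum_distrib_left sum_subtractf[symmetric] algebra_simps)
  also have "\<dots> \<le> (\<Sum>p | prime p \<and> p \<le> n. real (multiplicity p (fact n :: nat)) * ln (real p))"
  proof (rule sum_mono, rule mult_right_mono)
    fix p assume "p \<in> {p. prime p \<and> p \<le> n}"
    then have p: "prime p" by simp
    have "n div p = (\<Sum>j\<in>{1}. n div p ^ j)" by simp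
    also have "\<dots> \<le> (\<Sum>j=1..n. n div p ^ j)" using n by (intro sum_mono2) auto
    also have "\<dots> = multiplicity p (fact n :: nat)" using multiplicity_fact_eq[OF p order_refl] by simp
    finally have "real (n div p) \<le> real (multiplicity p (fact n :: nat))" by simp
    moreover have "real n / real p - 1 \<le> real (n div p)"
      using floor_divide_of_nat_eq[of n p, where ?'a = real] by linarith
    ultimately show "real n / real p - 1 \<le> real (multiplicity p (fact n :: nat))" by linarith
    show "0 \<le> ln (real p)" using prime_ge_1_nat[OF p] by simp
  qed
  also have "\<dots> = ln (fact n)" by (simp add: ln_fact_eq)
  also have "\<dots> \<le> real n * ln (real n)"
  proof -
    have "(fact n :: real) \<le> real n ^ n" using fact_le_power[of n, where ?'a = real] n by simp
    then have "ln (fact n :: real) \<le> ln (real n ^ n)" using n by (subst ln_le_cancel_iff) auto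
    then show ?thesis using n by (simp add: ln_realpow)
  qed
  finally have "real n * mertens_sum n \<le> real n * ln (real n) + 4 * real n"
    using prime_theta_le[of n] by simp
  then have "real n * mertens_sum n \<le> real n * (ln (real n) + 4)" by (simp add: algebra_simps)
  then show ?thesis using n by simp
qed

text \<open>A telescoping majorant. The 2 added to the logarithm contributes
  \<open>2 / (x * (x + 1)) \<ge> 1 / x^2\<close> per step, which absorbs the growth
  \<open>ln (x + 1) - ln x \<le> 1 / x\<close> of the numerator.\<close>

lemma sum_ln_over_consecutive:
  "n \<ge> 1 \<Longrightarrow> (\<Sum>k=2..n. ln (real k) / (real k * (real k - 1))) \<le> 2 - (ln (real n) + 2) / real n"
proof (induction n rule: nat_induct_at_least)
  case (Suc n)
  define x where "x = real n"
  have x: "x \<ge> 1" using Suc by (simp add: x_def)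
  have "ln (1 + 1 / x) \<le> 1 / x" using x by (intro ln_add_one_self_le_self) auto
  moreover have "1 + 1 / x = (x + 1) / x" using x by (simp add: add_divide_distrib)
  then have "ln (x + 1) - ln x = ln (1 + 1 / x)" using x by (simp add: ln_div)
  ultimately have l: "ln (x + 1) \<le> ln x + 1 / x" by linarith
  have x0: "x \<noteq> 0" "x + 1 \<noteq> 0" using x by auto
  have split: "b / (x * (x + 1)) = b / x - b / (x + 1)" for b
  proof -
    have "b * (x + 1) - b * x = b" by (simp add: algebra_simps)
    then show ?thesis by (simp only: diff_frac_eq[OF x0])
  qed
  have "0 \<le> - (1 / x) / x + 2 / (x * (x + 1))"
  proof -
    have "1 / (x * x) = 2 / (x * (x + x))" using x by simp
    also have "\<dots> \<le> 2 / (x * (x + 1))" using x by (intro divide_left_mono mult_left_mono mult_pos_pos) auto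
    finally show ?thesis by simp
  qed
  also have "\<dots> \<le> (ln x - ln (x + 1)) / x + 2 / (x * (x + 1))"
    using x l by (intro add_right_mono divide_right_mono) auto
  also have "\<dots> = (ln x + 2) / x - (ln (x + 1) + 2) / (x + 1) - ln (x + 1) / (x * (x + 1))"
    unfolding split by (simp add: add_divide_distrib diff_divide_distrib)
  finally have "ln (x + 1) / (x * (x + 1)) \<le> (ln x + 2) / x - (ln (x + 1) + 2) / (x + 1)" by linarith
  then show ?case using Suc by (simp add: x_def add.commute mult.commute)
qed simp

lemma ln_fact_lower: "n \<ge> 1 \<Longrightarrow> real n * ln (real n) - real n \<le> ln (fact n)"
proof (induction n rule: nat_induct_at_least)
  case (Suc n)
  define x where "x = real n"
  have x: "x \<ge> 1" using Suc by (simp add: x_def)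
  have "ln (1 + 1 / x) \<le> 1 / x" using x by (intro ln_add_one_self_le_self) auto
  moreover have "1 + 1 / x = (x + 1) / x" using x by (simp add: add_divide_distrib)
  then have "ln (x + 1) - ln x = ln (1 + 1 / x)" using x by (simp add: ln_div)
  ultimately have "x * (ln (x + 1) - ln x) \<le> x * (1 / x)" using x by (intro mult_left_mono) auto
  then have "x * ln (x + 1) - x * ln x \<le> 1" using x by (simp add: algebra_simps)
  moreover have "ln (fact (Suc n) :: real) = ln (x + 1) + ln (fact n)"
    by (simp add: ln_mult x_def add.commute)
  ultimately show ?case using Suc by (simp add: x_def algebra_simps)
qed simp

text \<open>Here all powers of \<open>p\<close> count, through a geometric series bounded by
  \<open>n / (p - 1)\<close>. Of the constant 3, one unit comes from the weak Stirling bound and two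
  from replacing \<open>1 / (p - 1)\<close> by \<open>1 / p\<close>.\<close>

lemma mertens_lower:
  assumes n: "n \<ge> 1"
  shows "ln (real n) - 3 \<le> mertens_sum n"
proof -
  have "real n * ln (real n) - real n \<le> ln (fact n)" by (rule ln_fact_lower[OF n])
  also have "\<dots> = (\<Sum>p | prime p \<and> p \<le> n. real (multiplicity p (fact n :: nat)) * ln (real p))"
    by (rule ln_fact_eq)
  also have "\<dots> \<le> (\<Sum>p | prime p \<and> p \<le> n. real n / (real p - 1) * ln (real p))"
  proof (rule sum_mono, rule mult_right_mono)
    fix p assume "p \<in> {p. prime p \<and> p \<le> n}"
    then have p: "prime p" by simp
    then have p2: "real p \<ge> 2" using prime_ge_2_nat[of p] by simp
    have "real (multiplicity p (fact n :: nat)) = (\<Sum>j=1..n. real (n div p ^ j))"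
      by (simp add: multiplicity_fact_eq[OF p order_refl])
    also have "\<dots> \<le> (\<Sum>j=1..n. real n * (1 / real p) ^ j)"
    proof (rule sum_mono)
      fix j
      have "real (n div p ^ j) \<le> real n / real (p ^ j)"
        using floor_divide_of_nat_eq[of n "p ^ j", where ?'a = real] by linarith
      then show "real (n div p ^ j) \<le> real n * (1 / real p) ^ j" by (simp add: power_divide)
    qed
    also have "\<dots> = real n * (\<Sum>j=1..n. (1 / real p) ^ j)" by (simp add: sum_distrib_left)
    also have "(\<Sum>j=1..n. (1 / real p) ^ j) \<le> 1 / (real p - 1)"
    proof -
      have "(real p - 1) * (\<Sum>j=1..m. (1 / real p) ^ j) = 1 - (1 / real p) ^ m" for m
      proof (induction m)
        case (Suc m)
        have "real p * (1 / real p) ^ Suc m = (1 / real p) ^ m" using p2 by simp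
        then show ?case using Suc by (simp add: algebra_simps del: power_Suc)
      qed simp
      then have "(real p - 1) * (\<Sum>j=1..n. (1 / real p) ^ j) \<le> 1" by simp
      then show ?thesis using p2 by (simp add: pos_le_divide_eq mult.commute)
    qed
    finally show "real (multiplicity p (fact n :: nat)) \<le> real n / (real p - 1)"
      by (simp add: mult_left_mono)
    show "0 \<le> ln (real p)" using p2 by simp
  qed
  also have "\<dots> = real n * (mertens_sum n + (\<Sum>p | prime p \<and> p \<le> n. ln (real p) / (real p * (real p - 1))))"
  proof -
    have e: "real n / (real p - 1) * ln (real p)
        = real n * (ln (real p) / real p + ln (real p) / (real p * (real p - 1)))" if "prime p" for p
      using prime_ge_2_nat[OF that] by (simp add: divide_simps) (simp add: algebra_simps)
    have "(\<Sum>p | prime p \<and> p \<le> n. real n / (real p - 1) * ln (real p)) =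
      (\<Sum>p | prime p \<and> p \<le> n. real n * (ln (real p) / real p + ln (real p) / (real p * (real p - 1))))"
      by (intro sum.cong e) auto
    then show ?thesis by (simp add: mertens_sum_def sum_distrib_left sum.distrib distrib_left)
  qed
  finally have "real n * ln (real n) - real n
      \<le> real n * (mertens_sum n + (\<Sum>p | prime p \<and> p \<le> n. ln (real p) / (real p * (real p - 1))))" .
  moreover have "(\<Sum>p | prime p \<and> p \<le> n. ln (real p) / (real p * (real p - 1))) \<le> 2"
  proof -
    have "(\<Sum>p | prime p \<and> p \<le> n. ln (real p) / (real p * (real p - 1)))
        \<le> (\<Sum>k=2..n. ln (real k) / (real k * (real k - 1)))"
      by (rule sum_mono2) (auto dest: prime_ge_2_nat)
    also have "\<dots> \<le> 2 - (ln (real n) + 2) / real n" by (rule sum_ln_over_consecutive[OF n])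
    also have "\<dots> \<le> 2" using n by simp
    finally show ?thesis .
  qed
  then have "real n * (mertens_sum n + (\<Sum>p | prime p \<and> p \<le> n. ln (real p) / (real p * (real p - 1))))
      \<le> real n * (mertens_sum n + 2)"
    by (intro mult_left_mono) auto
  ultimately have "real n * (ln (real n) - 1) \<le> real n * (mertens_sum n + 2)"
    unfolding right_diff_distrib by linarith
  then show ?thesis using n by simp
qed

text \<open>Summation by parts against a decreasing \<open>c\<close> of total variation at most
  \<open>c w\<close>. The term \<open>E k * c k\<close> stays exact during the induction and is
  estimated only at the end.\<close>

lemma abel_bound:
  fixes E c :: "nat \<Rightarrow> real"
  assumes "w \<le> k" "0 < w"
    and E: "\<And>n. w - 1 \<le> n \<Longrightarrow> \<bar>E n\<bar> \<le> C"
    and c: "\<And>n. w \<le> n \<Longrightarrow> c (Suc n) \<le> c n" "\<And>n. w \<le> n \<Longrightarrow> 0 \<le> c n"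
  shows "(\<Sum>n=w..<Suc k. (E n - E (n - 1)) * c n) \<le> 2 * C * c w"
proof -
  have "(\<Sum>n=w..<Suc k. (E n - E (n - 1)) * c n) \<le> E k * c k + C * (2 * c w - c k)"
    using assms(1)
  proof (induction k rule: dec_induct)
    case base
    have "- E (w - 1) * c w \<le> C * c w"
      using E[of "w - 1"] c(2)[of w] by (intro mult_right_mono) auto
    then show ?case by (simp add: algebra_simps)
  next
    case (step k)
    have "w - 1 \<le> k" using step by linarith
    then have "E k * (c k - c (Suc k)) \<le> C * (c k - c (Suc k))"
      using E[of k] c(1)[of k] step by (intro mult_right_mono) auto
    then show ?case using step by (simp add: algebra_simps)
  qed
  moreover have "w - 1 \<le> k" using assms(1) by linarith
  then have "E k * c k \<le> C * c k" using E[of k] c(2)[of k] assms(1) by (intro mult_right_mono) auto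
  ultimately show ?thesis by (simp add: algebra_simps)
qed

text \<open>Partial summation with weights \<open>1 / ln n\<close>: the fluctuation \<open>E\<close>
  of Mertens' sum, at most 4 in size, contributes \<open>8 / ln w\<close>, and the smooth part is
  dominated by differences of \<open>ln (ln n)\<close>, which telescope from
  \<open>w - 1\<close>.\<close>

lemma sum_reciprocal_primes_upper:
  assumes w: "3 \<le> w" "w \<le> z"
  shows "(\<Sum>p | prime p \<and> w \<le> p \<and> p < z. 1 / real p)
    \<le> ln (ln (real z) / ln (real w - 1)) + 8 / ln (real w)"
proof (cases "w = z")
  case True
  have "(\<Sum>p | prime p \<and> w \<le> p \<and> p < z. 1 / real p) = 0"
    using True by (intro sum.neutral) auto
  moreover have "1 \<le> ln (real z) / ln (real w - 1)"
    using w True by (simp add: ln_ge_zero)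
  ultimately show ?thesis using w by simp
next
  case False
  then obtain k where k: "z = Suc k" "w \<le> k" using w by (cases z) auto
  define E where "E = (\<lambda>n. mertens_sum n - ln (real n))"
  define c where "c = (\<lambda>n. 1 / ln (real n))"
  have E: "\<bar>E n\<bar> \<le> 4" if "n \<ge> 1" for n
    using mertens_upper[OF that] mertens_lower[OF that] by (simp add: E_def)
  have "{p. prime p \<and> w \<le> p \<and> p < z} = {p \<in> {w..<z}. prime p}" by auto
  then have "(\<Sum>p | prime p \<and> w \<le> p \<and> p < z. 1 / real p) = (\<Sum>n=w..<z. if prime n then 1 / real n else 0)"
    by (simp only: sum.inter_filter finite_atLeastLessThan)
  also have "\<dots> = (\<Sum>n=w..<z. (E n - E (n - 1)) * c n + (ln (real n) - ln (real (n - 1))) * c n)"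
  proof (rule sum.cong)
    fix n assume "n \<in> {w..<z}"
    then obtain m where m: "n = Suc m" "m \<ge> 2" using w by (cases n) auto
    then have "ln (real n) > 0" by simp
    then show "(if prime n then 1 / real n else 0) = (E n - E (n - 1)) * c n + (ln (real n) - ln (real (n - 1))) * c n"
      using m by (simp add: E_def c_def mertens_sum_Suc field_simps)
  qed simp
  also have "\<dots> = (\<Sum>n=w..<z. (E n - E (n - 1)) * c n) + (\<Sum>n=w..<z. (ln (real n) - ln (real (n - 1))) * c n)"
    by (rule sum.distrib)
  also have "(\<Sum>n=w..<z. (E n - E (n - 1)) * c n) \<le> 2 * 4 * c w"
    unfolding k(1)
  proof (rule abel_bound)
    show "c (Suc n) \<le> c n" if "w \<le> n" for n
      unfolding c_def using that w by (intro divide_left_mono mult_pos_pos) auto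
    show "0 \<le> c n" if "w \<le> n" for n using that w by (simp add: c_def)
  qed (use k w E in auto)
  also have "(\<Sum>n=w..<z. (ln (real n) - ln (real (n - 1))) * c n) \<le> (\<Sum>n=w..<z. ln (ln (real n)) - ln (ln (real (n - 1))))"
  proof (rule sum_mono)
    fix n assume "n \<in> {w..<z}"
    then have n: "n \<ge> 3" using w by simp
    define a where "a = ln (real (n - 1))"
    define b where "b = ln (real n)"
    have ab: "0 < a" "a \<le> b" using n by (auto simp: a_def b_def)
    have "ln (a / b) \<le> a / b - 1" using ab by (intro ln_le_minus_one) auto
    then have "(b - a) * (1 / b) \<le> ln b - ln a" using ab by (simp add: ln_div field_simps)
    then show "(ln (real n) - ln (real (n - 1))) * c n \<le> ln (ln (real n)) - ln (ln (real (n - 1)))"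
      by (simp add: a_def b_def c_def)
  qed
  also have "\<dots> = ln (ln (real k)) - ln (ln (real (w - 1)))"
    unfolding k(1) using k(2)
  proof (induction k rule: dec_induct)
    case (step k)
    then show ?case by simp
  qed simp
  also have "ln (ln (real k)) \<le> ln (ln (real z))" using k w by simp
  also have "ln (ln (real z)) - ln (ln (real (w - 1))) = ln (ln (real z) / ln (real w - 1))"
    using w k by (subst ln_div) (auto simp: of_nat_diff)
  finally show ?thesis by (simp add: c_def)
qed

text \<open>All deviations from \<open>ln n / ln m\<close> are bounded by a quantity that depends on
  \<open>n\<close> alone and tends to 0, so raising \<open>w\<close> yields dimension 1 with any
  prescribed factor \<open>1 + \<epsilon>\<close>, uniformly in \<open>m\<close>.\<close>

lemma sieve_dimension:
  fixes P :: "nat set" and \<gamma> :: "nat \<Rightarrow> real"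
  assumes P: "\<And>p. p \<in> P \<Longrightarrow> prime p"
    and \<gamma>: "\<And>p. p \<in> P \<Longrightarrow> 0 \<le> \<gamma> p \<and> \<gamma> p \<le> 1 / real p + 2 / (real p * (real p - 1))"
    and \<epsilon>: "\<epsilon> > 0"
  obtains w where "w \<ge> 4"
    "\<And>n m. w \<le> n \<Longrightarrow> n \<le> m \<Longrightarrow> ln (real n) / ln (real m) \<le> (1 + \<epsilon>) * (\<Prod>p\<in>P \<inter> {n..<m}. 1 - \<gamma> p)"
proof -
  \<comment> \<open>The first term trades \<open>ln (n - 1)\<close> for \<open>ln n\<close>, the
    second is the Mertens fluctuation, the third sums \<open>10 / (k * (k - 1))\<close>. The 10 is 2
    from the bound on \<open>\<gamma> p\<close> plus 8 from \<open>2 * (\<gamma> p)^2\<close>, as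
    \<open>\<gamma> p \<le> 2 / p\<close>.\<close>
  define err where "err = (\<lambda>n::nat. ln (ln (real n) / ln (real n - 1)) + 8 / ln (real n) + 10 / (real n - 1))"
  have "err \<longlonglongrightarrow> 0" unfolding err_def by real_asymp
  moreover have "ln (1 + \<epsilon>) > 0" using \<epsilon> by simp
  ultimately have "eventually (\<lambda>n. err n < ln (1 + \<epsilon>)) sequentially"
    by (rule order_tendstoD(2))
  then obtain w1 where w1: "\<And>n. n \<ge> w1 \<Longrightarrow> err n < ln (1 + \<epsilon>)"
    unfolding eventually_sequentially by blast
  show ?thesis
  proof (rule that[of "max 4 w1"])
    fix n m :: nat assume n: "max 4 w1 \<le> n" and nm: "n \<le> m"
    have n4: "4 \<le> n" using n by simp
    define Q where "Q = P \<inter> {n..<m}"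
    have finQ: "finite Q" by (simp add: Q_def)
    have gp: "0 \<le> \<gamma> p" "\<gamma> p \<le> 1 / 2" "\<gamma> p + 2 * (\<gamma> p)\<^sup>2 \<le> 1 / real p + 10 / (real p * (real p - 1))"
      if p: "p \<in> Q" for p
    proof -
      define x where "x = real p"
      have x: "x \<ge> 4" using p n4 by (auto simp: Q_def x_def)
      have g1: "0 \<le> \<gamma> p" "\<gamma> p \<le> 1 / x + 2 / (x * (x - 1))" using \<gamma>[of p] p by (auto simp: Q_def x_def)
      have "2 / (x * (x - 1)) \<le> 2 / (x * 2)" using x by (intro divide_left_mono mult_left_mono mult_pos_pos) auto
      then have g2: "\<gamma> p \<le> 2 / x" using g1 x by simp
      have "2 / x \<le> 2 / 4" using x by (intro divide_left_mono) auto
      then show "\<gamma> p \<le> 1 / 2" using g2 by simp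
      have "(\<gamma> p)\<^sup>2 \<le> (2 / x)\<^sup>2" using g1 g2 by (intro power_mono) auto
      also have "\<dots> = 4 / (x * x)" by (simp add: power2_eq_square)
      also have "\<dots> \<le> 4 / (x * (x - 1))" using x by (intro divide_left_mono mult_left_mono mult_pos_pos) auto
      finally have "2 * (\<gamma> p)\<^sup>2 \<le> 8 / (x * (x - 1))" by simp
      then show "\<gamma> p + 2 * (\<gamma> p)\<^sup>2 \<le> 1 / real p + 10 / (real p * (real p - 1))"
        using g1 by (simp add: x_def)
      show "0 \<le> \<gamma> p" by fact
    qed
    have pos: "(\<Prod>p\<in>Q. 1 - \<gamma> p) > 0" using gp(2) by (intro prod_pos) fastforce
    have "- ln (\<Prod>p\<in>Q. 1 - \<gamma> p) = (\<Sum>p\<in>Q. - ln (1 - \<gamma> p))"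
      using finQ gp(2) by (subst ln_prod) (fastforce simp: sum_negf)+
    also have "\<dots> \<le> (\<Sum>p\<in>Q. 1 / real p + 10 / (real p * (real p - 1)))"
    proof (rule sum_mono)
      fix p assume p: "p \<in> Q"
      show "- ln (1 - \<gamma> p) \<le> 1 / real p + 10 / (real p * (real p - 1))"
        using ln_one_minus_pos_lower_bound[OF gp(1,2)[OF p]] gp(3)[OF p] by linarith
    qed
    also have "\<dots> = (\<Sum>p\<in>Q. 1 / real p) + (\<Sum>p\<in>Q. 10 / (real p * (real p - 1)))"
      by (rule sum.distrib)
    also have "(\<Sum>p\<in>Q. 1 / real p) \<le> (\<Sum>p | prime p \<and> n \<le> p \<and> p < m. 1 / real p)"
      by (rule sum_mono2) (use P in \<open>auto simp: Q_def\<close>)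
    also have "\<dots> \<le> ln (ln (real m) / ln (real n - 1)) + 8 / ln (real n)"
      using n4 nm by (intro sum_reciprocal_primes_upper) auto
    also have "(\<Sum>p\<in>Q. 10 / (real p * (real p - 1))) \<le> (\<Sum>k=n..<m. 10 / (real k * (real k - 1)))"
      using n4 by (intro sum_mono2) (auto simp: Q_def)
    also have "\<dots> = 10 / (real n - 1) - 10 / (real m - 1)"
      using nm
    proof (induction m rule: dec_induct)
      case (step k)
      have "10 / (real k * (real k - 1)) = 10 / (real k - 1) - 10 / real k"
        using step n4 by (simp add: field_simps)
      then show ?case using step by simp
    qed simp
    also have "\<dots> \<le> 10 / (real n - 1)" using nm n4 by simp
    also have "ln (ln (real m) / ln (real n - 1)) + 8 / ln (real n) + 10 / (real n - 1)
        = ln (ln (real m) / ln (real n)) + err n"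
      using n4 nm by (simp add: err_def ln_div)
    also have "\<dots> \<le> ln (ln (real m) / ln (real n)) + ln (1 + \<epsilon>)"
      using w1[of n] n by simp
    also have "\<dots> = - ln (ln (real n) / ln (real m) / (1 + \<epsilon>))"
      using n4 nm \<epsilon> by (simp add: ln_div ln_mult)
    finally have "ln (ln (real n) / ln (real m) / (1 + \<epsilon>)) \<le> ln (\<Prod>p\<in>Q. 1 - \<gamma> p)" by simp
    then have "ln (real n) / ln (real m) / (1 + \<epsilon>) \<le> (\<Prod>p\<in>Q. 1 - \<gamma> p)"
      using n4 nm \<epsilon> pos by (subst (asm) ln_le_cancel_iff) auto
    then show "ln (real n) / ln (real m) \<le> (1 + \<epsilon>) * (\<Prod>p\<in>P \<inter> {n..<m}. 1 - \<gamma> p)"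
      using \<epsilon> pos_divide_le_eq[of "1 + \<epsilon>" "ln (real n) / ln (real m)"]
      by (simp only: Q_def mult.commute)
  qed simp
qed

section \<open>Divisor bounds and representations as sums of two squares\<close>

definition divisor_count :: "nat \<Rightarrow> nat" where
  "divisor_count n = card {d. d dvd n}"

lemma divisor_count_mult_le:
  assumes "a > 0" "b > 0"
  shows "divisor_count (a * b) \<le> divisor_count a * divisor_count b"
proof -
  have "{d. d dvd a * b} \<subseteq> (\<lambda>(x, y). x * y) ` ({d. d dvd a} \<times> {d. d dvd b})"
  proof
    fix d assume "d \<in> {d. d dvd a * b}"
    then obtain x y where "d = x * y" "x dvd a" "y dvd b" by (auto elim: dvd_productE)
    then show "d \<in> (\<lambda>(x, y). x * y) ` ({d. d dvd a} \<times> {d. d dvd b})" by auto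
  qed
  then have "divisor_count (a * b) \<le> card ({d. d dvd a} \<times> {d. d dvd b})"
    unfolding divisor_count_def using assms by (intro surj_card_le) auto
  then show ?thesis by (simp add: divisor_count_def card_cartesian_product)
qed

lemma divisor_count_prime_power:
  assumes "prime p"
  shows "divisor_count (p ^ e) \<le> e + 1"
proof -
  have "{d. d dvd p ^ e} \<subseteq> (\<lambda>i. p ^ i) ` {..e}"
    using divides_primepow_nat[OF assms] by auto
  then have "divisor_count (p ^ e) \<le> card {..e}"
    unfolding divisor_count_def by (intro surj_card_le) auto
  then show ?thesis by simp
qed

text \<open>Prime by prime: if \<open>p \<ge> 2 powr (1 / \<kappa>)\<close> then
  \<open>e + 1 \<le> 2 ^ e \<le> p powr (\<kappa> * e)\<close> costs no constant, and each of the
  finitely many smaller primes costs at most a factor \<open>K\<close>.\<close>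

lemma divisor_count_le_powr:
  fixes \<kappa> :: real
  assumes "\<kappa> > 0"
  obtains C where "C > 0" "\<And>n. n > 0 \<Longrightarrow> real (divisor_count n) \<le> C * real n powr \<kappa>"
proof -
  define K where "K = max 1 (1 / (\<kappa> * ln 2))"
  have K: "K \<ge> 1" "K * (\<kappa> * ln 2) \<ge> 1" using assms by (auto simp: K_def max_def field_simps)
  define B where "B = nat \<lceil>2 powr (1 / \<kappa>)\<rceil>"
  define S where "S = (\<lambda>n. prime_factors n \<inter> {..<B})"
  have small: "real e + 1 \<le> K * real p powr (\<kappa> * real e)" if "prime p" for p e
  proof -
    have "real e + 1 \<le> K * (1 + \<kappa> * real e * ln 2)"
      using K mult_right_mono[OF K(2), of "real e"] by (simp add: algebra_simps)
    also have "1 + \<kappa> * real e * ln 2 \<le> exp (\<kappa> * real e * ln 2)" by (rule exp_ge_add_one_self)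
    also have "\<dots> = 2 powr (\<kappa> * real e)" by (simp add: powr_def)
    also have "\<dots> \<le> real p powr (\<kappa> * real e)"
      using prime_ge_2_nat[OF that] assms by (intro powr_mono2) auto
    finally show ?thesis using K by simp
  qed
  have large: "real e + 1 \<le> real p powr (\<kappa> * real e)" if "p \<ge> B" for p e
  proof -
    have "real e + 1 \<le> 2 ^ e" by (induction e) auto
    also have "\<dots> = (2 powr (1 / \<kappa>)) powr (\<kappa> * real e)"
      using assms by (simp add: powr_powr powr_realpow)
    also have "\<dots> \<le> real p powr (\<kappa> * real e)"
      using that assms by (intro powr_mono2) (auto simp: B_def)
    finally show ?thesis .
  qed
  have main: "real (divisor_count n) \<le> K ^ card (S n) * real n powr \<kappa>" if "n > 0" for n
    using that
  proof (induction n rule: less_induct)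
    case (less n)
    show ?case
    proof (cases "n = 1")
      case True
      have "divisor_count 1 = 1" by (simp add: divisor_count_def)
      then show ?thesis using True by (simp add: S_def)
    next
      case False
      then obtain p where p: "prime p" "p dvd n" using prime_factor_nat by blast
      define e where "e = multiplicity p n"
      obtain m where m: "n = p ^ e * m" "\<not> p dvd m"
        using multiplicity_decompose'[of n p] less.prems p prime_gt_1_nat[of p] unfolding e_def by auto
      have e: "e > 0" using p less.prems by (simp add: e_def prime_multiplicity_gt_zero_iff)
      have m0: "m > 0" using m less.prems by (auto intro: Nat.gr0I)
      have p1: "p > 1" using p prime_gt_1_nat by blast
      have "1 < p ^ e" using p1 e by (intro one_less_power) auto
      then have "m < n" using m m0 by simp
      have "divisor_count n \<le> (e + 1) * divisor_count m"
        using divisor_count_mult_le[of "p ^ e" m] divisor_count_prime_power[OF p(1), of e] m m0 p1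
        by (metis (no_types, lifting) mult_le_mono1 order_trans zero_less_power less_trans zero_less_one)
      then have "real (divisor_count n) \<le> real ((e + 1) * divisor_count m)" by (simp only: of_nat_le_iff)
      also have "\<dots> = (real e + 1) * real (divisor_count m)" by (simp add: algebra_simps)
      also have "\<dots> \<le> (real e + 1) * (K ^ card (S m) * real m powr \<kappa>)"
        using less.IH[OF \<open>m < n\<close> m0] by (intro mult_left_mono) auto
      finally have d: "real (divisor_count n) \<le> (real e + 1) * (K ^ card (S m) * real m powr \<kappa>)" .
      have n_powr: "real n powr \<kappa> = real p powr (\<kappa> * real e) * real m powr \<kappa>"
      proof -
        have "real n powr \<kappa> = (real p powr real e * real m) powr \<kappa>"
          using m p1 by (simp add: powr_realpow)
        also have "\<dots> = real p powr (real e * \<kappa>) * real m powr \<kappa>"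
          by (simp add: powr_mult powr_powr)
        finally show ?thesis by (simp add: mult.commute)
      qed
      have pf: "prime_factors n = insert p (prime_factors m)"
        using m e m0 p p1 by (auto simp: prime_factors_dvd prime_dvd_mult_iff prime_dvd_power_iff primes_dvd_imp_eq)
      have pm: "p \<notin> prime_factors m" using m by auto
      show ?thesis
      proof (cases "p < B")
        case True
        then have "S n = insert p (S m)" by (simp add: S_def pf)
        moreover have "p \<notin> S m" "finite (S m)" using pm by (auto simp: S_def)
        ultimately have "card (S n) = Suc (card (S m))" by simp
        moreover have "(real e + 1) * (K ^ card (S m) * real m powr \<kappa>)
            \<le> (K * real p powr (\<kappa> * real e)) * (K ^ card (S m) * real m powr \<kappa>)"
          using small[OF p(1)] K by (intro mult_right_mono) auto
        ultimately show ?thesis using d by (simp add: n_powr mult_ac)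
      next
        case False
        then have "S n = S m" by (simp add: S_def pf)
        moreover have "(real e + 1) * (K ^ card (S m) * real m powr \<kappa>)
            \<le> real p powr (\<kappa> * real e) * (K ^ card (S m) * real m powr \<kappa>)"
          using large[of p e] False K by (intro mult_right_mono) auto
        ultimately show ?thesis using d by (simp add: n_powr mult_ac)
      qed
    qed
  qed
  show ?thesis
  proof (rule that[of "K ^ B"])
    show "K ^ B > 0" using K by simp
    fix n :: nat assume n: "n > 0"
    have "card (S n) \<le> card {..<B}" unfolding S_def by (intro card_mono) auto
    then have "K ^ card (S n) \<le> K ^ B" using K by (intro power_increasing) auto
    then have "K ^ card (S n) * real n powr \<kappa> \<le> K ^ B * real n powr \<kappa>" by (intro mult_right_mono) auto
    then show "real (divisor_count n) \<le> K ^ B * real n powr \<kappa>" using main[OF n] by linarith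
  qed
qed

lemma card_le_mult_fibre:
  assumes "finite A" "finite B" "f ` A \<subseteq> B" "\<And>y. y \<in> B \<Longrightarrow> card {x \<in> A. f x = y} \<le> k"
  shows "card A \<le> card B * k"
proof -
  have "card A = (\<Sum>y\<in>B. \<Sum>x\<in>{x \<in> A. f x = y}. 1)"
    using sum.group[OF assms(1-3), of "\<lambda>_. 1::nat"] by simp
  also have "\<dots> \<le> (\<Sum>y\<in>B. k)" by (intro sum_mono) (use assms(4) in simp)
  finally show ?thesis by simp
qed

definition two_square_reps :: "nat \<Rightarrow> (int \<times> int) set" where
  "two_square_reps m = {(a, b). a\<^sup>2 + b\<^sup>2 = int m}"

lemma abs_le_of_square_le: "x\<^sup>2 \<le> int m \<Longrightarrow> \<bar>x\<bar> \<le> int m"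
proof -
  assume "x\<^sup>2 \<le> int m"
  moreover have "\<bar>x\<bar> \<le> x\<^sup>2"
  proof (cases "x = 0")
    case False
    then have "\<bar>x\<bar> * 1 \<le> \<bar>x\<bar> * \<bar>x\<bar>" by (intro mult_left_mono) auto
    then show ?thesis by (simp add: power2_eq_square)
  qed simp
  ultimately show ?thesis by linarith
qed

lemma finite_two_square_reps: "finite (two_square_reps m)"
proof (rule finite_subset)
  show "two_square_reps m \<subseteq> {- int m..int m} \<times> {- int m..int m}"
  proof
    fix z assume "z \<in> two_square_reps m"
    then obtain a b where z: "z = (a, b)" "a\<^sup>2 + b\<^sup>2 = int m" by (auto simp: two_square_reps_def)
    then have "a\<^sup>2 \<le> int m" "b\<^sup>2 \<le> int m" using zero_le_power2[of a] zero_le_power2[of b] by linarith+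
    then show "z \<in> {- int m..int m} \<times> {- int m..int m}"
      using abs_le_of_square_le[of a m] abs_le_of_square_le[of b m] z by auto
  qed
qed simp

lemma r_eq_card: "r m = card (two_square_reps m)"
  by (simp add: r_def two_square_reps_def)

lemma coprime_sum_squares:
  fixes a b :: int
  assumes "coprime a b" "a\<^sup>2 + b\<^sup>2 = m"
  shows "coprime a m"
proof -
  have "coprime a (b\<^sup>2)" using assms by simp
  moreover have "gcd a m = gcd a (b\<^sup>2)"
    using gcd_add_mult[of a a "b\<^sup>2"] assms(2) by (simp add: power2_eq_square)
  ultimately show ?thesis by (simp add: coprime_iff_gcd_eq_1)
qed

definition primitive_reps :: "nat \<Rightarrow> (int \<times> int) set" where
  "primitive_reps m = {(a, b). a\<^sup>2 + b\<^sup>2 = int m \<and> coprime a b}"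

text \<open>Two primitive representations that share the divisor \<open>gcd (ad - bc) m\<close> with a fixed one
  differ by multiplication with a Gaussian unit.\<close>

lemma primitive_reps_same_divisor:
  fixes a b c d c' d' M e :: int
  assumes "odd M" "M > 0"
    and ab: "a\<^sup>2 + b\<^sup>2 = M" "coprime a b"
    and cd: "c\<^sup>2 + d\<^sup>2 = M" "coprime c d"
    and cd': "c'\<^sup>2 + d'\<^sup>2 = M"
    and e: "gcd (a * d - b * c) M = e" "gcd (a * d' - b * c') M = e"
  shows "(c', d') \<in> (\<lambda>(X, Y). (c * X + d * Y, d * X - c * Y)) ` {(1, 0), (-1, 0), (0, 1), (0, -1)}"
proof -
  have e0: "e > 0" using e assms(2) by (metis gcd_pos_int less_irrefl)
  obtain f where f: "M = e * f" using e by (metis dvdE gcd_dvd2)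
  have f_dvd: "f dvd a * y + b * x" if xy: "x\<^sup>2 + y\<^sup>2 = M" "gcd (a * y - b * x) M = e" for x y
  proof -
    obtain u where u: "a * y - b * x = e * u" using xy(2) by (metis dvdE gcd_dvd1)
    have "gcd (e * u) (e * f) = e" using xy(2) u f by simp
    then have "coprime u f" using e0 by (simp add: gcd_mult_distrib_int[symmetric] coprime_iff_gcd_eq_1)
    have "(a * y - b * x) * (a * y + b * x) = M * (a\<^sup>2 + y\<^sup>2 - M)"
    proof -
      have "b\<^sup>2 = M - a\<^sup>2" "x\<^sup>2 = M - y\<^sup>2" using ab xy(1) by auto
      moreover have "a\<^sup>2 * y\<^sup>2 - (M - a\<^sup>2) * (M - y\<^sup>2) = M * (a\<^sup>2 + y\<^sup>2 - M)" by (simp add: algebra_simps)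
      ultimately have "a\<^sup>2 * y\<^sup>2 - b\<^sup>2 * x\<^sup>2 = M * (a\<^sup>2 + y\<^sup>2 - M)" by simp
      moreover have "(a * y - b * x) * (a * y + b * x) = a\<^sup>2 * y\<^sup>2 - b\<^sup>2 * x\<^sup>2"
        by (simp add: algebra_simps power2_eq_square)
      ultimately show ?thesis by simp
    qed
    then have "e * (u * (a * y + b * x)) = e * (f * (a\<^sup>2 + y\<^sup>2 - M))" using u f by (simp add: mult_ac)
    then have "u * (a * y + b * x) = f * (a\<^sup>2 + y\<^sup>2 - M)" using e0 by simp
    then have "f dvd u * (a * y + b * x)" by simp
    then show ?thesis using \<open>coprime u f\<close> by (simp add: coprime_dvd_mult_right_iff coprime_commute)
  qed
  have cop: "coprime a M" "coprime d M"
    using coprime_sum_squares[OF ab(2,1)] coprime_sum_squares[of d c M] cd by (auto simp: add.commute coprime_commute)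
  have eM: "e dvd M" and fM: "f dvd M" using f by auto
  have ae: "coprime a e" "coprime a f" using cop eM fM coprime_divisors dvd_refl by blast+
  define Y0 where "Y0 = d * c' - d' * c"
  have "a * Y0 = c' * (a * d - b * c) - c * (a * d' - b * c')" by (simp add: Y0_def algebra_simps)
  moreover have "e dvd a * d - b * c" "e dvd a * d' - b * c'" using e gcd_dvd1 by metis+
  ultimately have "e dvd a * Y0" by (simp add: dvd_diff)
  then have eY: "e dvd Y0" using ae by (simp add: coprime_dvd_mult_right_iff coprime_commute)
  have "a * Y0 = c' * (a * d + b * c) - c * (a * d' + b * c')" by (simp add: Y0_def algebra_simps)
  then have "f dvd a * Y0" using f_dvd[OF cd(1) e(1)] f_dvd[OF cd' e(2)] by (simp add: dvd_diff)
  then have fY: "f dvd Y0" using ae by (simp add: coprime_dvd_mult_right_iff coprime_commute)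
  have "coprime e f"
  proof -
    define h where "h = gcd e f"
    have "h dvd a * d - b * c" "h dvd a * d + b * c"
      using e f_dvd[OF cd(1) e(1)] unfolding h_def by (meson dvd_trans gcd_dvd1 gcd_dvd2)+
    then have "h dvd (a * d - b * c) + (a * d + b * c)" by (rule dvd_add)
    then have 1: "h dvd 2 * (a * d)" by simp
    have "coprime (2 * (a * d)) M" using cop assms(1) by (simp add: coprime_left_2_iff_odd)
    moreover have "h dvd M" using eM unfolding h_def by (meson dvd_trans gcd_dvd1)
    ultimately have "is_unit h" using 1 by (meson coprime_common_divisor)
    then show ?thesis by (simp add: h_def coprime_iff_gcd_eq_1)
  qed
  then have "M dvd Y0" using f eY fY by (simp add: divides_mult)
  then obtain Y where Y: "Y0 = M * Y" by auto
  define X0 where "X0 = c * c' + d * d'"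
  have sq: "X0\<^sup>2 + Y0\<^sup>2 = M\<^sup>2"
  proof -
    have "X0\<^sup>2 + Y0\<^sup>2 = (c\<^sup>2 + d\<^sup>2) * (c'\<^sup>2 + d'\<^sup>2)"
      by (simp add: X0_def Y0_def algebra_simps power2_eq_square)
    then show ?thesis using cd cd' by (simp add: power2_eq_square)
  qed
  then have "X0\<^sup>2 = M\<^sup>2 * (1 - Y\<^sup>2)" using Y by (simp add: algebra_simps power_mult_distrib)
  then have "M\<^sup>2 dvd X0\<^sup>2" by simp
  then have "M dvd X0" by simp
  then obtain X where X: "X0 = M * X" by auto
  have "M\<^sup>2 * (X\<^sup>2 + Y\<^sup>2) = M\<^sup>2 * 1" using sq X Y by (simp add: algebra_simps power_mult_distrib)
  then have XY: "X\<^sup>2 + Y\<^sup>2 = 1" using assms(2) by simp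
  have "M * c' = c * X0 + d * Y0"
  proof -
    have "c * X0 + d * Y0 = (c\<^sup>2 + d\<^sup>2) * c'" by (simp add: X0_def Y0_def algebra_simps power2_eq_square)
    then show ?thesis using cd by simp
  qed
  also have "\<dots> = M * (c * X + d * Y)" by (simp add: X Y algebra_simps)
  finally have c': "c' = c * X + d * Y" using assms(2) by simp
  have "M * d' = d * X0 - c * Y0"
  proof -
    have "d * X0 - c * Y0 = (c\<^sup>2 + d\<^sup>2) * d'" by (simp add: X0_def Y0_def algebra_simps power2_eq_square)
    then show ?thesis using cd by simp
  qed
  also have "\<dots> = M * (d * X - c * Y)" by (simp add: X Y algebra_simps)
  finally have d': "d' = d * X - c * Y" using assms(2) by simp
  have "\<bar>X\<bar> \<le> 1" "\<bar>Y\<bar> \<le> 1"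
    using abs_le_of_square_le[of X 1] abs_le_of_square_le[of Y 1] XY zero_le_power2[of X] zero_le_power2[of Y]
    by auto
  then have "X \<in> {-1, 0, 1}" "Y \<in> {-1, 0, 1}" by auto
  then have "(X, Y) \<in> {(1, 0), (-1, 0), (0, 1), (0, -1)}" using XY by auto
  then show ?thesis using c' d' by (intro image_eqI[of _ _ "(X, Y)"]) auto
qed

lemma card_primitive_reps:
  assumes "odd m"
  shows "card (primitive_reps m) \<le> 4 * divisor_count m"
proof (cases "primitive_reps m = {}")
  case False
  have m0: "m > 0" using assms by (auto intro: Nat.gr0I)
  obtain a b where ab: "a\<^sup>2 + b\<^sup>2 = int m" "coprime a b" using False by (auto simp: primitive_reps_def)
  define F where "F = (\<lambda>(c, d). nat (gcd (a * d - b * c) (int m)))"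
  have "card (primitive_reps m) \<le> card {e. e dvd m} * 4"
  proof (rule card_le_mult_fibre[where f = F])
    show "finite (primitive_reps m)"
      by (rule finite_subset[OF _ finite_two_square_reps[of m]]) (auto simp: primitive_reps_def two_square_reps_def)
    show "finite {e. e dvd m}" using m0 by simp
    show "F ` primitive_reps m \<subseteq> {e. e dvd m}"
      by (auto simp: F_def nat_dvd_iff)
    fix e
    show "card {x \<in> primitive_reps m. F x = e} \<le> 4"
    proof (cases "{x \<in> primitive_reps m. F x = e} = {}")
      case False
      then obtain c d where cd: "(c, d) \<in> primitive_reps m" "F (c, d) = e" by auto
      define U :: "(int \<times> int) set" where "U = {(1, 0), (-1, 0), (0, 1), (0, -1)}"
      have "{x \<in> primitive_reps m. F x = e} \<subseteq> (\<lambda>(X, Y). (c * X + d * Y, d * X - c * Y)) ` U"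
      proof
        fix x assume "x \<in> {x \<in> primitive_reps m. F x = e}"
        then obtain c' d' where x: "x = (c', d')" "(c', d') \<in> primitive_reps m" "F (c', d') = e"
          by (cases x) auto
        have g: "gcd (a * d - b * c) (int m) = int e" "gcd (a * d' - b * c') (int m) = int e"
          using cd(2) x(3) by (simp_all add: F_def nat_eq_iff)
        show "x \<in> (\<lambda>(X, Y). (c * X + d * Y, d * X - c * Y)) ` U"
          unfolding x(1) U_def
        proof (rule primitive_reps_same_divisor[where M = "int m" and a = a and b = b and e = "int e"])
        qed (use assms m0 ab cd(1) x(2) g in \<open>auto simp: primitive_reps_def\<close>)
      qed
      moreover have "finite U" by (simp add: U_def)
      ultimately have "card {x \<in> primitive_reps m. F x = e} \<le> card U" using surj_card_le by blast
      then show ?thesis by (simp add: U_def)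
    qed (simp only: card.empty le0)
  qed
  then show ?thesis by (simp add: divisor_count_def)
qed simp

lemma divisor_count_mono: "n > 0 \<Longrightarrow> d dvd n \<Longrightarrow> divisor_count d \<le> divisor_count n"
  unfolding divisor_count_def by (intro card_mono) (auto intro: dvd_trans)

lemma r_le_divisor_count:
  assumes "odd m"
  shows "r m \<le> 4 * (divisor_count m)\<^sup>2"
proof -
  have m0: "m > 0" using assms by (auto intro: Nat.gr0I)
  define F :: "int \<times> int \<Rightarrow> nat" where "F = (\<lambda>(a, b). nat (gcd a b))"
  have sq_dvd: "(gcd a b)\<^sup>2 dvd a\<^sup>2 + b\<^sup>2" for a b :: int by (intro dvd_add) auto
  have "card (two_square_reps m) \<le> card {e. e dvd m} * (4 * divisor_count m)"
  proof (rule card_le_mult_fibre[where f = F])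
    show "finite {e. e dvd m}" using m0 by simp
    show "F ` two_square_reps m \<subseteq> {e. e dvd m}"
    proof
      fix e assume "e \<in> F ` two_square_reps m"
      then obtain a b where ab: "a\<^sup>2 + b\<^sup>2 = int m" "e = nat (gcd a b)"
        by (auto simp: two_square_reps_def F_def)
      have "gcd a b dvd a\<^sup>2 + b\<^sup>2" by (intro dvd_add) (auto simp: power2_eq_square)
      then show "e \<in> {e. e dvd m}" using ab by (simp add: nat_dvd_iff)
    qed
    fix e
    show "card {x \<in> two_square_reps m. F x = e} \<le> 4 * divisor_count m"
    proof (cases "{x \<in> two_square_reps m. F x = e} = {}")
      case False
      then obtain a b where ab: "a\<^sup>2 + b\<^sup>2 = int m" "gcd a b = int e"
        by (auto simp: two_square_reps_def F_def)
      have "int (e\<^sup>2) dvd int m" using sq_dvd[of a b] ab by simp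
      then have dvd: "e\<^sup>2 dvd m" by (simp only: of_nat_dvd_iff)
      then obtain k where k: "m = e\<^sup>2 * k" by auto
      have e0: "e > 0" using k m0 by (auto intro: Nat.gr0I)
      have ok: "odd k" using k assms by simp
      have "inj_on (\<lambda>(a, b). (a div int e, b div int e)) {x \<in> two_square_reps m. F x = e}"
      proof (rule inj_onI)
        fix x y assume x: "x \<in> {x \<in> two_square_reps m. F x = e}" and y: "y \<in> {x \<in> two_square_reps m. F x = e}"
          and eq: "(case x of (a, b) \<Rightarrow> (a div int e, b div int e)) = (case y of (a, b) \<Rightarrow> (a div int e, b div int e))"
        obtain a b c d where xy: "x = (a, b)" "y = (c, d)" by fastforce
        have "nat (gcd a b) = e" "nat (gcd c d) = e" using x y xy by (auto simp: F_def)
        then have "gcd a b = int e" "gcd c d = int e" by (simp_all add: nat_eq_iff)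
        then have "int e dvd a" "int e dvd b" "int e dvd c" "int e dvd d"
          by (metis gcd_dvd1 gcd_dvd2)+
        then show "x = y" using eq xy by (auto simp: dvd_div_eq_iff)
      qed
      then have "card {x \<in> two_square_reps m. F x = e}
          = card ((\<lambda>(a, b). (a div int e, b div int e)) ` {x \<in> two_square_reps m. F x = e})"
        by (simp add: card_image)
      also have "\<dots> \<le> card (primitive_reps k)"
      proof (rule card_mono)
        show "finite (primitive_reps k)"
          by (rule finite_subset[OF _ finite_two_square_reps[of k]]) (auto simp: primitive_reps_def two_square_reps_def)
        show "(\<lambda>(a, b). (a div int e, b div int e)) ` {x \<in> two_square_reps m. F x = e} \<subseteq> primitive_reps k"
        proof
          fix z assume "z \<in> (\<lambda>(a, b). (a div int e, b div int e)) ` {x \<in> two_square_reps m. F x = e}"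
          then obtain a b where ab: "a\<^sup>2 + b\<^sup>2 = int m" "gcd a b = int e" "z = (a div int e, b div int e)"
            by (auto simp: two_square_reps_def F_def)
          obtain u v where uv: "a = int e * u" "b = int e * v" using ab(2) by (metis dvdE gcd_dvd1 gcd_dvd2)
          have "int e * gcd u v = gcd (int e * u) (int e * v)"
            using gcd_mult_distrib_int[of "int e" u v] by simp
          then have "int e * gcd u v = int e" using ab(2) uv by simp
          then have "coprime u v" using e0 by (simp add: coprime_iff_gcd_eq_1)
          moreover have "(int e)\<^sup>2 * (u\<^sup>2 + v\<^sup>2) = (int e)\<^sup>2 * int k"
            using ab(1) uv k by (simp add: algebra_simps power_mult_distrib)
          then have "u\<^sup>2 + v\<^sup>2 = int k" using e0 by simp
          ultimately show "z \<in> primitive_reps k" using ab(3) uv e0 by (simp add: primitive_reps_def)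
        qed
      qed
      also have "\<dots> \<le> 4 * divisor_count k" by (rule card_primitive_reps[OF ok])
      also have "\<dots> \<le> 4 * divisor_count m" using divisor_count_mono[OF m0, of k] k by simp
      finally show ?thesis .
    qed (simp only: card.empty le0)
  qed (rule finite_two_square_reps)
  then show ?thesis by (simp add: r_eq_card divisor_count_def power2_eq_square)
qed

definition sl2_points :: "nat \<Rightarrow> (int \<times> int \<times> int \<times> int) set" where
  "sl2_points n = {(x1, x2, x3, x4). x1 * x4 - x2 * x3 = 1 \<and> x1\<^sup>2 + x2\<^sup>2 + x3\<^sup>2 + x4\<^sup>2 = int n}"

lemma finite_sl2_points: "finite (sl2_points n)"
proof (rule finite_subset)
  let ?I = "{- int n..int n}"
  show "sl2_points n \<subseteq> ?I \<times> ?I \<times> ?I \<times> ?I"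
  proof
    fix z assume "z \<in> sl2_points n"
    then obtain a b c d where z: "z = (a, b, c, d)" "a\<^sup>2 + b\<^sup>2 + c\<^sup>2 + d\<^sup>2 = int n"
      by (auto simp: sl2_points_def)
    then have "a\<^sup>2 \<le> int n" "b\<^sup>2 \<le> int n" "c\<^sup>2 \<le> int n" "d\<^sup>2 \<le> int n"
      using zero_le_power2[of a] zero_le_power2[of b] zero_le_power2[of c] zero_le_power2[of d] by linarith+
    then show "z \<in> ?I \<times> ?I \<times> ?I \<times> ?I"
      using abs_le_of_square_le[of a n] abs_le_of_square_le[of b n]
        abs_le_of_square_le[of c n] abs_le_of_square_le[of d n] z by auto
  qed
qed simp

text \<open>Inverting the substitution needs equal parities within the two pairs of coordinates, which for
  \<open>n \<equiv> 3 (mod 4)\<close> holds either directly or after swapping \<open>c\<close> and \<open>d\<close>; this costs the factor 2.\<close>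

lemma r_mult_r_le_sl2_points:
  assumes n: "n mod 4 = 3"
  shows "r (n - 2) * r (n + 2) \<le> 2 * card (sl2_points n)"
proof -
  have n3: "n \<ge> 3" using n by (metis mod_less_eq_dividend)
  define G where "G = (\<lambda>((x1::int, x2::int, x3::int, x4::int), t).
    if t then ((x1 - x4, x2 + x3), (x1 + x4, x2 - x3)) else ((x2 + x3, x1 - x4), (x1 + x4, x2 - x3)))"
  have "two_square_reps (n - 2) \<times> two_square_reps (n + 2) \<subseteq> G ` (sl2_points n \<times> UNIV)"
  proof
    fix z assume "z \<in> two_square_reps (n - 2) \<times> two_square_reps (n + 2)"
    then obtain a b c d where z: "z = ((c, d), (a, b))" and
      cd: "c\<^sup>2 + d\<^sup>2 = int n - 2" and ab: "a\<^sup>2 + b\<^sup>2 = int n + 2"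
      using n3 by (auto simp: two_square_reps_def of_nat_diff)
    have "odd n" using n by presburger
    then have odd: "odd (a\<^sup>2 + b\<^sup>2)" "odd (c\<^sup>2 + d\<^sup>2)" using ab cd by auto
    have point: "((a + c) div 2, (b + d) div 2, (d - b) div 2, (a - c) div 2) \<in> sl2_points n
        \<and> (a + c) div 2 + (a - c) div 2 = a \<and> (a + c) div 2 - (a - c) div 2 = c
        \<and> (b + d) div 2 + (d - b) div 2 = d \<and> (b + d) div 2 - (d - b) div 2 = b"
      if cd: "c\<^sup>2 + d\<^sup>2 = int n - 2" and e: "even (a + c)" "even (b + d)" for c d
    proof -
      obtain u v where u: "a + c = 2 * u" and v: "b + d = 2 * v" using e by (elim evenE)
      have acbd: "a = 2 * u - c" "b = 2 * v - d" using u v by auto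
      have x: "(a + c) div 2 = u" "(b + d) div 2 = v" "(d - b) div 2 = d - v" "(a - c) div 2 = u - c"
        using acbd by auto
      have e1: "(2 * u - c)\<^sup>2 + (2 * v - d)\<^sup>2 = int n + 2" using ab acbd by simp
      then have "4 * (u\<^sup>2 - u * c + v\<^sup>2 - v * d) = 4"
        using cd by (simp add: power2_eq_square algebra_simps)
      then have k: "u\<^sup>2 - u * c + v\<^sup>2 - v * d = 1" by simp
      have "u * (u - c) - v * (d - v) = 1" using k by (simp add: power2_eq_square algebra_simps)
      moreover have "u\<^sup>2 + v\<^sup>2 + (d - v)\<^sup>2 + (u - c)\<^sup>2 = int n"
        using k cd by (simp add: power2_eq_square algebra_simps)
      ultimately show ?thesis unfolding x using acbd by (simp add: sl2_points_def)
    qed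
    show "z \<in> G ` (sl2_points n \<times> UNIV)"
    proof (cases "even (a + c)")
      case True
      then have "even (b + d)" using odd by simp
      from point[OF cd True this] show ?thesis unfolding z
        by (intro image_eqI[of _ _ "(((a + c) div 2, (b + d) div 2, (d - b) div 2, (a - c) div 2), True)"])
          (auto simp: G_def)
    next
      case False
      have "odd (a + b)" "odd (c + d)" using odd by simp_all
      then have "d\<^sup>2 + c\<^sup>2 = int n - 2" "even (a + d)" "even (b + c)"
        using False cd by (simp, presburger, presburger)
      from point[OF this] show ?thesis unfolding z
        by (intro image_eqI[of _ _ "(((a + d) div 2, (b + c) div 2, (c - b) div 2, (a - d) div 2), False)"])
          (auto simp: G_def)
    qed
  qed
  then have "card (two_square_reps (n - 2) \<times> two_square_reps (n + 2)) \<le> card (sl2_points n \<times> (UNIV :: bool set))"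
    using finite_sl2_points by (intro surj_card_le) auto
  then show ?thesis by (simp add: r_eq_card card_cartesian_product)
qed

lemma sum_sl2_points_le_s_Gamma:
  assumes "\<And>n. n \<in> G \<Longrightarrow> real n \<le> x \<and> squarefree n \<and> omega n \<le> k"
  shows "(\<Sum>n\<in>G. card (sl2_points n)) \<le> s_Gamma k x"
proof -
  have G: "G \<subseteq> {..nat \<lfloor>x\<rfloor>}" using assms by (auto simp: le_nat_floor)
  then have fG: "finite G" by (rule finite_subset) simp
  define T where "T = {(x1 :: int, x2 :: int, x3 :: int, x4 :: int).
     x1 * x4 - x2 * x3 = 1 \<and>
     (\<exists>n :: nat. int n = x1\<^sup>2 + x2\<^sup>2 + x3\<^sup>2 + x4\<^sup>2 \<and>
        real n \<le> x \<and> squarefree n \<and> omega n \<le> k)}"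
  have "finite T"
  proof (rule finite_subset)
    show "T \<subseteq> (\<Union>n\<in>{..nat \<lfloor>x\<rfloor>}. sl2_points n)"
    proof
      fix z assume "z \<in> T"
      moreover obtain a b c d where z: "z = (a, b, c, d)" by (cases z)
      ultimately obtain n where "int n = a\<^sup>2 + b\<^sup>2 + c\<^sup>2 + d\<^sup>2" "a * d - b * c = 1" "real n \<le> x"
        by (auto simp: T_def)
      then have "z \<in> sl2_points n" "real n \<le> x" by (simp_all add: z sl2_points_def)
      moreover from this have "n \<in> {..nat \<lfloor>x\<rfloor>}" by (simp add: le_nat_floor)
      ultimately show "z \<in> (\<Union>n\<in>{..nat \<lfloor>x\<rfloor>}. sl2_points n)" by blast
    qed
  qed (simp add: finite_sl2_points)
  have "(\<Sum>n\<in>G. card (sl2_points n)) = card (\<Union>n\<in>G. sl2_points n)"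
    using fG finite_sl2_points by (intro card_UN_disjoint[symmetric]) (auto simp: sl2_points_def)
  also have "\<dots> \<le> card T"
  proof (rule card_mono[OF \<open>finite T\<close>])
    show "(\<Union>n\<in>G. sl2_points n) \<subseteq> T" using assms by (fastforce simp: T_def sl2_points_def)
  qed
  finally show ?thesis by (simp add: s_Gamma_def T_def)
qed

section \<open>Rough numbers and the lower bound\<close>

lemma card_square_multiples_le:
  fixes x :: real
  assumes z: "2 \<le> z" and x: "0 \<le> x" and B: "\<And>n. n \<in> B \<Longrightarrow> 0 < n \<and> real n \<le> x \<and> (\<exists>k\<ge>z. k\<^sup>2 dvd n)"
  shows "finite B" "real (card B) \<le> x / (real z - 1)"
proof -
  define m where "m = nat \<lfloor>x\<rfloor>"
  have le_m: "n \<le> m" if "real n \<le> x" for n using that by (simp add: m_def le_nat_floor)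
  have B_sub: "B \<subseteq> {..m}" using B le_m by blast
  then show "finite B" by (rule finite_subset) simp
  show "real (card B) \<le> x / (real z - 1)"
  proof -
    define S where "S = (\<lambda>k. {n. 0 < n \<and> n \<le> m \<and> k\<^sup>2 dvd n})"
    have cS: "real (card (S k)) \<le> x / (real k)\<^sup>2" if "k > 0" for k
    proof -
      have "S k \<subseteq> (\<lambda>j. k\<^sup>2 * j) ` {1..m div k\<^sup>2}"
      proof
        fix n assume "n \<in> S k"
        then obtain j where j: "n = k\<^sup>2 * j" "0 < n" "n \<le> m" by (auto simp: S_def)
        then have "j \<le> m div k\<^sup>2" using that by (simp add: less_eq_div_iff_mult_less_eq mult.commute)
        then show "n \<in> (\<lambda>j. k\<^sup>2 * j) ` {1..m div k\<^sup>2}" using j by (auto intro!: image_eqI[of _ _ j])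
      qed
      then have "card (S k) \<le> card {1..m div k\<^sup>2}" by (intro surj_card_le) auto
      then have "real (card (S k)) \<le> real (m div k\<^sup>2)" by simp
      also have "\<dots> \<le> real m / real (k\<^sup>2)"
        using floor_divide_of_nat_eq[of m "k\<^sup>2", where ?'a = real] by linarith
      also have "\<dots> \<le> x / (real k)\<^sup>2"
        using x by (simp add: m_def divide_right_mono)
      finally show ?thesis .
    qed
    have "B \<subseteq> (\<Union>k\<in>{z..<z + m}. S k)"
    proof
      fix n assume n: "n \<in> B"
      then obtain k where k: "k \<ge> z" "k\<^sup>2 dvd n" using B by blast
      have "0 < n" "n \<le> m" using B[OF n] le_m by auto
      moreover have "k\<^sup>2 \<le> n" using k \<open>0 < n\<close> by (simp add: dvd_imp_le)
      then have "k * 1 \<le> n" using k z by (intro order_trans[OF mult_le_mono2[of 1 k k]]) (auto simp: power2_eq_square)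
      ultimately show "n \<in> (\<Union>k\<in>{z..<z + m}. S k)" using k z by (auto simp: S_def intro!: bexI[of _ k])
    qed
    then have "card B \<le> card (\<Union>k\<in>{z..<z + m}. S k)" by (intro card_mono) (auto simp: S_def)
    also have "\<dots> \<le> (\<Sum>k=z..<z + m. card (S k))" by (rule card_UN_le) simp
    finally have "real (card B) \<le> real (\<Sum>k=z..<z + m. card (S k))" by (simp only: of_nat_le_iff)
    also have "\<dots> = (\<Sum>k=z..<z + m. real (card (S k)))" by simp
    also have "\<dots> \<le> (\<Sum>k=z..<z + m. x * (1 / (real k - 1) - 1 / real k))"
    proof (rule sum_mono)
      fix k assume "k \<in> {z..<z + m}"
      then have k: "real k \<ge> 2" using z by simp
      have "x / (real k)\<^sup>2 \<le> x / ((real k - 1) * real k)"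
        using k x by (intro divide_left_mono) (auto simp: power2_eq_square)
      also have "\<dots> = x * (1 / (real k - 1) - 1 / real k)" using k by (simp add: field_simps)
      finally show "real (card (S k)) \<le> x * (1 / (real k - 1) - 1 / real k)" using cS[of k] k by simp
    qed
    also have "\<dots> = x * (\<Sum>k=z..<z + m. 1 / (real k - 1) - 1 / real k)" by (simp add: sum_distrib_left)
    also have "(\<Sum>k=z..<z + m. 1 / (real k - 1) - 1 / real k) = 1 / (real z - 1) - 1 / (real (z + m) - 1)" for m
      using z by (induction m) auto
    also have "x * (1 / (real z - 1) - 1 / (real (z + m) - 1)) \<le> x * (1 / (real z - 1))"
      using x z by (intro mult_left_mono) auto
    finally show ?thesis by simp
  qed
qed

lemma r_product_bound:
  assumes "\<kappa> > 0"
  obtains C where "C > 0"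
    "\<And>n x. n mod 4 = 3 \<Longrightarrow> real n \<le> x \<Longrightarrow> real (r (n - 2) * r (n + 2)) \<le> C * x powr \<kappa>"
proof -
  obtain C where C: "C > 0" "\<And>n. n > 0 \<Longrightarrow> real (divisor_count n) \<le> C * real n powr (\<kappa> / 4)"
    using divisor_count_le_powr[of "\<kappa> / 4"] assms by (metis divide_pos_pos zero_less_numeral)
  show ?thesis
  proof (rule that[of "(4 * (C * 2 powr (\<kappa> / 4))\<^sup>2)\<^sup>2"])
    show "(4 * (C * 2 powr (\<kappa> / 4))\<^sup>2)\<^sup>2 > 0" using C by simp
    fix n :: nat and x :: real
    assume n: "n mod 4 = 3" "real n \<le> x"
    have n3: "n \<ge> 3" using n by (metis mod_less_eq_dividend)
    have "odd n" using n by presburger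
    have *: "real (r m) \<le> 4 * (C * 2 powr (\<kappa> / 4))\<^sup>2 * x powr (\<kappa> / 2)" if "odd m" "real m \<le> 2 * x" for m
    proof -
      have m0: "m > 0" using that by (auto intro: Nat.gr0I)
      have x0: "x > 0" using n n3 by linarith
      have "real (divisor_count m) \<le> C * real m powr (\<kappa> / 4)" using C m0 by simp
      also have "\<dots> \<le> C * (2 * x) powr (\<kappa> / 4)"
        using that C assms by (intro mult_left_mono powr_mono2) auto
      also have "\<dots> = C * 2 powr (\<kappa> / 4) * x powr (\<kappa> / 4)" using x0 by (simp add: powr_mult)
      finally have "(real (divisor_count m))\<^sup>2 \<le> (C * 2 powr (\<kappa> / 4) * x powr (\<kappa> / 4))\<^sup>2"
        by (intro power_mono) auto
      also have "\<dots> = (C * 2 powr (\<kappa> / 4))\<^sup>2 * x powr (\<kappa> / 2)"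
        by (simp add: power_mult_distrib power2_eq_square[of "x powr _"] powr_add[symmetric])
      finally have "4 * (real (divisor_count m))\<^sup>2 \<le> 4 * (C * 2 powr (\<kappa> / 4))\<^sup>2 * x powr (\<kappa> / 2)" by simp
      moreover have "real (r m) \<le> real (4 * (divisor_count m)\<^sup>2)"
        using r_le_divisor_count[OF that(1)] by (simp only: of_nat_le_iff)
      ultimately show ?thesis by simp
    qed
    have "real (r (n - 2)) \<le> 4 * (C * 2 powr (\<kappa> / 4))\<^sup>2 * x powr (\<kappa> / 2)"
      using \<open>odd n\<close> n n3 by (intro *) auto
    moreover have "real (r (n + 2)) \<le> 4 * (C * 2 powr (\<kappa> / 4))\<^sup>2 * x powr (\<kappa> / 2)"
      using \<open>odd n\<close> n n3 by (intro *) auto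
    ultimately have "real (r (n - 2)) * real (r (n + 2))
        \<le> (4 * (C * 2 powr (\<kappa> / 4))\<^sup>2 * x powr (\<kappa> / 2)) * (4 * (C * 2 powr (\<kappa> / 4))\<^sup>2 * x powr (\<kappa> / 2))"
      by (intro mult_mono) auto
    also have "\<dots> = (4 * (C * 2 powr (\<kappa> / 4))\<^sup>2)\<^sup>2 * x powr \<kappa>"
      by (simp add: power2_eq_square[of "4 * _"] powr_add[symmetric] mult_ac)
    finally show "real (r (n - 2) * r (n + 2)) \<le> (4 * (C * 2 powr (\<kappa> / 4))\<^sup>2)\<^sup>2 * x powr \<kappa>" by simp
  qed
qed

lemma omega_le_of_rough:
  assumes n: "0 < n" "real n < real z ^ Suc k" and rough: "\<And>p. prime p \<Longrightarrow> p dvd n \<Longrightarrow> z \<le> p"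
    and z: "1 \<le> z"
  shows "omega n \<le> k"
proof (rule ccontr)
  assume "\<not> omega n \<le> k"
  then have "z ^ Suc k \<le> z ^ card (prime_factors n)"
    using z by (intro power_increasing) (auto simp: omega_def)
  also have "\<dots> = (\<Prod>p\<in>prime_factors n. z)" by simp
  also have "\<dots> \<le> (\<Prod>p\<in>prime_factors n. p ^ multiplicity p n)"
  proof (rule prod_mono)
    fix p assume p: "p \<in> prime_factors n"
    then have "prime p" "p dvd n" by auto
    then have "z \<le> p" "0 < multiplicity p n" "1 \<le> p"
      using rough n p by (auto simp: prime_factors_multiplicity prime_ge_1_nat)
    then have "z \<le> p ^ multiplicity p n" by (metis order_trans self_le_power)
    then show "0 \<le> z \<and> z \<le> p ^ multiplicity p n" by simp
  qed
  also have "\<dots> = n" using prod_prime_factors[of n] n by simp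
  finally have "real (z ^ Suc k) \<le> real n" by (simp only: of_nat_le_iff)
  then show False using n by simp
qed

lemma chi4_odd: "odd n \<Longrightarrow> chi4 n = 1 \<or> chi4 n = -1"
  unfolding chi4_def by presburger

lemma g_prime_bounds:
  assumes "prime p" "odd p"
  shows "0 \<le> g p" "g p \<le> 1 / real p + 2 / (real p * (real p - 1))" "g p < 1"
proof -
  have "p \<ge> 3" using assms prime_ge_2_nat[of p] by (cases "p = 2") auto
  then have p: "real p \<ge> 3" by simp
  have gp: "g p = 1 / real p * ((real p - chi4 p) / (real p + chi4 p))"
    using assms by (simp add: g_def prime_prime_factors)
  show "0 \<le> g p" unfolding gp using p chi4_odd[OF assms(2)] by auto
  have "(real p - chi4 p) / (real p + chi4 p) \<le> (real p + 1) / (real p - 1)"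
    using p chi4_odd[OF assms(2)] by (intro frac_le) auto
  then have "g p \<le> 1 / real p * ((real p + 1) / (real p - 1))"
    unfolding gp using p by (intro mult_left_mono) auto
  also have "\<dots> = 1 / real p + 2 / (real p * (real p - 1))" using p by (simp add: divide_simps)
  finally show *: "g p \<le> 1 / real p + 2 / (real p * (real p - 1))" .
  have "2 / (real p * (real p - 1)) \<le> 2 / (3 * 2)" using p by (intro divide_left_mono mult_mono) auto
  moreover have "1 / real p \<le> 1 / 3" using p by (intro divide_left_mono) auto
  ultimately show "g p < 1" using * by simp
qed

lemma g_nonneg: "g d \<ge> 0"
proof -
  have "(real p - chi4 p) / (real p + chi4 p) \<ge> 0" if "p \<in> prime_factors d" for p
  proof -
    have "p \<ge> 2" using that prime_ge_2_nat by auto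
    moreover have "\<bar>chi4 p\<bar> \<le> 1" by (simp add: chi4_def)
    ultimately show ?thesis by (intro divide_nonneg_nonneg) auto
  qed
  then show ?thesis unfolding g_def by (intro mult_nonneg_nonneg prod_nonneg) auto
qed

lemma g_mult_prime:
  assumes "prime p" "q > 0" "\<not> p dvd q"
  shows "g (q * p) = g q * g p"
proof -
  have "prime_factors (q * p) = insert p (prime_factors q)"
    using assms by (auto simp: prime_factors_product prime_prime_factors)
  moreover have "p \<notin> prime_factors q" using assms by auto
  ultimately show ?thesis using assms by (simp add: g_def prime_prime_factors mult_ac)
qed

lemma s_Gamma_pos:
  assumes "1 \<le> k" "3 \<le> x"
  shows "1 \<le> s_Gamma k x"
proof -
  have "(1, 1, 0, 1) \<in> sl2_points 3" by (simp add: sl2_points_def)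
  then have "1 \<le> card (sl2_points 3)" using finite_sl2_points[of 3] by (auto simp: Suc_le_eq card_gt_0_iff)
  moreover have "prime (3::nat)" by simp
  then have "squarefree (3::nat)" "omega 3 = 1"
    by (auto simp: squarefree_prime omega_def prime_prime_factors simp del: prime_nat_numeral_eq)
  then have "(\<Sum>n\<in>{3}. card (sl2_points n)) \<le> s_Gamma k x"
    using assms by (intro sum_sl2_points_le_s_Gamma) auto
  ultimately show ?thesis by simp
qed

lemma s_Gamma_lower_eventually:
  fixes \<theta> :: real
  assumes \<theta>: "0 < \<theta>" "\<theta> \<le> 1" and R: "hypothesis_R \<theta>"
  defines "N \<equiv> nat \<lfloor>2 / \<theta>\<rfloor>"
  obtains c x0 where "c > 0" "\<And>x. x \<ge> x0 \<Longrightarrow> c * (x / ln x) \<le> real (s_Gamma N x)"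
proof -
  define \<rho> where "\<rho> = \<theta> * (real N + 1) / 2"
  have "2 / \<theta> < real N + 1" using \<theta> unfolding N_def by linarith
  then have \<rho>: "\<rho> > 1" using \<theta> by (simp add: \<rho>_def field_simps)
  define \<mu> where "\<mu> = (\<rho> - 1) / (4 * \<rho>)"
  have \<mu>: "0 < \<mu>" "\<mu> < 1 / 4" using \<rho> by (auto simp: \<mu>_def field_simps)
  define \<delta> where "\<delta> = 2 * \<mu>"
  define \<alpha> where "\<alpha> = \<theta> * (1 - \<mu>)"
  define \<tau> where "\<tau> = \<alpha> / (2 + \<delta>)"
  define \<epsilon>0 where "\<epsilon>0 = \<theta> * \<mu> / 2"
  have \<alpha>: "0 < \<alpha>" "\<alpha> < \<theta> - \<epsilon>0" using \<theta> \<mu> by (auto simp: \<alpha>_def \<epsilon>0_def field_simps)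
  have \<epsilon>0: "\<epsilon>0 > 0" using \<theta> \<mu> by (simp add: \<epsilon>0_def)
  have \<delta>: "0 < \<delta>" "\<delta> < 1" using \<mu> by (auto simp: \<delta>_def)
  have \<tau>0: "0 < \<tau>" using \<alpha> \<delta> by (simp add: \<tau>_def)
  have \<tau>\<alpha>: "(2 + \<delta>) * \<tau> = \<alpha>" using \<delta> by (simp add: \<tau>_def)
  have \<tau>N: "1 / (real N + 1) < \<tau>"
  proof -
    have "4 * \<rho> * \<mu> = \<rho> - 1" using \<rho> by (simp add: \<mu>_def)
    moreover have "\<mu> < \<rho> * \<mu>" using \<mu> \<rho> by simp
    ultimately have "\<rho> * (1 - \<mu>) > 1 + \<mu>" using \<rho> by (simp add: algebra_simps)
    then have "\<theta> * (real N + 1) * (1 - \<mu>) > 2 + \<delta>" by (simp add: \<rho>_def \<delta>_def)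
    then have "2 + \<delta> < \<alpha> * (real N + 1)" by (simp add: \<alpha>_def mult_ac)
    then show ?thesis using \<delta> by (simp add: \<tau>_def field_simps)
  qed
  obtain \<Phi>p \<Phi>m Bp Bm :: "real \<Rightarrow> real" and \<beta> \<epsilon> :: real where
    \<beta>: "2 < \<beta>" "\<beta> < 2 + \<delta>" and \<epsilon>: "\<epsilon> > 0" and \<Phi>1: "\<Phi>m (2 + \<delta>) < 1"
    and f1: "\<And>s. \<Phi>m s > 0" and f2: "\<And>s. s \<ge> 1 \<Longrightarrow> \<Phi>p s > 0"
    and f3: "\<And>s. s \<le> \<beta> \<Longrightarrow> \<Phi>m s \<ge> 1"
    and f4: "\<And>a b. a \<le> b \<Longrightarrow> \<Phi>m b \<le> \<Phi>m a"
    and f5: "\<And>a b. 1 \<le> a \<Longrightarrow> a \<le> b \<Longrightarrow> \<Phi>p b \<le> \<Phi>p a"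
    and f6: "\<And>a b. 1 \<le> a \<Longrightarrow> a \<le> b \<Longrightarrow> (b - a) * \<Phi>m (b - 1) \<le> Bp a - Bp b"
    and f7: "\<And>a b. \<beta> \<le> a \<Longrightarrow> a \<le> b \<Longrightarrow> (b - a) * \<Phi>p (b - 1) \<le> Bm a - Bm b"
    and f8: "\<And>s. s \<ge> 1 \<Longrightarrow> Bp s \<ge> 0" and f9: "\<And>s. s \<ge> \<beta> \<Longrightarrow> Bm s \<ge> 0"
    and f10: "\<And>s. s \<ge> 1 \<Longrightarrow> (1 + \<epsilon>) / s * Bp s + \<epsilon> * \<Phi>m (s - 1) \<le> \<Phi>p s"
    and f11: "\<And>s. s \<ge> \<beta> \<Longrightarrow> (1 + \<epsilon>) / s * Bm s + \<epsilon> * \<Phi>p (s - 1) \<le> \<Phi>m s"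
    by (rule strict_sieve_functions[OF \<delta>]) (rule that; assumption)
  define P where "P = {p::nat. prime p \<and> odd p}"
  have Pp: "prime p" if "p \<in> P" for p using that by (simp add: P_def)
  have gP: "0 \<le> g p \<and> g p \<le> 1 / real p + 2 / (real p * (real p - 1))" if "p \<in> P" for p
    using g_prime_bounds[of p] that by (simp add: P_def)
  obtain w where w: "w \<ge> 4" and
    dim: "\<And>n m. w \<le> n \<Longrightarrow> n \<le> m \<Longrightarrow> ln (real n) / ln (real m) \<le> (1 + \<epsilon>) * (\<Prod>p\<in>P \<inter> {n..<m}. 1 - g p)"
    using sieve_dimension[of P g \<epsilon>, OF Pp gP \<epsilon>] by blast
  define W where "W = (\<lambda>z. \<Prod>p\<in>P \<inter> {..<z}. 1 - g p)"
  have W0: "W z > 0" for z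
    unfolding W_def by (rule prod_pos) (use g_prime_bounds in \<open>auto simp: P_def\<close>)
  have Wdim: "W n \<le> (1 + \<epsilon>) * W m * ln (real m) / ln (real n)" if "w \<le> n" "n \<le> m" for n m
  proof -
    have l: "0 < ln (real n)" "0 < ln (real m)" using that w by auto
    have split: "P \<inter> {..<m} = (P \<inter> {..<n}) \<union> (P \<inter> {n..<m})" using that by auto
    have "W m = W n * (\<Prod>p\<in>P \<inter> {n..<m}. 1 - g p)"
      unfolding W_def split by (rule prod.union_disjoint) auto
    then have "W n * (ln (real n) / ln (real m)) \<le> (1 + \<epsilon>) * W m"
      using mult_left_mono[OF dim[OF that], of "W n"] W0[of n] by (simp add: mult_ac)
    then show ?thesis using l by (simp add: field_simps)
  qed
  obtain C where C: "C > 0" and R': "\<And>x::real. x \<ge> 2 \<Longrightarrow>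
        (\<Sum>d | d > 0 \<and> real d \<le> x powr (\<theta> - \<epsilon>0) \<and> odd d \<and> squarefree d.
           \<bar>real (\<Sum>n | n > 0 \<and> real n \<le> x \<and> n mod 4 = 3 \<and> d dvd n. r (n - 2) * r (n + 2))
              - 8 * g d * x\<bar>) \<le> C * (x / ln x powr 2)"
  proof -
    have "(2::real) > 0" by simp
    with R \<epsilon>0 show ?thesis using that unfolding hypothesis_R_def by blast
  qed
  obtain C3 where C3: "C3 > 0" and
    r_bound: "\<And>n x. n mod 4 = 3 \<Longrightarrow> real n \<le> x \<Longrightarrow> real (r (n - 2) * r (n + 2)) \<le> C3 * x powr (\<tau> / 2)"
    using r_product_bound[of "\<tau> / 2"] \<tau>0 by auto
  define c1 where "c1 = (1 - \<Phi>m (2 + \<delta>)) * (W w * ln (real w) / ((1 + \<epsilon>) * \<tau>))"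
  have c1: "c1 > 0" using \<Phi>1 W0[of w] w \<epsilon> \<tau>0 by (simp add: c1_def)

  have "eventually (\<lambda>x. x powr \<alpha> * fact w \<le> x powr (\<theta> - \<epsilon>0)) at_top"
    using \<alpha> by real_asymp
  moreover have "eventually (\<lambda>x. x powr (1 / (real N + 1)) \<le> x powr \<tau> - 1) at_top"
    using \<tau>N \<tau>0 by real_asymp
  moreover have "eventually (\<lambda>x. x powr \<tau> \<ge> real w + 4) at_top"
    using \<tau>0 by real_asymp
  moreover have "eventually (\<lambda>x. C * (x / ln x powr 2) + 2 * C3 * x powr (1 - \<tau> / 2) \<le> 6 * c1 * (x / ln x)) at_top"
    using \<tau>0 c1 by real_asymp
  ultimately have "eventually (\<lambda>x. x powr \<alpha> * fact w \<le> x powr (\<theta> - \<epsilon>0) \<and>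
      x powr (1 / (real N + 1)) \<le> x powr \<tau> - 1 \<and> x powr \<tau> \<ge> real w + 4 \<and>
      C * (x / ln x powr 2) + 2 * C3 * x powr (1 - \<tau> / 2) \<le> 6 * c1 * (x / ln x)) at_top"
    by eventually_elim simp
  then obtain x1 where x1: "\<And>x. x \<ge> x1 \<Longrightarrow> x powr \<alpha> * fact w \<le> x powr (\<theta> - \<epsilon>0) \<and>
      x powr (1 / (real N + 1)) \<le> x powr \<tau> - 1 \<and> x powr \<tau> \<ge> real w + 4 \<and>
      C * (x / ln x powr 2) + 2 * C3 * x powr (1 - \<tau> / 2) \<le> 6 * c1 * (x / ln x)"
    unfolding eventually_at_top_linorder by blast
  show ?thesis
  proof (rule that[OF c1, of "max 3 x1"])
    fix x :: real assume "x \<ge> max 3 x1"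
    then have x3: "x \<ge> 3" and e1: "x powr \<alpha> * fact w \<le> x powr (\<theta> - \<epsilon>0)"
      and e2: "x powr (1 / (real N + 1)) \<le> x powr \<tau> - 1" and e3: "x powr \<tau> \<ge> real w + 4"
      and e4: "C * (x / ln x powr 2) + 2 * C3 * x powr (1 - \<tau> / 2) \<le> 6 * c1 * (x / ln x)"
      using x1[of x] by auto
    have lnx: "ln x > 0" using x3 by simp
    define M where "M = {n::nat. n > 0 \<and> real n \<le> x \<and> n mod 4 = 3}"
    define a where "a = (\<lambda>n::nat. real (r (n - 2) * r (n + 2)))"
    have finM: "finite M"
      by (rule finite_subset[of _ "{..nat \<lfloor>x\<rfloor>}"]) (auto simp: M_def le_nat_floor)
    interpret sifting P M a g "8 * x"
    proof
      show "g 1 = 1" by (simp add: g_def)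
      show "g p < 1" if "p \<in> P" for p using g_prime_bounds[of p] that by (simp add: P_def)
      show "g (q * p) = g q * g p" if "p \<in> P" "0 < q" "\<not> p dvd q" for p q
        using that by (intro g_mult_prime) (auto simp: P_def)
    qed (use finM x3 in \<open>auto simp: a_def P_def g_nonneg\<close>)
    have VW: "V = W" by (simp add: fun_eq_iff V_def W_def)
    define z where "z = nat \<lfloor>x powr \<tau>\<rfloor>"
    have z_le: "real z \<le> x powr \<tau>" by (simp add: z_def)
    have z_gt: "real z > x powr \<tau> - 1" unfolding z_def by linarith
    have z3: "z \<ge> 3" "w \<le> z" using z_gt e3 by linarith+
    have lnz: "ln (real z) > 0" "ln (real z) \<le> \<tau> * ln x"
    proof -
      show "ln (real z) > 0" using z3 by simp
      have "ln (real z) \<le> ln (x powr \<tau>)" using z_le z3 by (subst ln_le_cancel_iff) auto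
      then show "ln (real z) \<le> \<tau> * ln x" using x3 by (simp add: ln_powr)
    qed
    define D where "D = x powr \<alpha>"
    have D1: "1 \<le> D" using x3 \<alpha> by (simp add: D_def ge_one_powr_ge_zero)
    have lnD: "ln D = (2 + \<delta>) * (\<tau> * ln x)" using x3 \<tau>\<alpha> by (simp add: D_def ln_powr mult.assoc[symmetric])
    have lnDz: "(2 + \<delta>) * ln (real z) \<le> ln D" using lnz \<delta> unfolding lnD by (intro mult_left_mono) auto
    have "\<beta> * ln (real z) \<le> ln D"
      using \<beta> lnz lnDz mult_right_mono[of \<beta> "2 + \<delta>" "ln (real z)"] by linarith
    then have sieve: "sifted 1 z \<ge> 8 * x * g 1 * V z * (1 - \<Phi>m (ln D / ln (real z))) - total_error 1 (D * fact w) z"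
    proof (rule linear_sieve(2)[of \<beta> \<epsilon> \<Phi>m \<Phi>p Bp Bm w z 1 D, rotated -1])
      show "V n \<le> (1 + \<epsilon>) * V m * ln (real m) / ln (real n)" if "w \<le> n" "n \<le> m" for n m
        using Wdim[OF that] by (simp add: VW)
      show "\<not> p dvd 1" if "p \<in> P" for p using Pp[OF that] by auto
    qed (use \<beta> \<epsilon> f1 f2 f3 f4 f5 f6 f7 f8 f9 f10 f11 w z3 D1 in simp_all)
    have main_term: "8 * c1 * (x / ln x) \<le> 8 * x * g 1 * V z * (1 - \<Phi>m (ln D / ln (real z)))"
    proof -
      have "2 + \<delta> \<le> ln D / ln (real z)" using lnDz lnz by (simp add: pos_le_divide_eq)
      then have 1: "1 - \<Phi>m (2 + \<delta>) \<le> 1 - \<Phi>m (ln D / ln (real z))" using f4 by simp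
      have "W w * ln (real w) \<le> (1 + \<epsilon>) * W z * ln (real z)"
        using Wdim[OF order_refl z3(2)] w by (simp add: field_simps)
      also have "\<dots> \<le> (1 + \<epsilon>) * W z * (\<tau> * ln x)"
        using lnz \<epsilon> W0[of z] by (intro mult_left_mono) auto
      also have "\<dots> = W z * ((1 + \<epsilon>) * \<tau> * ln x)" by (simp add: mult_ac)
      finally have "W w * ln (real w) / ((1 + \<epsilon>) * \<tau>) / ln x \<le> W z"
        using lnx \<epsilon> \<tau>0 by (simp add: pos_divide_le_eq)
      then have "(1 - \<Phi>m (2 + \<delta>)) * (W w * ln (real w) / ((1 + \<epsilon>) * \<tau>) / ln x)
          \<le> (1 - \<Phi>m (ln D / ln (real z))) * W z"
        using 1 \<Phi>1 w W0[of w] \<epsilon> \<tau>0 lnx by (intro mult_mono) auto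
      then have "c1 / ln x \<le> (1 - \<Phi>m (ln D / ln (real z))) * W z" by (simp add: c1_def)
      then have "8 * x * (c1 / ln x) \<le> 8 * x * ((1 - \<Phi>m (ln D / ln (real z))) * W z)"
        using x3 by (intro mult_left_mono) auto
      then show ?thesis using gamma_one by (simp add: VW mult_ac)
    qed
    have error_term: "total_error 1 (D * fact w) z \<le> C * (x / ln x powr 2)"
    proof -
      let ?S = "{d. d > 0 \<and> real d \<le> x powr (\<theta> - \<epsilon>0) \<and> odd d \<and> squarefree d}"
      have "total_error 1 (D * fact w) z \<le> (\<Sum>d\<in>?S. \<bar>remainder d\<bar>)"
        unfolding total_error_def mult_1
      proof (rule sum_mono2)
        show "finite ?S"
          by (rule finite_subset[of _ "{..nat \<lfloor>x powr (\<theta> - \<epsilon>0)\<rfloor>}"]) (auto simp: le_nat_floor)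
        show "{d. d \<in> divisors_upto z \<and> real d \<le> D * fact w} \<subseteq> ?S"
        proof
          fix d assume "d \<in> {d. d \<in> divisors_upto z \<and> real d \<le> D * fact w}"
          then have d: "d \<in> divisors_upto z" "real d \<le> D * fact w" by auto
          have "\<not> 2 dvd d" using prime_dvd_divisors_upto[OF d(1), of 2] by (auto simp: P_def)
          then show "d \<in> ?S"
            using d e1 divisors_upto_bounds[OF d(1)] squarefree_divisors_upto[OF d(1)]
            by (auto simp: D_def)
        qed
      qed simp
      also have "\<dots> = (\<Sum>d\<in>?S.
           \<bar>real (\<Sum>n | n > 0 \<and> real n \<le> x \<and> n mod 4 = 3 \<and> d dvd n. r (n - 2) * r (n + 2)) - 8 * g d * x\<bar>)"
        unfolding remainder_def by (simp add: M_def a_def conj_assoc mult_ac)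
      also have "\<dots> \<le> C * (x / ln x powr 2)" using R'[of x] x3 by simp
      finally show ?thesis .
    qed
    define T where "T = {n \<in> M. \<forall>p\<in>P. p < z \<longrightarrow> \<not> p dvd n}"
    define G where "G = {n \<in> T. squarefree n}"
    define B where "B = {n \<in> T. \<not> squarefree n}"
    have finT: "finite T" using finM by (simp add: T_def)
    have rough: "z \<le> p" if "n \<in> T" "prime p" "p dvd n" for n p
    proof -
      have "n mod 4 = 3" using that(1) by (simp add: T_def M_def)
      then have "odd n" by presburger
      then have "odd p" using that(3) by auto
      then show ?thesis using that by (auto simp: T_def P_def not_less[symmetric])
    qed
    have "sifted 1 z = (\<Sum>n\<in>T. a n)" by (simp add: sifted_def T_def)
    also have "T = G \<union> B" "G \<inter> B = {}" by (auto simp: G_def B_def)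
    then have "(\<Sum>n\<in>T. a n) = (\<Sum>n\<in>G. a n) + (\<Sum>n\<in>B. a n)"
      using finT by (simp add: sum.union_disjoint)
    finally have split: "sifted 1 z = (\<Sum>n\<in>G. a n) + (\<Sum>n\<in>B. a n)" .
    have B_bound: "(\<Sum>n\<in>B. a n) \<le> 2 * C3 * x powr (1 - \<tau> / 2)"
    proof -
      have "0 < n \<and> real n \<le> x \<and> (\<exists>k\<ge>z. k\<^sup>2 dvd n)" if n: "n \<in> B" for n
      proof -
        have n0: "n > 0" "real n \<le> x" "n \<in> T" using n by (auto simp: B_def T_def M_def)
        obtain k where k: "k\<^sup>2 dvd n" "\<not> k dvd 1" using n by (auto simp: B_def squarefree_def)
        then obtain p where p: "prime p" "p dvd k" using prime_factor_nat[of k] by auto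
        then have "p\<^sup>2 dvd n" using k by (meson dvd_power_same dvd_trans)
        moreover have "p dvd n" using p k by (meson dvd_power dvd_trans pos2)
        ultimately show ?thesis using n0 rough[OF n0(3) p(1)] by blast
      qed
      then have cB: "real (card B) \<le> x / (real z - 1)"
        using z3 x3 by (intro card_square_multiples_le) auto
      have "(\<Sum>n\<in>B. a n) \<le> (\<Sum>n\<in>B. C3 * x powr (\<tau> / 2))"
        unfolding a_def by (intro sum_mono r_bound) (auto simp: B_def T_def M_def)
      also have "\<dots> = real (card B) * (C3 * x powr (\<tau> / 2))" by simp
      also have "\<dots> \<le> (2 * x powr (1 - \<tau>)) * (C3 * x powr (\<tau> / 2))"
      proof (rule mult_right_mono)
        have "x powr \<tau> / 2 \<le> real z - 1" using z_gt e3 by simp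
        then have "x / (real z - 1) \<le> x / (x powr \<tau> / 2)"
          using x3 z3 by (intro divide_left_mono mult_pos_pos) auto
        also have "\<dots> = 2 * x powr (1 - \<tau>)" using x3 by (simp add: powr_diff)
        finally show "real (card B) \<le> 2 * x powr (1 - \<tau>)" using cB by simp
      qed (use C3 in simp)
      also have "\<dots> = 2 * C3 * (x powr (1 - \<tau>) * x powr (\<tau> / 2))" by simp
      also have "x powr (1 - \<tau>) * x powr (\<tau> / 2) = x powr (1 - \<tau> / 2)"
        by (simp add: powr_add[symmetric])
      finally show ?thesis .
    qed
    have "(\<Sum>n\<in>G. a n) \<le> (\<Sum>n\<in>G. real (2 * card (sl2_points n)))"
      unfolding a_def of_nat_le_iff
      by (intro sum_mono, unfold of_nat_le_iff, intro r_mult_r_le_sl2_points) (auto simp: G_def T_def M_def)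
    also have "\<dots> = 2 * real (\<Sum>n\<in>G. card (sl2_points n))" by (simp add: sum_distrib_left)
    also have "\<dots> \<le> 2 * real (s_Gamma N x)"
    proof -
      have "(\<Sum>n\<in>G. card (sl2_points n)) \<le> s_Gamma N x"
      proof (rule sum_sl2_points_le_s_Gamma)
        fix n assume n: "n \<in> G"
        then have nT: "n \<in> T" "n > 0" "real n \<le> x" by (auto simp: G_def T_def M_def)
        have "x = (x powr (1 / (real N + 1))) powr (real N + 1)" using x3 by (simp add: powr_powr)
        also have "\<dots> < real z powr (real N + 1)"
          using e2 z_gt x3 by (intro powr_less_mono2) auto
        also have "\<dots> = real z ^ Suc N" using z3 powr_realpow[of "real z" "Suc N"] by (simp add: add.commute)
        finally have "omega n \<le> N"
          using nT z3 rough[OF nT(1)] by (intro omega_le_of_rough[of n z]) auto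
        then show "real n \<le> x \<and> squarefree n \<and> omega n \<le> N" using n nT by (simp add: G_def)
      qed
      then have "real (\<Sum>n\<in>G. card (sl2_points n)) \<le> real (s_Gamma N x)" by (simp only: of_nat_le_iff)
      then show ?thesis by linarith
    qed
    finally have "(\<Sum>n\<in>G. a n) \<le> 2 * real (s_Gamma N x)" .
    then have "8 * c1 * (x / ln x) \<le> 2 * real (s_Gamma N x) + 6 * c1 * (x / ln x)"
      using sieve main_term error_term split B_bound e4 by linarith
    then show "c1 * (x / ln x) \<le> real (s_Gamma N x)" by linarith
  qed
qed

lemma s_Gamma_lower:
  fixes \<theta> :: real
  assumes \<theta>: "0 < \<theta>" "\<theta> \<le> 1" and R: "hypothesis_R \<theta>"
  shows "\<exists>c>0. \<forall>x::real. x > 3 \<longrightarrow> real (s_Gamma (nat \<lfloor>2 / \<theta>\<rfloor>) x) \<ge> c * (x / ln x)"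
proof -
  obtain c x0 where c: "c > 0"
    "\<And>x. x \<ge> x0 \<Longrightarrow> c * (x / ln x) \<le> real (s_Gamma (nat \<lfloor>2 / \<theta>\<rfloor>) x)"
    using s_Gamma_lower_eventually[OF assms] by blast
  define X where "X = max 3 x0"
  define c' where "c' = min c (ln 3 / X)"
  have X: "X \<ge> 3" "X \<ge> x0" by (auto simp: X_def)
  have c': "c' > 0" "c' \<le> c" "c' \<le> ln 3 / X" using c X by (auto simp: c'_def)
  have "2 / \<theta> \<ge> 2" using \<theta> by (simp add: field_simps)
  then have N: "1 \<le> nat \<lfloor>2 / \<theta>\<rfloor>" by linarith
  have "real (s_Gamma (nat \<lfloor>2 / \<theta>\<rfloor>) x) \<ge> c' * (x / ln x)" if x: "x > 3" for x
  proof (cases "x \<ge> X")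
    case True
    have "c' * (x / ln x) \<le> c * (x / ln x)" using c' x by (intro mult_right_mono) auto
    then show ?thesis using c(2)[of x] True X by linarith
  next
    case False
    have "x / ln x \<le> X / ln 3" using False x by (intro frac_le) auto
    then have "c' * (x / ln x) \<le> ln 3 / X * (X / ln 3)" using c' X x by (intro mult_mono) auto
    also have "\<dots> = 1" using X by simp
    also have "\<dots> \<le> real (s_Gamma (nat \<lfloor>2 / \<theta>\<rfloor>) x)" using s_Gamma_pos[OF N, of x] x by simp
    finally show ?thesis .
  qed
  then show ?thesis using c' by blast
qed

theorem theorem3:
  shows "(\<forall>\<theta>::real. 0 < \<theta> \<and> \<theta> \<le> 1 \<and> hypothesis_R \<theta> \<longrightarrow>
            (\<exists>c>0. \<forall>x::real. x > 3 \<longrightarrow>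
               real (s_Gamma (nat \<lfloor>2 / \<theta>\<rfloor>) x) \<ge> c * (x / ln x)))
       \<and> (hypothesis_R (1 / 2) \<longrightarrow>
            (\<exists>c>0. \<forall>x::real. x > 3 \<longrightarrow> real (s_Gamma 4 x) \<ge> c * (x / ln x)))"
proof -
  have "nat \<lfloor>2 / (1 / 2 :: real)\<rfloor> = 4" by simp
  then show ?thesis using s_Gamma_lower[of "1 / 2"] s_Gamma_lower by auto
qed

end
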